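(* Let $l\ge 2$ be an even integer, let $\mathfrak g$ be the simple complex Lie algebra of type $A_l$ and $\hat{\mathfrak g}$ the associated affine Lie algebra. The maximal proper $\hat{\mathfrak g}$-submodule of $N(-\tfrac12(l+1),0)$ is $J(-\tfrac12(l+1),0)=U(\hat{\mathfrak g})v$, where $$v=\sum_{i=1}^{l}\frac{l-2i+1}{l+1}\,h_i(-1)e_\theta(-1)\mathbf 1-\sum_{i=1}^{l-1}e_{\epsilon_1-\epsilon_{i+1}}(-1)\,e_{\epsilon_{i+1}-\epsilon_{l+1}}(-1)\mathbf 1-\frac12(l-1)\,e_\theta(-2)\mathbf 1 .$$
   Context: $\mathfrak g$ has root system $\{\epsilon_i-\epsilon_j : i\ne j,\ 1\le i,j\le l+1\}$, positive roots $\epsilon_i-\epsilon_j$ ($i<j$), simple roots $\alpha_i=\epsilon_i-\epsilon_{i+1}$, highest root $\theta=\epsilon_1-\epsilon_{l+1}$, invariant form $(\cdot,\cdot)$ normalized by $(\theta,\theta)=2$, and Chevalley generators $e_i,f_i,h_i$ ($1\le i\le l$). Root vectors for positive roots are fixed by $e_{\epsilon_i-\epsilon_j}=[e_{j-1},[e_{j-2},[\dots[e_{i+1},e_i]\dots]]]$ for $i<j$ (so $e_{\epsilon_i-\epsilon_{i+1}}=e_i$), and $e_\theta=e_{\epsilon_1-\epsilon_{l+1}}$. The affine Lie algebra is $\hat{\mathfrak g}=\mathfrak g\otimes\mathbb C[t,t^{-1}]\oplus\mathbb Cc$ with $c$ central and $[x\otimes t^m,y\otimes t^n]=[x,y]\otimes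 t^{m+n}+m\delta_{m+n,0}(x,y)c$. Write $x(n)$ for the action of $x\otimes t^n$. For $k\in\mathbb C$, $N(k,0)=U(\hat{\mathfrak g})\otimes_{U(\mathfrak g\oplus\mathbb Cc\oplus\mathfrak g\otimes t\mathbb C[t])}\mathbb C$, where $\mathfrak g\otimes\mathbb C[t]$ acts trivially on $\mathbb C$ and $c$ acts as $k$; $\mathbf 1=1\otimes 1\in N(k,0)$; $J(k,0)$ denotes the maximal proper submodule of $N(k,0)$. *)

theory Defs
  imports Complex_Main "HOL-Library.Poly_Mapping"
begin

section \<open>Complex Lie algebras\<close>

class complex_lie_algebra = ab_group_add +
  fixes scaleC :: "complex \<Rightarrow> 'a \<Rightarrow> 'a"  (infixr \<open>*\<^sub>C\<close> 75)
    and lie :: "'a \<Rightarrow> 'a \<Rightarrow> 'a"  (\<open>\<^bold>[_,/ _\<^bold>]\<close>)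
  assumes scaleC_add_right: "a *\<^sub>C (x + y) = a *\<^sub>C x + a *\<^sub>C y"
    and scaleC_add_left: "(a + b) *\<^sub>C x = a *\<^sub>C x + b *\<^sub>C x"
    and scaleC_scaleC: "a *\<^sub>C (b *\<^sub>C x) = (a * b) *\<^sub>C x"
    and scaleC_one: "1 *\<^sub>C x = x"
    and lie_add_left: "\<^bold>[x + y, z\<^bold>] = \<^bold>[x, z\<^bold>] + \<^bold>[y, z\<^bold>]"
    and lie_add_right: "\<^bold>[x, y + z\<^bold>] = \<^bold>[x, y\<^bold>] + \<^bold>[x, z\<^bold>]"
    and lie_scale_left: "\<^bold>[a *\<^sub>C x, y\<^bold>] = a *\<^sub>C \<^bold>[x, y\<^bold>]"
    and lie_scale_right: "\<^bold>[x, a *\<^sub>C y\<^bold>] = a *\<^sub>C \<^bold>[x, y\<^bold>]"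
    and lie_self: "\<^bold>[x, x\<^bold>] = 0"
    and jacobi: "\<^bold>[x, \<^bold>[y, z\<^bold>]\<^bold>] + \<^bold>[y, \<^bold>[z, x\<^bold>]\<^bold>] + \<^bold>[z, \<^bold>[x, y\<^bold>]\<^bold>] = 0"

lemma vector_space_scaleC:
  "vector_space (scaleC :: complex \<Rightarrow> 'a::complex_lie_algebra \<Rightarrow> 'a)"
  by standard (simp_all add: scaleC_add_right scaleC_add_left scaleC_scaleC scaleC_one)

lemma scaleC_zero_right: "a *\<^sub>C (0 :: 'a::complex_lie_algebra) = 0"
  using scaleC_add_right[of a 0 0] by simp

lemma lie_zero_left: "\<^bold>[0, x :: 'a::complex_lie_algebra\<^bold>] = 0"
  using lie_add_left[of 0 0 x] by simp

lemma lie_zero_right: "\<^bold>[x :: 'a::complex_lie_algebra, 0\<^bold>] = 0"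
  using lie_add_right[of x 0 0] by simp

lemma lie_skew: "\<^bold>[x, y :: 'a::complex_lie_algebra\<^bold>] = - \<^bold>[y, x\<^bold>]"
proof -
  have "0 = \<^bold>[x + y, x + y\<^bold>]" by (simp only: lie_self)
  also have "\<dots> = \<^bold>[x, x + y\<^bold>] + \<^bold>[y, x + y\<^bold>]" by (rule lie_add_left)
  also have "\<dots> = \<^bold>[x, y\<^bold>] + \<^bold>[y, x\<^bold>]" by (simp add: lie_add_right lie_self)
  finally show ?thesis by (simp add: eq_neg_iff_add_eq_0)
qed

definition lie_subalgebra :: "'a::complex_lie_algebra set \<Rightarrow> bool" where
  "lie_subalgebra S \<longleftrightarrow> module.subspace scaleC S \<and> (\<forall>x\<in>S. \<forall>y\<in>S. \<^bold>[x, y\<^bold>] \<in> S)"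

definition lie_ideal :: "'a::complex_lie_algebra set \<Rightarrow> bool" where
  "lie_ideal I \<longleftrightarrow> module.subspace scaleC I \<and> (\<forall>x. \<forall>y\<in>I. \<^bold>[x, y\<^bold>] \<in> I)"

definition simple_lie_algebra :: "'a::complex_lie_algebra itself \<Rightarrow> bool" where
  "simple_lie_algebra _ \<longleftrightarrow>
     (\<exists>x y :: 'a. \<^bold>[x, y\<^bold>] \<noteq> 0) \<and>
     (\<forall>I :: 'a set. lie_ideal I \<longrightarrow> I = {0} \<or> I = UNIV)"

class complex_lie_algebra_form = complex_lie_algebra +
  fixes inv_form :: "'a \<Rightarrow> 'a \<Rightarrow> complex"
  assumes form_sym: "inv_form x y = inv_form y x"
    and form_add_left: "inv_form (x + y) z = inv_form x z + inv_form y z"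
    and form_scale_left: "inv_form (a *\<^sub>C x) y = a * inv_form x y"
    and form_invariant: "inv_form (\<^bold>[x, y\<^bold>]) z = inv_form x (\<^bold>[y, z\<^bold>])"

lemma form_add_right:
  "inv_form x (y + z :: 'a::complex_lie_algebra_form) = inv_form x y + inv_form x z"
  by (metis form_sym form_add_left)

lemma form_scale_right:
  "inv_form x (a *\<^sub>C y :: 'a::complex_lie_algebra_form) = a * inv_form x y"
  by (metis form_sym form_scale_left)

lemma form_zero_left: "inv_form (0 :: 'a::complex_lie_algebra_form) x = 0"
  using form_add_left[of 0 0 x] by simp

lemma form_zero_right: "inv_form x (0 :: 'a::complex_lie_algebra_form) = 0"
  using form_add_right[of x 0 0] by simp

lemma form_minus_right: "inv_form x (- y :: 'a::complex_lie_algebra_form) = - inv_form x y"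
  using form_add_right[of x y "- y"] by (simp add: form_zero_right eq_neg_iff_add_eq_0 add.commute)


section \<open>Type \<open>A\<close>\<close>

definition cartan_A :: "nat \<Rightarrow> nat \<Rightarrow> int" where
  "cartan_A i j = (if i = j then 2 else if i = Suc j \<or> j = Suc i then -1 else 0)"

text \<open>The Lie algebra is the whole type \<open>'g\<close>; \<open>e i\<close>, \<open>f i\<close>, \<open>h i\<close> are meaningful for
  \<open>1 \<le> i \<le> l\<close> only. The relations are those of Serre's presentation.\<close>

definition chevalley_generators_A ::
  "nat \<Rightarrow> (nat \<Rightarrow> 'g::complex_lie_algebra) \<Rightarrow> (nat \<Rightarrow> 'g) \<Rightarrow> (nat \<Rightarrow> 'g) \<Rightarrow> bool" where
  "chevalley_generators_A l e f h \<longleftrightarrow>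
     (\<forall>S. lie_subalgebra S \<and> e ` {1..l} \<subseteq> S \<and> f ` {1..l} \<subseteq> S \<longrightarrow> S = UNIV) \<and>
     (\<forall>i\<in>{1..l}. \<forall>j\<in>{1..l}.
        \<^bold>[h i, h j\<^bold>] = 0 \<and>
        \<^bold>[e i, f j\<^bold>] = (if i = j then h i else 0) \<and>
        \<^bold>[h i, e j\<^bold>] = of_int (cartan_A i j) *\<^sub>C e j \<and>
        \<^bold>[h i, f j\<^bold>] = - (of_int (cartan_A i j) *\<^sub>C f j) \<and>
        (i \<noteq> j \<longrightarrow> (lie (e i) ^^ nat (1 - cartan_A i j)) (e j) = 0 \<and>
                  (lie (f i) ^^ nat (1 - cartan_A i j)) (f j) = 0))"

definition simple_type_A ::
  "nat \<Rightarrow> (nat \<Rightarrow> 'g::complex_lie_algebra) \<Rightarrow> (nat \<Rightarrow> 'g) \<Rightarrow> (nat \<Rightarrow> 'g) \<Rightarrow> bool" where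
  "simple_type_A l e f h \<longleftrightarrow> simple_lie_algebra TYPE('g) \<and> chevalley_generators_A l e f h"

text \<open>\<open>root_vec e i j\<close> is the root vector for \<open>\<epsilon>\<^sub>i - \<epsilon>\<^sub>j\<close>, where \<open>1 \<le> i < j\<close>
  (junk value \<open>0\<close> if \<open>i \<ge> j\<close>).\<close>

fun root_vec :: "(nat \<Rightarrow> 'g::complex_lie_algebra) \<Rightarrow> nat \<Rightarrow> nat \<Rightarrow> 'g" where
  "root_vec e i 0 = 0"
| "root_vec e i (Suc j) =
     (if j < i then 0 else if j = i then e i else \<^bold>[e j, root_vec e i j\<^bold>])"

definition e_theta :: "nat \<Rightarrow> (nat \<Rightarrow> 'g::complex_lie_algebra) \<Rightarrow> 'g" where
  "e_theta l e = root_vec e 1 (l + 1)"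

text \<open>\<open>(\<theta>, \<theta>) = 2\<close>: the form on the dual of the Cartan subalgebra is transported from the
  Cartan subalgebra, so \<open>(\<theta>, \<theta>) = (t, t)\<close> where \<open>t\<close> is the element of the Cartan subalgebra
  representing \<open>\<theta>\<close>, i.e. \<open>\<theta>(x) = (t, x)\<close>; and \<open>\<theta>\<close> is the weight of \<open>e_theta\<close>.\<close>

definition form_normalized ::
  "nat \<Rightarrow> (nat \<Rightarrow> 'g::complex_lie_algebra_form) \<Rightarrow> (nat \<Rightarrow> 'g) \<Rightarrow> bool" where
  "form_normalized l e h \<longleftrightarrow>
     (\<exists>t \<in> module.span scaleC (h ` {1..l}).
        (\<forall>x \<in> module.span scaleC (h ` {1..l}).
            \<^bold>[x, e_theta l e\<^bold>] = inv_form t x *\<^sub>C e_theta l e) \<and>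
        inv_form t t = 2)"


section \<open>The affine Lie algebra\<close>

text \<open>\<open>Affine p a\<close> is \<open>(\<Sum>n. p n \<otimes> t\<^sup>n) + a c\<close>.\<close>

context notes [[typedef_overloaded]]
begin

datatype 'g affine =
  Affine (loop_part: "int \<Rightarrow>\<^sub>0 'g::complex_lie_algebra_form") (central_part: complex)

end

definition loop_bracket ::
  "(int \<Rightarrow>\<^sub>0 'g::complex_lie_algebra) \<Rightarrow> (int \<Rightarrow>\<^sub>0 'g) \<Rightarrow> (int \<Rightarrow>\<^sub>0 'g)" where
  "loop_bracket p q =
     (\<Sum>m\<in>Poly_Mapping.keys p. \<Sum>n\<in>Poly_Mapping.keys q.
        Poly_Mapping.single (m + n) (\<^bold>[Poly_Mapping.lookup p m, Poly_Mapping.lookup q n\<^bold>]))"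

definition loop_cocycle ::
  "(int \<Rightarrow>\<^sub>0 'g::complex_lie_algebra_form) \<Rightarrow> (int \<Rightarrow>\<^sub>0 'g) \<Rightarrow> complex" where
  "loop_cocycle p q =
     (\<Sum>m\<in>Poly_Mapping.keys p. \<Sum>n\<in>Poly_Mapping.keys q.
        if m + n = 0
        then of_int m * inv_form (Poly_Mapping.lookup p m) (Poly_Mapping.lookup q n) else 0)"

definition loop_scale :: "complex \<Rightarrow> (int \<Rightarrow>\<^sub>0 'g::complex_lie_algebra) \<Rightarrow> (int \<Rightarrow>\<^sub>0 'g)" where
  "loop_scale a p = Poly_Mapping.map (scaleC a) p"

lemma lookup_loop_scale:
  "Poly_Mapping.lookup (loop_scale a p) n = a *\<^sub>C Poly_Mapping.lookup p n"
  by (simp add: loop_scale_def Poly_Mapping.map.rep_eq when_def scaleC_zero_right)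

lemma biadditive_sum_keys:
  fixes F :: "int \<Rightarrow> int \<Rightarrow> 'g::ab_group_add \<Rightarrow> 'g \<Rightarrow> 'b::comm_monoid_add"
  assumes "finite A" "finite B" "Poly_Mapping.keys p \<subseteq> A" "Poly_Mapping.keys q \<subseteq> B"
    and z: "\<And>m n y. F m n 0 y = 0" "\<And>m n x. F m n x 0 = 0"
  shows "(\<Sum>m\<in>Poly_Mapping.keys p. \<Sum>n\<in>Poly_Mapping.keys q.
            F m n (Poly_Mapping.lookup p m) (Poly_Mapping.lookup q n)) =
         (\<Sum>m\<in>A. \<Sum>n\<in>B. F m n (Poly_Mapping.lookup p m) (Poly_Mapping.lookup q n))"
proof -
  have "(\<Sum>n\<in>Poly_Mapping.keys q. F m n (Poly_Mapping.lookup p m) (Poly_Mapping.lookup q n)) =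
        (\<Sum>n\<in>B. F m n (Poly_Mapping.lookup p m) (Poly_Mapping.lookup q n))" for m
    using assms by (intro sum.mono_neutral_left) (auto simp: in_keys_iff)
  then show ?thesis
    using assms by (simp, intro sum.mono_neutral_left) (auto simp: in_keys_iff)
qed

lemma loop_bracket_wide:
  assumes "finite A" "finite B" "Poly_Mapping.keys p \<subseteq> A" "Poly_Mapping.keys q \<subseteq> B"
  shows "loop_bracket p q = (\<Sum>m\<in>A. \<Sum>n\<in>B.
     Poly_Mapping.single (m + n) (\<^bold>[Poly_Mapping.lookup p m, Poly_Mapping.lookup q n\<^bold>]))"
  unfolding loop_bracket_def
  using biadditive_sum_keys[OF assms, where F = "\<lambda>m n x y. Poly_Mapping.single (m + n) (\<^bold>[x, y\<^bold>])"]
  by (simp add: lie_zero_left lie_zero_right)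

lemma loop_cocycle_wide:
  assumes "finite A" "finite B" "Poly_Mapping.keys p \<subseteq> A" "Poly_Mapping.keys q \<subseteq> B"
  shows "loop_cocycle p q = (\<Sum>m\<in>A. \<Sum>n\<in>B. if m + n = 0
     then of_int m * inv_form (Poly_Mapping.lookup p m) (Poly_Mapping.lookup q n) else 0)"
  unfolding loop_cocycle_def
  using biadditive_sum_keys[OF assms,
      where F = "\<lambda>m n x y. if m + n = 0 then of_int m * inv_form x y else 0"]
  by (simp add: form_zero_left form_zero_right)

lemma loop_bracket_add_left: "loop_bracket (p + p') q = loop_bracket p q + loop_bracket p' q"
proof -
  let ?A = "Poly_Mapping.keys p \<union> Poly_Mapping.keys p'" and ?B = "Poly_Mapping.keys q"
  have "loop_bracket r q = (\<Sum>m\<in>?A. \<Sum>n\<in>?B.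
     Poly_Mapping.single (m + n) (\<^bold>[Poly_Mapping.lookup r m, Poly_Mapping.lookup q n\<^bold>]))"
    if "r \<in> {p, p', p + p'}" for r
    using that keys_add[of p p'] by (intro loop_bracket_wide) auto
  then show ?thesis
    by (simp add: lookup_add lie_add_left single_add sum.distrib)
qed

lemma loop_bracket_add_right: "loop_bracket q (p + p') = loop_bracket q p + loop_bracket q p'"
proof -
  let ?A = "Poly_Mapping.keys p \<union> Poly_Mapping.keys p'" and ?B = "Poly_Mapping.keys q"
  have "loop_bracket q r = (\<Sum>m\<in>?B. \<Sum>n\<in>?A.
     Poly_Mapping.single (m + n) (\<^bold>[Poly_Mapping.lookup q m, Poly_Mapping.lookup r n\<^bold>]))"
    if "r \<in> {p, p', p + p'}" for r
    using that keys_add[of p p'] by (intro loop_bracket_wide) auto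
  then show ?thesis
    by (simp add: lookup_add lie_add_right single_add sum.distrib)
qed

lemma loop_cocycle_add_left: "loop_cocycle (p + p') q = loop_cocycle p q + loop_cocycle p' q"
proof -
  let ?A = "Poly_Mapping.keys p \<union> Poly_Mapping.keys p'" and ?B = "Poly_Mapping.keys q"
  have "loop_cocycle r q = (\<Sum>m\<in>?A. \<Sum>n\<in>?B. if m + n = 0
     then of_int m * inv_form (Poly_Mapping.lookup r m) (Poly_Mapping.lookup q n) else 0)"
    if "r \<in> {p, p', p + p'}" for r
    using that keys_add[of p p'] by (intro loop_cocycle_wide) auto
  then show ?thesis
    by (simp flip: sum.distrib)
       (intro sum.cong refl, simp add: lookup_add form_add_left distrib_left)
qed

lemma loop_cocycle_add_right: "loop_cocycle q (p + p') = loop_cocycle q p + loop_cocycle q p'"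
proof -
  let ?A = "Poly_Mapping.keys p \<union> Poly_Mapping.keys p'" and ?B = "Poly_Mapping.keys q"
  have "loop_cocycle q r = (\<Sum>m\<in>?B. \<Sum>n\<in>?A. if m + n = 0
     then of_int m * inv_form (Poly_Mapping.lookup q m) (Poly_Mapping.lookup r n) else 0)"
    if "r \<in> {p, p', p + p'}" for r
    using that keys_add[of p p'] by (intro loop_cocycle_wide) auto
  then show ?thesis
    by (simp flip: sum.distrib)
       (intro sum.cong refl, simp add: lookup_add form_add_right distrib_left)
qed

lemma loop_bracket_single:
  "loop_bracket (Poly_Mapping.single m x) (Poly_Mapping.single n y) =
     Poly_Mapping.single (m + n) (\<^bold>[x, y\<^bold>])"
  by (subst loop_bracket_wide[of "{m}" "{n}"]) auto

lemma loop_cocycle_single: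
  "loop_cocycle (Poly_Mapping.single m x) (Poly_Mapping.single n y) =
     (if m + n = 0 then of_int m * inv_form x y else 0)"
  by (subst loop_cocycle_wide[of "{m}" "{n}"]) auto

lemma loop_scale_add: "loop_scale a (p + q) = loop_scale a p + loop_scale a q"
  by (rule poly_mapping_eqI) (simp add: lookup_loop_scale lookup_add scaleC_add_right)

lemma loop_scale_single:
  "loop_scale a (Poly_Mapping.single m x) = Poly_Mapping.single m (a *\<^sub>C x)"
  by (rule poly_mapping_eqI)
     (simp add: lookup_loop_scale lookup_single when_def scaleC_zero_right)

lemma loop_zero [simp]:
  "loop_bracket 0 q = 0" "loop_bracket q 0 = 0" "loop_scale a 0 = 0"
  by (simp_all add: loop_bracket_def poly_mapping_eqI lookup_loop_scale scaleC_zero_right)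

lemma loop_cocycle_zero [simp]: "loop_cocycle 0 q = 0" "loop_cocycle q 0 = 0"
  by (simp_all add: loop_cocycle_def)

lemma loop_induct [case_names zero single add]:
  fixes p :: "int \<Rightarrow>\<^sub>0 'g::ab_group_add"
  assumes z: "P 0" and s: "\<And>m x. P (Poly_Mapping.single m x)"
    and a: "\<And>p q. P p \<Longrightarrow> P q \<Longrightarrow> P (p + q)"
  shows "P p"
proof -
  have *: "P (\<Sum>m\<in>K. Poly_Mapping.single m (Poly_Mapping.lookup p m))" if "finite K" for K
    using that by induction (auto intro: assms)
  have "p = (\<Sum>m\<in>Poly_Mapping.keys p. Poly_Mapping.single m (Poly_Mapping.lookup p m))"
    by (rule poly_mapping_eqI)
       (auto simp: lookup_sum lookup_single when_def sum.delta in_keys_iff)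
  with *[of "Poly_Mapping.keys p"] show ?thesis by simp
qed

lemma loop_bracket_scale:
  "loop_bracket (loop_scale a p) q = loop_scale a (loop_bracket p q)"
  "loop_bracket p (loop_scale a q) = loop_scale a (loop_bracket p q)"
proof (induction p arbitrary: q rule: loop_induct)
  case (single m x)
  { case 1 show ?case
      by (induction q rule: loop_induct)
         (simp_all add: loop_scale_single loop_bracket_single lie_scale_left
            loop_bracket_add_right loop_scale_add) }
  { case 2 show ?case
      by (induction q rule: loop_induct)
         (simp_all add: loop_scale_single loop_bracket_single lie_scale_right
            loop_bracket_add_right loop_scale_add) }
qed (simp_all add: loop_bracket_add_left loop_scale_add)

lemma loop_cocycle_scale:
  "loop_cocycle (loop_scale a p) q = a * loop_cocycle p q"
  "loop_cocycle p (loop_scale a q) = a * loop_cocycle p q"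
proof (induction p arbitrary: q rule: loop_induct)
  case (single m x)
  { case 1 show ?case
      by (induction q rule: loop_induct)
         (simp_all add: loop_scale_single loop_cocycle_single form_scale_left
            loop_cocycle_add_right distrib_left loop_scale_add) }
  { case 2 show ?case
      by (induction q rule: loop_induct)
         (simp_all add: loop_scale_single loop_cocycle_single form_scale_right
            loop_cocycle_add_right distrib_left loop_scale_add) }
qed (simp_all add: loop_cocycle_add_left loop_scale_add distrib_left)

lemma loop_bracket_skew: "loop_bracket p q + loop_bracket q p = 0"
proof (induction p arbitrary: q rule: loop_induct)
  case (single m x)
  show ?case
  proof (induction q rule: loop_induct)
    case (single n y)
    show ?case
      using lie_skew[of x y]
      by (simp add: loop_bracket_single add.commute[of n m] flip: single_add)
  next
    case (add p q)
    then show ?case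
      by (simp add: loop_bracket_add_left loop_bracket_add_right algebra_simps)
  qed simp
next
  case (add p q r)
  from add[of r] show ?case
    by (simp add: loop_bracket_add_left loop_bracket_add_right algebra_simps)
qed simp

lemma loop_cocycle_skew: "loop_cocycle p q + loop_cocycle q p = 0"
proof (induction p arbitrary: q rule: loop_induct)
  case (single m x)
  show ?case
  proof (induction q rule: loop_induct)
    case (single n y)
    show ?case
    proof (cases "m + n = 0")
      case True
      then have "n = - m" by simp
      then show ?thesis by (simp add: loop_cocycle_single form_sym[of y x])
    qed (simp add: loop_cocycle_single add.commute[of n m])
  next
    case (add p q)
    then show ?case
      by (simp add: loop_cocycle_add_left loop_cocycle_add_right algebra_simps)
  qed simp
next
  case (add p q r)
  from add[of r] show ?case
    by (simp add: loop_cocycle_add_left loop_cocycle_add_right algebra_simps)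
qed simp

lemma loop_bracket_self: "loop_bracket p p = 0"
proof (induction p rule: loop_induct)
  case (add p q)
  then show ?case
    using loop_bracket_skew[of q p]
    by (simp add: loop_bracket_add_left loop_bracket_add_right)
qed (simp_all add: loop_bracket_single lie_self)

lemma loop_cocycle_self: "loop_cocycle p p = 0"
  using loop_cocycle_skew[of p p] by simp

lemma triadditive_zero:
  fixes J :: "(int \<Rightarrow>\<^sub>0 'g::ab_group_add) \<Rightarrow> (int \<Rightarrow>\<^sub>0 'g) \<Rightarrow> (int \<Rightarrow>\<^sub>0 'g) \<Rightarrow> 'b::ab_group_add"
  assumes a: "\<And>p p' q r. J (p + p') q r = J p q r + J p' q r"
    "\<And>p q q' r. J p (q + q') r = J p q r + J p q' r"
    "\<And>p q r r'. J p q (r + r') = J p q r + J p q r'"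
    and s: "\<And>m n k x y z.
      J (Poly_Mapping.single m x) (Poly_Mapping.single n y) (Poly_Mapping.single k z) = 0"
  shows "J p q r = 0"
proof -
  have z: "J 0 q r = 0" "J p 0 r = 0" "J p q 0 = 0" for p q r
    using a(1)[of 0 0 q r] a(2)[of p 0 0 r] a(3)[of p q 0 0] by simp_all
  show ?thesis
  proof (induction p arbitrary: q r rule: loop_induct)
    case p: (single m x)
    show ?case
    proof (induction q arbitrary: r rule: loop_induct)
      case q: (single n y)
      show ?case by (induction r rule: loop_induct) (simp_all add: z a s)
    qed (simp_all add: z a)
  qed (simp_all add: z a)
qed

lemma loop_jacobi:
  "loop_bracket p (loop_bracket q r) + loop_bracket q (loop_bracket r p)
     + loop_bracket r (loop_bracket p q) = 0"
  by (rule triadditive_zero[where J = "\<lambda>p q r. loop_bracket p (loop_bracket q r)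
        + loop_bracket q (loop_bracket r p) + loop_bracket r (loop_bracket p q)"])
     (simp_all add: loop_bracket_add_left loop_bracket_add_right loop_bracket_single
        add.assoc add.commute add.left_commute jacobi[unfolded add.assoc] flip: single_add)

lemma loop_cocycle_jacobi:
  "loop_cocycle p (loop_bracket q r) + loop_cocycle q (loop_bracket r p)
     + loop_cocycle r (loop_bracket p q) = 0"
proof (rule triadditive_zero[where J = "\<lambda>p q r. loop_cocycle p (loop_bracket q r)
        + loop_cocycle q (loop_bracket r p) + loop_cocycle r (loop_bracket p q)"])
  fix m n k :: int and x y z :: 'a
  have "inv_form y (\<^bold>[z, x\<^bold>]) = inv_form x (\<^bold>[y, z\<^bold>])"
    "inv_form z (\<^bold>[x, y\<^bold>]) = inv_form x (\<^bold>[y, z\<^bold>])"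
    by (metis form_invariant form_sym)+
  note * = this
  show "loop_cocycle (Poly_Mapping.single m x)
       (loop_bracket (Poly_Mapping.single n y) (Poly_Mapping.single k z))
     + loop_cocycle (Poly_Mapping.single n y)
       (loop_bracket (Poly_Mapping.single k z) (Poly_Mapping.single m x))
     + loop_cocycle (Poly_Mapping.single k z)
       (loop_bracket (Poly_Mapping.single m x) (Poly_Mapping.single n y)) = 0"
  proof (cases "m + n + k = 0")
    case True
    then have m: "m = - n - k" by simp
    show ?thesis
      unfolding m by (simp add: loop_bracket_single loop_cocycle_single * algebra_simps)
  next
    case False
    then have "m + (n + k) \<noteq> 0" "n + (k + m) \<noteq> 0" "k + (m + n) \<noteq> 0" by simp_all
    then show ?thesis by (simp add: loop_bracket_single loop_cocycle_single)
  qed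
qed (simp_all add: loop_bracket_add_left loop_bracket_add_right loop_cocycle_add_left
       loop_cocycle_add_right)

instantiation affine :: (complex_lie_algebra_form) complex_lie_algebra
begin

definition "0 = Affine 0 0"
definition "X + Y = Affine (loop_part X + loop_part Y) (central_part X + central_part Y)"
definition "- X = Affine (- loop_part X) (- central_part X)"
definition "X - Y = Affine (loop_part X - loop_part Y) (central_part X - central_part Y)"
definition "a *\<^sub>C X = Affine (loop_scale a (loop_part X)) (a * central_part X)"
definition "\<^bold>[X, Y\<^bold>] =
  Affine (loop_bracket (loop_part X) (loop_part Y)) (loop_cocycle (loop_part X) (loop_part Y))"

instance
proof
  fix X Y Z :: "'a affine" and a b :: complex
  note d = zero_affine_def plus_affine_def uminus_affine_def minus_affine_def
    scaleC_affine_def lie_affine_def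
  show "X + Y + Z = X + (Y + Z)" by (simp add: d add.assoc)
  show "X + Y = Y + X" by (simp add: d add.commute)
  show "0 + X = X" by (simp add: d)
  show "- X + X = 0" by (simp add: d)
  show "X - Y = X + - Y" by (simp add: d)
  show "a *\<^sub>C (X + Y) = a *\<^sub>C X + a *\<^sub>C Y" by (simp add: d loop_scale_add distrib_left)
  show "(a + b) *\<^sub>C X = a *\<^sub>C X + b *\<^sub>C X"
    by (auto simp: d distrib_right lookup_loop_scale lookup_add scaleC_add_left
        intro!: poly_mapping_eqI)
  show "a *\<^sub>C (b *\<^sub>C X) = (a * b) *\<^sub>C X"
    by (auto simp: d lookup_loop_scale scaleC_scaleC intro!: poly_mapping_eqI)
  show "1 *\<^sub>C X = X"
    by (cases X) (auto simp: d lookup_loop_scale scaleC_one intro!: poly_mapping_eqI)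
  show "\<^bold>[X + Y, Z\<^bold>] = \<^bold>[X, Z\<^bold>] + \<^bold>[Y, Z\<^bold>]"
    by (simp add: d loop_bracket_add_left loop_cocycle_add_left)
  show "\<^bold>[X, Y + Z\<^bold>] = \<^bold>[X, Y\<^bold>] + \<^bold>[X, Z\<^bold>]"
    by (simp add: d loop_bracket_add_right loop_cocycle_add_right)
  show "\<^bold>[a *\<^sub>C X, Y\<^bold>] = a *\<^sub>C \<^bold>[X, Y\<^bold>]"
    by (simp add: d loop_bracket_scale loop_cocycle_scale)
  show "\<^bold>[X, a *\<^sub>C Y\<^bold>] = a *\<^sub>C \<^bold>[X, Y\<^bold>]"
    by (simp add: d loop_bracket_scale loop_cocycle_scale)
  show "\<^bold>[X, X\<^bold>] = 0" by (simp add: d loop_bracket_self loop_cocycle_self)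
  show "\<^bold>[X, \<^bold>[Y, Z\<^bold>]\<^bold>] + \<^bold>[Y, \<^bold>[Z, X\<^bold>]\<^bold>] + \<^bold>[Z, \<^bold>[X, Y\<^bold>]\<^bold>] = 0"
    by (simp add: d loop_jacobi loop_cocycle_jacobi)
qed

end

definition tpow :: "'g::complex_lie_algebra_form \<Rightarrow> int \<Rightarrow> 'g affine"  (infix \<open>\<otimes>t\<close> 85) where
  "x \<otimes>t n = Affine (Poly_Mapping.single n x) 0"

definition affine_c :: "'g::complex_lie_algebra_form affine" where
  "affine_c = Affine 0 1"

lemma affine_bracket_tpow:
  "\<^bold>[x \<otimes>t m, y \<otimes>t n\<^bold>] =
     \<^bold>[x, y\<^bold>] \<otimes>t (m + n) + (if m + n = 0 then of_int m * inv_form x y else 0) *\<^sub>C affine_c"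
  by (auto simp: tpow_def affine_c_def lie_affine_def scaleC_affine_def plus_affine_def
      loop_bracket_single loop_cocycle_single)

lemma affine_bracket_c: "\<^bold>[affine_c, X\<^bold>] = 0"
  by (simp add: affine_c_def lie_affine_def zero_affine_def)

text \<open>The subalgebra \<open>\<gg> \<oplus> \<complex>c \<oplus> \<gg> \<otimes> t\<complex>[t]\<close>.\<close>

definition affine_nonneg :: "'g::complex_lie_algebra_form affine set" where
  "affine_nonneg = {X. \<forall>n<0. Poly_Mapping.lookup (loop_part X) n = 0}"


section \<open>The universal enveloping algebra\<close>

text \<open>The free associative algebra is the monoid ring of words; the multiplication of finitely
  supported functions in the library requires an additive monoid, hence the wrapper around
  lists.\<close>

datatype 'a word = Word "'a list"

instantiation word :: (type) monoid_add
begin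

definition "0 = Word []"
fun plus_word where "plus_word (Word u) (Word v) = Word (u @ v)"

instance
proof
  fix a b c :: "'a word"
  show "a + b + c = a + (b + c)" by (cases a; cases b; cases c) simp
  show "0 + a = a" by (cases a) (simp add: zero_word_def)
  show "a + 0 = a" by (cases a) (simp add: zero_word_def)
qed

end

type_synonym 'a free_algebra = "'a word \<Rightarrow>\<^sub>0 complex"

definition fa_gen :: "'a \<Rightarrow> 'a free_algebra" where
  "fa_gen x = Poly_Mapping.single (Word [x]) 1"

definition fa_const :: "complex \<Rightarrow> 'a free_algebra" where
  "fa_const a = Poly_Mapping.single 0 a"

text \<open>The first two families of generators turn the free algebra on the set \<open>'a\<close> into the
  tensor algebra of the vector space \<open>'a\<close>.\<close>

inductive_set uea_ideal :: "'a::complex_lie_algebra free_algebra set" where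
  gen_add: "fa_gen (x + y) - fa_gen x - fa_gen y \<in> uea_ideal"
| gen_scale: "fa_gen (a *\<^sub>C x) - fa_const a * fa_gen x \<in> uea_ideal"
| gen_lie: "fa_gen x * fa_gen y - fa_gen y * fa_gen x - fa_gen (\<^bold>[x, y\<^bold>]) \<in> uea_ideal"
| zero: "0 \<in> uea_ideal"
| add: "p \<in> uea_ideal \<Longrightarrow> q \<in> uea_ideal \<Longrightarrow> p + q \<in> uea_ideal"
| mult: "p \<in> uea_ideal \<Longrightarrow> r * p * s \<in> uea_ideal"

lemma uea_ideal_left: "p \<in> uea_ideal \<Longrightarrow> r * p \<in> uea_ideal"
  using uea_ideal.mult[of p r 1] by simp

lemma uea_ideal_right: "p \<in> uea_ideal \<Longrightarrow> p * s \<in> uea_ideal"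
  using uea_ideal.mult[of p 1 s] by simp

lemma uea_ideal_uminus: "p \<in> uea_ideal \<Longrightarrow> - p \<in> uea_ideal"
  using uea_ideal_left[of p "- 1"] by simp

lemma uea_ideal_diff: "p \<in> uea_ideal \<Longrightarrow> q \<in> uea_ideal \<Longrightarrow> p - q \<in> uea_ideal"
  using uea_ideal.add[of p "- q"] uea_ideal_uminus[of q] by simp

definition uea_eq :: "'a::complex_lie_algebra free_algebra \<Rightarrow> 'a free_algebra \<Rightarrow> bool" where
  "uea_eq p q \<longleftrightarrow> p - q \<in> uea_ideal"

quotient_type (overloaded) 'a uea = "'a::complex_lie_algebra free_algebra" / uea_eq
proof (rule equivpI)
  show "reflp (uea_eq :: 'a free_algebra \<Rightarrow> _)"
    by (simp add: reflp_def uea_eq_def uea_ideal.zero)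
  show "symp (uea_eq :: 'a free_algebra \<Rightarrow> _)"
    unfolding symp_def uea_eq_def by (metis uea_ideal_uminus minus_diff_eq)
  show "transp (uea_eq :: 'a free_algebra \<Rightarrow> _)"
    unfolding transp_def uea_eq_def
  proof (intro allI impI)
    fix x y z :: "'a free_algebra"
    assume "x - y \<in> uea_ideal" "y - z \<in> uea_ideal"
    from uea_ideal.add[OF this] show "x - z \<in> uea_ideal" by simp
  qed
qed

instantiation uea :: (complex_lie_algebra) ring
begin

lift_definition zero_uea :: "'a uea" is 0 .
lift_definition plus_uea :: "'a uea \<Rightarrow> 'a uea \<Rightarrow> 'a uea" is "(+)"
  unfolding uea_eq_def
  by (metis uea_ideal.add add_diff_add)
lift_definition uminus_uea :: "'a uea \<Rightarrow> 'a uea" is uminus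
  unfolding uea_eq_def
  by (metis uea_ideal_uminus minus_diff_minus)
lift_definition minus_uea :: "'a uea \<Rightarrow> 'a uea \<Rightarrow> 'a uea" is "(-)"
  unfolding uea_eq_def
proof -
  fix p p' q q' :: "'a free_algebra"
  assume "p - p' \<in> uea_ideal" "q - q' \<in> uea_ideal"
  from uea_ideal_diff[OF this] show "p - q - (p' - q') \<in> uea_ideal"
    by (simp add: algebra_simps)
qed
lift_definition times_uea :: "'a uea \<Rightarrow> 'a uea \<Rightarrow> 'a uea" is "(*)"
  unfolding uea_eq_def
proof -
  fix p p' q q' :: "'a free_algebra"
  assume "p - p' \<in> uea_ideal" "q - q' \<in> uea_ideal"
  then have "(p - p') * q + p' * (q - q') \<in> uea_ideal"
    by (intro uea_ideal.add uea_ideal_left uea_ideal_right)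
  then show "p * q - p' * q' \<in> uea_ideal" by (simp add: algebra_simps)
qed

instance
  by standard (transfer, simp add: algebra_simps uea_eq_def uea_ideal.zero)+

end

instantiation uea :: (complex_lie_algebra) monoid_mult
begin

lift_definition one_uea :: "'a uea" is 1 .

instance
  by standard (transfer, simp add: uea_eq_def uea_ideal.zero)+

end

lift_definition uea_gen :: "'a::complex_lie_algebra \<Rightarrow> 'a uea" is fa_gen .

lift_definition uea_const :: "complex \<Rightarrow> 'a::complex_lie_algebra uea" is fa_const .

lemma uea_gen_add: "uea_gen (x + y) = uea_gen x + uea_gen y"
  by transfer (simp add: uea_eq_def diff_diff_eq[symmetric] uea_ideal.gen_add)

lemma uea_gen_scale: "uea_gen (a *\<^sub>C x) = uea_const a * uea_gen x"
  by transfer (simp add: uea_eq_def uea_ideal.gen_scale)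

lemma uea_gen_lie: "uea_gen (\<^bold>[x, y\<^bold>]) = uea_gen x * uea_gen y - uea_gen y * uea_gen x"
  by transfer (metis uea_eq_def uea_ideal_uminus uea_ideal.gen_lie minus_diff_eq)


section \<open>Generalized Verma modules\<close>

text \<open>\<open>N(k, 0) = U \<otimes> \<complex>\<close> over \<open>U(\<gg> \<oplus> \<complex>c \<oplus> \<gg> \<otimes> t\<complex>[t])\<close>, where \<open>U\<close> is the enveloping algebra
  of the affine Lie algebra. It is the quotient of the free abelian group on \<open>U \<times> \<complex>\<close> by the
  subgroup \<open>verma_rel k\<close>; as \<open>k\<close> is a term, \<open>N(k, 0)\<close> is a set of cosets and not a type.
  The balancing relations are imposed for the scalars and the elements of
  \<open>\<gg> \<oplus> \<complex>c \<oplus> \<gg> \<otimes> t\<complex>[t]\<close>; these generate its enveloping algebra, so that the relations follow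
  for all of it.\<close>

type_synonym 'g pre_verma = "('g affine uea \<times> complex) \<Rightarrow>\<^sub>0 int"

text \<open>The action of \<open>\<gg> \<oplus> \<complex>c \<oplus> \<gg> \<otimes> t\<complex>[t]\<close> on \<open>\<complex>\<close>.\<close>

definition vacuum_char :: "complex \<Rightarrow> 'g::complex_lie_algebra_form affine \<Rightarrow> complex" where
  "vacuum_char k X = k * central_part X"

inductive_set verma_rel :: "complex \<Rightarrow> 'g::complex_lie_algebra_form pre_verma set"
  for k :: complex where
  add_left: "frag_of (u + u', z) - frag_of (u, z) - frag_of (u', z) \<in> verma_rel k"
| add_right: "frag_of (u, z + z') - frag_of (u, z) - frag_of (u, z') \<in> verma_rel k"
| balanced_const: "frag_of (u * uea_const a, z) - frag_of (u, a * z) \<in> verma_rel k"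
| balanced: "X \<in> affine_nonneg \<Longrightarrow>
    frag_of (u * uea_gen X, z) - frag_of (u, vacuum_char k X * z) \<in> verma_rel k"
| zero: "0 \<in> verma_rel k"
| add: "p \<in> verma_rel k \<Longrightarrow> q \<in> verma_rel k \<Longrightarrow> p + q \<in> verma_rel k"
| uminus: "p \<in> verma_rel k \<Longrightarrow> - p \<in> verma_rel k"

definition verma_class ::
  "complex \<Rightarrow> 'g::complex_lie_algebra_form pre_verma \<Rightarrow> 'g pre_verma set" where
  "verma_class k p = {q. q - p \<in> verma_rel k}"

definition verma_N :: "complex \<Rightarrow> 'g::complex_lie_algebra_form pre_verma set set" where
  "verma_N k = range (verma_class k)"

definition verma_zero :: "complex \<Rightarrow> 'g::complex_lie_algebra_form pre_verma set" where
  "verma_zero k = verma_class k 0"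

definition vacuum :: "complex \<Rightarrow> 'g::complex_lie_algebra_form pre_verma set" where
  "vacuum k = verma_class k (frag_of (1, 1))"

definition verma_add :: "complex \<Rightarrow> 'g::complex_lie_algebra_form pre_verma set \<Rightarrow>
    'g pre_verma set \<Rightarrow> 'g pre_verma set" where
  "verma_add k V W = (\<Union>p\<in>V. \<Union>q\<in>W. verma_class k (p + q))"

definition pre_act ::
  "'g::complex_lie_algebra_form affine uea \<Rightarrow> 'g pre_verma \<Rightarrow> 'g pre_verma" where
  "pre_act u = frag_extend (\<lambda>(u', z). frag_of (u * u', z))"

definition verma_act :: "complex \<Rightarrow> 'g::complex_lie_algebra_form affine uea \<Rightarrow>
    'g pre_verma set \<Rightarrow> 'g pre_verma set" where
  "verma_act k u V = (\<Union>p\<in>V. verma_class k (pre_act u p))"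

lemma verma_class_eq_iff: "verma_class k p = verma_class k q \<longleftrightarrow> p - q \<in> verma_rel k"
proof
  assume "verma_class k p = verma_class k q"
  moreover have "p \<in> verma_class k p" by (simp add: verma_class_def verma_rel.zero)
  ultimately show "p - q \<in> verma_rel k" by (simp add: verma_class_def)
next
  assume pq: "p - q \<in> verma_rel k"
  have "r - p \<in> verma_rel k \<longleftrightarrow> r - q \<in> verma_rel k" for r
    using verma_rel.add[of "r - p" k "p - q"] verma_rel.add[of "r - q" k "- (p - q)"]
      verma_rel.uminus[OF pq] pq by auto
  then show "verma_class k p = verma_class k q" by (simp add: verma_class_def)
qed

lemma verma_add_class: "verma_add k (verma_class k p) (verma_class k q) = verma_class k (p + q)"
proof -
  have "verma_class k (p' + q') = verma_class k (p + q)"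
    if "p' \<in> verma_class k p" "q' \<in> verma_class k q" for p' q'
    using that verma_rel.add[of "p' - p" k "q' - q"]
    unfolding verma_class_eq_iff by (simp add: verma_class_def add_diff_add)
  moreover have "r \<in> verma_class k r" for r
    by (simp add: verma_class_def verma_rel.zero)
  ultimately show ?thesis unfolding verma_add_def by blast
qed

lemma pre_act_rel: "p \<in> verma_rel k \<Longrightarrow> pre_act u p \<in> verma_rel k"
proof (induction rule: verma_rel.induct)
  case (add_left u1 u2 z)
  show ?case
    using verma_rel.add_left[of "u * u1" "u * u2" z k]
    by (simp add: pre_act_def frag_extend_diff distrib_left)
next
  case (add_right u1 z1 z2)
  show ?case
    using verma_rel.add_right[of "u * u1" z1 z2 k]
    by (simp add: pre_act_def frag_extend_diff)
next
  case (balanced_const u1 a z)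
  show ?case
    using verma_rel.balanced_const[of "u * u1" a z k]
    by (simp add: pre_act_def frag_extend_diff mult.assoc)
next
  case (balanced X u1 z)
  show ?case
    using verma_rel.balanced[OF balanced, of "u * u1" z k]
    by (simp add: pre_act_def frag_extend_diff mult.assoc)
next
  case (add p q)
  then show ?case by (simp add: pre_act_def frag_extend_add verma_rel.add)
next
  case (uminus p)
  then show ?case by (simp add: pre_act_def frag_extend_minus verma_rel.uminus)
qed (simp add: pre_act_def verma_rel.zero)

lemma verma_act_class: "verma_act k u (verma_class k p) = verma_class k (pre_act u p)"
proof -
  have "verma_class k (pre_act u q) = verma_class k (pre_act u p)" if "q \<in> verma_class k p" for q
    using that pre_act_rel[of "q - p" k u]
    unfolding verma_class_eq_iff by (simp add: verma_class_def pre_act_def frag_extend_diff)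
  moreover have "p \<in> verma_class k p"
    by (simp add: verma_class_def verma_rel.zero)
  ultimately show ?thesis unfolding verma_act_def by blast
qed

definition verma_submodule ::
  "complex \<Rightarrow> 'g::complex_lie_algebra_form pre_verma set set \<Rightarrow> bool" where
  "verma_submodule k W \<longleftrightarrow>
     W \<subseteq> verma_N k \<and> verma_zero k \<in> W \<and>
     (\<forall>V\<in>W. \<forall>V'\<in>W. verma_add k V V' \<in> W) \<and>
     (\<forall>u. \<forall>V\<in>W. verma_act k u V \<in> W)"

definition maximal_proper_submodule ::
  "complex \<Rightarrow> 'g::complex_lie_algebra_form pre_verma set set \<Rightarrow> bool" where
  "maximal_proper_submodule k J \<longleftrightarrow>
     verma_submodule k J \<and> J \<noteq> verma_N k \<and>
     (\<forall>W. verma_submodule k W \<and> J \<subseteq> W \<longrightarrow> W = J \<or> W = verma_N k)"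

text \<open>Only meaningful if there is exactly one maximal proper submodule.\<close>

definition verma_J :: "complex \<Rightarrow> 'g::complex_lie_algebra_form pre_verma set set" where
  "verma_J k = (THE J. maximal_proper_submodule k J)"

text \<open>\<open>x\<langle>n\<rangle>\<close> is the image of \<open>x \<otimes> t\<^sup>n\<close> in the enveloping algebra; it acts as \<open>x(n)\<close>.\<close>

abbreviation mode :: "'g::complex_lie_algebra_form \<Rightarrow> int \<Rightarrow> 'g affine uea"
    (\<open>_\<langle>_\<rangle>\<close> [1000, 0] 1000) where
  "x\<langle>n\<rangle> \<equiv> uea_gen (x \<otimes>t n)"

end

theory Submission
  imports Defs
begin

text \<open>
  Extend the root vectors to elements \<open>G a b\<close> (\<open>1 \<le> a, b \<le> N\<close>, \<open>N = l + 1\<close>), the images of the matrix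
  units under \<open>gl_N \<rightarrow> gl_N / \<complex> = sl_N\<close>, so that \<open>e\<^sub>i\<close> is \<open>G (i + 1) i\<close>. Writing \<open>E(n)\<close> for the matrix
  of currents, let \<open>Q(m)\<close> be the matrix of modes of the normally ordered square of \<open>E\<close>, corrected by
  \<open>(N / 2) (m + 1) E(m)\<close>. At level \<open>k = - N / 2\<close> the commutator of a current with \<open>Q\<close> is again of the
  adjoint form, except for a multiple of the identity matrix. Hence the trace \<open>S\<close> of \<open>Q\<close> is
  a multiple of the Sugawara field and the traceless part \<open>R\<close> is a primary field, whose modes of
  weight \<open>-2\<close> span the \<open>\<gg>\<close>-module generated by \<open>v\<close>. All modes of \<open>R\<close> act as zero on
  \<open>N(k, 0) / U v\<close>.

  Every proper submodule lies in the radical of the vacuum functional, because \<open>S(0)\<close> acts as a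
  multiple of the degree operator, up to a constant. If the radical were larger than \<open>U v\<close>, then a homogeneous element of it of least
  degree \<open>d\<close> and maximal weight would be a singular vector modulo \<open>U v\<close>. For its weights \<open>\<lambda>\<^sub>i\<close> the
  relations \<open>R\<^sub>i\<^sub>i(0) = 0\<close> read \<open>\<lambda>\<^sub>i\<^sup>2 + (\<Sum>p>i. \<lambda>\<^sub>i - \<lambda>\<^sub>p) - (N / 2) \<lambda>\<^sub>i = d\<close>; as the \<open>\<lambda>\<^sub>i\<close> are integers and \<open>N\<close>
  is odd, they are all equal, hence zero, so \<open>d = 0\<close>, which is impossible.
\<close>

section \<open>Root vectors of type \<open>A\<close>\<close>

text \<open>Submodules of N(k, 0) are treated as left ideals of the enveloping algebra that contain
  the annihilator K of the vacuum. The obstacle is that the modes Q(m) are infinite sums, hence not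
  elements of this algebra. They are replaced by sums over a window of length 2T, and identities are
  stated for all large T after applying functionals that vanish on K. Such a sum is not invariant
  under a shift of its index, and the shift terms combine with the central terms: in the commutator
  of E_ab(n) with Q_ij(m) the coefficients N + k, k and -1 - 2k/N of three different currents have
  to be N/2, -N/2 and 0. Each condition says k = -N/2; this is the origin of the level and of the
  constant N/2 in the correction. The factor m + 1 makes Q(-1) kill the vacuum. The entry R_N1(-2),
  applied to the vacuum, is -v, because E_N1 belongs to theta. The vacuum functional, which detects
  properness, has to be constructed: it is defined on words by recursion, and its compatibility with
  the Lie bracket is then proved.\<close>

interpretation cx: vector_space "scaleC :: complex \<Rightarrow> 'a::complex_lie_algebra \<Rightarrow> 'a"
  by (rule vector_space_scaleC)

definition kd :: "'i \<Rightarrow> 'i \<Rightarrow> complex" where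
  "kd i j = (if i = j then 1 else 0)"

lemma kd_self [simp]: "kd i i = 1"
  and kd_neq: "i \<noteq> j \<Longrightarrow> kd i j = 0"
  by (simp_all add: kd_def)

section \<open>Bracket identities in an arbitrary complex Lie algebra\<close>

lemma lie_minus_right: "\<^bold>[x, - y\<^bold>] = - \<^bold>[x, y\<^bold>]" for x :: "'a::complex_lie_algebra"
  using lie_add_right[of x "- y" y] lie_zero_right[of x] by (simp add: eq_neg_iff_add_eq_0)

lemma lie_minus_left: "\<^bold>[- x, y\<^bold>] = - \<^bold>[x, y\<^bold>]" for x :: "'a::complex_lie_algebra"
  using lie_add_left[of "- x" x y] lie_zero_left[of y] by (simp add: eq_neg_iff_add_eq_0)

lemma lie_jacobi': "\<^bold>[\<^bold>[x, y\<^bold>], z\<^bold>] = \<^bold>[x, \<^bold>[y, z\<^bold>]\<^bold>] - \<^bold>[y, \<^bold>[x, z\<^bold>]\<^bold>]" for x :: "'a::complex_lie_algebra"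
proof -
  have 1: "\<^bold>[\<^bold>[x, y\<^bold>], z\<^bold>] = - \<^bold>[z, \<^bold>[x, y\<^bold>]\<^bold>]" by (rule lie_skew)
  have "\<^bold>[y, \<^bold>[z, x\<^bold>]\<^bold>] = - \<^bold>[y, \<^bold>[x, z\<^bold>]\<^bold>]"
    using lie_skew[of z x] by (simp add: lie_minus_right)
  then have "\<^bold>[x, \<^bold>[y, z\<^bold>]\<^bold>] - \<^bold>[y, \<^bold>[x, z\<^bold>]\<^bold>] + \<^bold>[z, \<^bold>[x, y\<^bold>]\<^bold>] = 0"
    using jacobi[of x y z] by simp
  then show ?thesis
    unfolding 1 by (metis eq_neg_iff_add_eq_0)
qed

lemma lie_diff_left: "\<^bold>[x - y, z\<^bold>] = \<^bold>[x, z\<^bold>] - \<^bold>[y, z\<^bold>]" for x :: "'a::complex_lie_algebra"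
  using lie_add_left[of x "- y" z] by (simp add: lie_minus_left)

lemma lie_diff_right: "\<^bold>[x, y - z\<^bold>] = \<^bold>[x, y\<^bold>] - \<^bold>[x, z\<^bold>]" for x :: "'a::complex_lie_algebra"
  using lie_add_right[of x y "- z"] by (simp add: lie_minus_right)

lemma lie_sum_left: "\<^bold>[\<Sum>i\<in>A. g i, z\<^bold>] = (\<Sum>i\<in>A. \<^bold>[g i, z\<^bold>])" for z :: "'a::complex_lie_algebra"
  by (induction A rule: infinite_finite_induct) (simp_all add: lie_zero_left lie_add_left)

lemma lie_sum_right: "\<^bold>[z, \<Sum>i\<in>A. g i\<^bold>] = (\<Sum>i\<in>A. \<^bold>[z, g i\<^bold>])" for z :: "'a::complex_lie_algebra"
  by (induction A rule: infinite_finite_induct) (simp_all add: lie_zero_right lie_add_right)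

lemma lie_derivation: "\<^bold>[x, \<^bold>[y, z\<^bold>]\<^bold>] = \<^bold>[\<^bold>[x, y\<^bold>], z\<^bold>] + \<^bold>[y, \<^bold>[x, z\<^bold>]\<^bold>]" for x :: "'a::complex_lie_algebra"
  by (simp add: lie_jacobi')

lemma eq_uminus_imp_zero: "x = - x \<Longrightarrow> x = 0" for x :: "'a::complex_lie_algebra"
proof -
  assume "x = - x"
  then have "(2 :: complex) *\<^sub>C x = 0"
    using scaleC_add_left[of 1 1 x] by (simp add: scaleC_one eq_neg_iff_add_eq_0)
  then show "x = 0" by simp
qed

lemma root_vec_Suc: "b < a \<Longrightarrow> root_vec e b (Suc a) = \<^bold>[e a, root_vec e b a\<^bold>]"
  and root_vec_simple: "root_vec e b (Suc b) = e b"
  by simp_all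

declare root_vec.simps(2) [simp del]

locale serre_A =
  fixes l :: nat and e f h :: "nat \<Rightarrow> 'g::complex_lie_algebra"
  assumes hh: "\<lbrakk>i \<in> {1..l}; j \<in> {1..l}\<rbrakk> \<Longrightarrow> \<^bold>[h i, h j\<^bold>] = 0"
    and ef: "\<lbrakk>i \<in> {1..l}; j \<in> {1..l}\<rbrakk> \<Longrightarrow> \<^bold>[e i, f j\<^bold>] = (if i = j then h i else 0)"
    and he: "\<lbrakk>i \<in> {1..l}; j \<in> {1..l}\<rbrakk> \<Longrightarrow> \<^bold>[h i, e j\<^bold>] = of_int (cartan_A i j) *\<^sub>C e j"
    and hf: "\<lbrakk>i \<in> {1..l}; j \<in> {1..l}\<rbrakk> \<Longrightarrow> \<^bold>[h i, f j\<^bold>] = - (of_int (cartan_A i j) *\<^sub>C f j)"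
    and ee: "\<lbrakk>i \<in> {1..l}; j \<in> {1..l}; i \<noteq> Suc j; j \<noteq> Suc i\<rbrakk> \<Longrightarrow> \<^bold>[e i, e j\<^bold>] = 0"
    and ff: "\<lbrakk>i \<in> {1..l}; j \<in> {1..l}; i \<noteq> Suc j; j \<noteq> Suc i\<rbrakk> \<Longrightarrow> \<^bold>[f i, f j\<^bold>] = 0"
    and eee: "\<lbrakk>i \<in> {1..l}; j \<in> {1..l}; i = Suc j \<or> j = Suc i\<rbrakk> \<Longrightarrow> \<^bold>[e i, \<^bold>[e i, e j\<^bold>]\<^bold>] = 0"
    and fff: "\<lbrakk>i \<in> {1..l}; j \<in> {1..l}; i = Suc j \<or> j = Suc i\<rbrakk> \<Longrightarrow> \<^bold>[f i, \<^bold>[f i, f j\<^bold>]\<^bold>] = 0"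
begin

lemma ad_e_above:
  assumes "1 \<le> b" "b < a" "a < i" "i \<le> l"
  shows "\<^bold>[e i, root_vec e b a\<^bold>] = 0"
  using assms
proof (induction a)
  case (Suc a)
  show ?case
  proof (cases "a = b")
    case True
    then show ?thesis using Suc by (simp add: root_vec_simple ee)
  next
    case False
    then show ?thesis using Suc by (simp add: root_vec_Suc lie_derivation[of "e i"] ee lie_zero_left lie_zero_right)
  qed
qed simp

text \<open>Bracketing with \<open>e i\<close> extends the chain of simple roots from
  \<open>b\<close> to \<open>a - 1\<close> at one of its ends or gives zero. Serre's cubic relations
  enter only when \<open>i\<close> is the last letter of the chain or the one before it.\<close>

lemma ad_e:
  assumes "1 \<le> b" "b < a" "a \<le> Suc l" "i \<in> {1..l}"
  shows "\<^bold>[e i, root_vec e b a\<^bold>] =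
    (if i = a then root_vec e b (Suc a) else if Suc i = b then - root_vec e i a else 0)"
  using assms
proof (induction a arbitrary: i)
  case (Suc a)
  show ?case
  proof (cases "a = b")
    case True
    show ?thesis
    proof (cases "Suc i = b")
      case True
      then have "root_vec e i (Suc b) = \<^bold>[e b, e i\<^bold>]"
        using root_vec_Suc[of i b e] root_vec_simple[of e i] by auto
      then show ?thesis using True \<open>a = b\<close> lie_skew[of "e i" "e b"] by (auto simp: root_vec_simple)
    next
      case False
      then show ?thesis using True Suc.prems ee[of i b]
        by (auto simp: root_vec_simple root_vec_Suc[of b "Suc b"])
    qed
  next
    case False
    then have ab: "b < a" "a \<in> {1..l}" using Suc.prems by auto
    let ?X = "root_vec e b a"
    have r: "root_vec e b (Suc a) = \<^bold>[e a, ?X\<^bold>]" using ab by (simp add: root_vec_Suc)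
    have IH: "\<^bold>[e j, ?X\<^bold>] = (if j = a then root_vec e b (Suc a) else if Suc j = b then - root_vec e j a else 0)"
      if "j \<in> {1..l}" for j
      using Suc.IH[of j] Suc.prems ab that by auto
    consider "i = Suc a" | "Suc i = b" | "i > Suc a" | "i = a" | "b \<le> i" "i < a" | "Suc i < b"
      using ab by linarith
    then show ?thesis
    proof cases
      case 1
      then show ?thesis using ab by (simp add: root_vec_Suc)
    next
      case 2
      then have "\<^bold>[e i, e a\<^bold>] = 0" using ab Suc.prems by (intro ee) auto
      then show ?thesis using 2 ab Suc.prems IH[of i]
        by (auto simp: r lie_derivation[of "e i"] lie_zero_left lie_minus_right root_vec_Suc)
    next
      case 3
      then show ?thesis using ab Suc.prems ad_e_above[of b "Suc a" i] by auto
    next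
      case 4
      have "\<^bold>[e a, \<^bold>[e a, ?X\<^bold>]\<^bold>] = 0"
      proof (cases "a = Suc b")
        case True
        then show ?thesis using ab Suc.prems eee[of a b] by (simp add: root_vec_simple)
      next
        case False
        then obtain c where c: "a = Suc c" "b < c" using ab by (cases a) auto
        let ?Y = "root_vec e b c"
        have Y: "\<^bold>[e a, ?Y\<^bold>] = 0" using c ab Suc.prems by (intro ad_e_above) auto
        have "\<^bold>[e a, \<^bold>[e a, e c\<^bold>]\<^bold>] = 0" using c ab Suc.prems by (intro eee) auto
        moreover have "\<^bold>[e a, ?X\<^bold>] = \<^bold>[\<^bold>[e a, e c\<^bold>], ?Y\<^bold>]"
          using c Y lie_derivation[of "e a" "e c" ?Y] by (simp add: root_vec_Suc lie_zero_right)
        ultimately show ?thesis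
          using Y lie_derivation[of "e a" "\<^bold>[e a, e c\<^bold>]" ?Y] by (simp add: lie_zero_left lie_zero_right)
      qed
      then show ?thesis using 4 ab by (auto simp: r)
    next
      case 5
      have X: "\<^bold>[e i, ?X\<^bold>] = 0" using IH[of i] 5 Suc.prems by auto
      have "\<^bold>[e i, \<^bold>[e a, ?X\<^bold>]\<^bold>] = 0"
      proof (cases "Suc i = a")
        case False
        then have "\<^bold>[e i, e a\<^bold>] = 0" using 5 ab Suc.prems by (intro ee) auto
        then show ?thesis using X by (simp add: lie_derivation[of "e i"] lie_zero_left lie_zero_right)
      next
        case a: True
        show ?thesis
        proof (cases "i = b")
          case True
          then have "\<^bold>[e i, \<^bold>[e i, e a\<^bold>]\<^bold>] = 0" using a ab Suc.prems by (intro eee) auto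
          then show ?thesis using True a[symmetric] lie_skew[of "e a" "e i"]
            by (simp add: root_vec_simple lie_minus_right)
        next
          case False
          then have bi: "b < i" using 5 by simp
          \<comment> \<open>Here \<open>\<alpha>\<close> for index \<open>i\<close> would occur
            twice, which no root of type A allows. With \<open>a = i + 1\<close>, moving the outer
            \<open>e i\<close> inwards gives \<open>?Z = [[e a, e i], ?X]\<close>, while Jacobi and
            \<open>[e i, ?X] = 0\<close> give \<open>- ?Z\<close> for the same bracket.\<close>
          let ?Y = "root_vec e b i" and ?Z = "\<^bold>[e i, \<^bold>[e a, ?X\<^bold>]\<^bold>]"
          have XY: "?X = \<^bold>[e i, ?Y\<^bold>]" using bi by (simp add: root_vec_Suc a[symmetric])
          have Y: "\<^bold>[e a, ?Y\<^bold>] = 0" using a bi ab Suc.prems by (intro ad_e_above) auto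
          have "\<^bold>[e i, \<^bold>[e i, e a\<^bold>]\<^bold>] = 0" using a ab Suc.prems 5 by (intro eee) auto
          then have s: "\<^bold>[e i, \<^bold>[e a, e i\<^bold>]\<^bold>] = 0"
            using lie_skew[of "e a" "e i"] by (simp add: lie_minus_right)
          have "\<^bold>[e a, ?X\<^bold>] = \<^bold>[\<^bold>[e a, e i\<^bold>], ?Y\<^bold>]"
            using Y lie_derivation[of "e a" "e i" ?Y] by (simp add: XY lie_zero_right)
          then have "?Z = \<^bold>[\<^bold>[e a, e i\<^bold>], ?X\<^bold>]"
            using s lie_derivation[of "e i" "\<^bold>[e a, e i\<^bold>]" ?Y] by (simp add: XY lie_zero_left)
          also have "\<dots> = - ?Z"
            using X lie_jacobi'[of "e a" "e i" ?X] by (simp add: lie_zero_right)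
          finally show ?thesis by (rule eq_uminus_imp_zero)
        qed
      qed
      then show ?thesis using 5 by (auto simp: r)
    next
      case 6
      then have "\<^bold>[e i, e a\<^bold>] = 0" using ab Suc.prems by (intro ee) auto
      then show ?thesis using 6 ab Suc.prems IH[of i]
        by (auto simp: r lie_derivation[of "e i"] lie_zero_left lie_zero_right)
    qed
  qed
qed simp

text \<open>The coefficient is the weight of the matrix unit at \<open>(a, b)\<close> under the
  difference of the diagonal units at \<open>i + 1\<close> and \<open>i\<close>, which is the role
  that \<open>h i\<close> gets in \<open>G_diag_step\<close>.\<close>

lemma ad_h:
  assumes "1 \<le> b" "b < a" "a \<le> Suc l" "i \<in> {1..l}"
  shows "\<^bold>[h i, root_vec e b a\<^bold>] = (kd (Suc i) a - kd i a - kd (Suc i) b + kd i b) *\<^sub>C root_vec e b a"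
  using assms
proof (induction a)
  case (Suc a)
  have he': "\<^bold>[h i, e a\<^bold>] = (kd (Suc i) (Suc a) - kd i (Suc a) - kd (Suc i) a + kd i a) *\<^sub>C e a"
    using he[of i a] Suc.prems by (auto simp: cartan_A_def kd_def)
  show ?case
  proof (cases "a = b")
    case True
    then show ?thesis using he' by (simp add: root_vec_simple)
  next
    case False
    then have "\<^bold>[h i, root_vec e b a\<^bold>] = (kd (Suc i) a - kd i a - kd (Suc i) b + kd i b) *\<^sub>C root_vec e b a"
      using Suc by auto
    then show ?thesis
      using he' False Suc.prems
      by (simp add: root_vec_Suc lie_derivation[of "h i"] lie_scale_left lie_scale_right flip: scaleC_add_left)
  qed
qed simp

text \<open>Since \<open>f i\<close> commutes with the other simple root vectors, it can only delete
  its own letter. Deleting an inner letter leaves an upper letter that commutes with everything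
  below it, so only the two ends contribute.\<close>

lemma ad_f:
  assumes "1 \<le> b" "b < a" "a \<le> Suc l" "i \<in> {1..l}"
  shows "\<^bold>[f i, root_vec e b a\<^bold>] =
    (if a = Suc b then (if i = b then - h b else 0)
     else if Suc i = a then root_vec e b i else if i = b then - root_vec e (Suc b) a else 0)"
  using assms
proof (induction a)
  case (Suc a)
  have fe: "\<^bold>[f i, e a\<^bold>] = (if i = a then - h a else 0)"
    using ef[of a i] lie_skew[of "f i" "e a"] Suc.prems by auto
  show ?case
  proof (cases "a = b")
    case True
    then show ?thesis using fe by (simp add: root_vec_simple)
  next
    case False
    then have ab: "b < a" "a \<in> {1..l}" using Suc.prems by auto
    let ?X = "root_vec e b a"
    have IH: "\<^bold>[f i, ?X\<^bold>] = (if a = Suc b then (if i = b then - h b else 0)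
     else if Suc i = a then root_vec e b i else if i = b then - root_vec e (Suc b) a else 0)"
      using Suc ab by auto
    have d: "\<^bold>[f i, root_vec e b (Suc a)\<^bold>] = \<^bold>[\<^bold>[f i, e a\<^bold>], ?X\<^bold>] + \<^bold>[e a, \<^bold>[f i, ?X\<^bold>]\<^bold>]"
      using ab by (simp add: root_vec_Suc lie_derivation[of "f i"])
    show ?thesis
    proof (cases "i = a")
      case True
      have "\<^bold>[h a, ?X\<^bold>] = - ?X"
        using ad_h[of b a a] ab Suc.prems by (simp add: kd_def)
      moreover have "\<^bold>[f i, ?X\<^bold>] = 0" using IH True ab by auto
      ultimately show ?thesis using True ab by (simp add: d[unfolded True] fe[unfolded True] lie_zero_right lie_minus_left)
    next
      case ia: False
      have 1: "\<^bold>[f i, root_vec e b (Suc a)\<^bold>] = \<^bold>[e a, \<^bold>[f i, ?X\<^bold>]\<^bold>]"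
        using ia by (simp add: d fe lie_zero_left)
      show ?thesis
      proof (cases "a = Suc b")
        case True
        have "\<^bold>[e a, - h b\<^bold>] = - e a"
          using he[of b a] lie_skew[of "h b" "e a"] True ab Suc.prems
          by (simp add: lie_minus_right cartan_A_def)
        then show ?thesis using True ia IH
          by (auto simp: 1[unfolded True] lie_zero_right root_vec_simple)
      next
        case False
        have "\<^bold>[e a, root_vec e b i\<^bold>] = 0" if "Suc i = a"
          using that ab False Suc.prems by (intro ad_e_above) auto
        then show ?thesis using False ia IH ab
          by (auto simp: 1 lie_zero_right lie_minus_right root_vec_Suc[of "Suc b" a])
      qed
    qed
  qed
qed simp

text \<open>This is why the relations form a locale of their own: a second instance turns each
  statement on positive root vectors into one on negative root vectors.\<close>

lemma serre_swap: "serre_A l f e (\<lambda>i. - h i)"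
proof
  fix i j assume "i \<in> {1..l}" "j \<in> {1..l}"
  then show "\<^bold>[f i, e j\<^bold>] = (if i = j then - h i else 0)"
    using ef[of j i] lie_skew[of "f i" "e j"] by auto
qed (simp_all add: lie_minus_left lie_minus_right hh he hf ee ff eee fff lie_zero_right)

text \<open>Telescoping \<open>h i = G (i + 1) (i + 1) - G i i\<close> makes this
  \<open>G c c - G 1 1\<close>; the common offset of the diagonal units is then determined by
  requiring trace zero.\<close>

definition cartan_sum :: "nat \<Rightarrow> 'g" where
  "cartan_sum c = (\<Sum>i\<in>{1..<c}. h i)"

text \<open>Off the diagonal, the sign makes the root vectors multiply like matrix units; \<open>G a a\<close> stands for the
  matrix unit minus \<open>1 / (l + 1)\<close> times the identity.\<close>

definition G :: "nat \<Rightarrow> nat \<Rightarrow> 'g" where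
  "G a b = (if b < a then root_vec e b a
     else if a < b then (-1) ^ (b - a - 1) *\<^sub>C root_vec f a b
     else cartan_sum a - (1 / of_nat (l + 1)) *\<^sub>C (\<Sum>c\<in>{1..l + 1}. cartan_sum c))"

lemma G_lower: "b < a \<Longrightarrow> G a b = root_vec e b a"
  by (simp add: G_def)

lemma G_e: "G (Suc i) i = e i" and G_f: "G i (Suc i) = f i"
  by (simp_all add: G_def root_vec_simple)

lemma G_diag_step: "1 \<le> i \<Longrightarrow> G (Suc i) (Suc i) - G i i = h i"
  by (simp add: G_def cartan_sum_def)

lemma scaleC_of_nat: "of_nat n *\<^sub>C x = (\<Sum>i\<in>{1..n}. x)" for x :: 'g
  by (induction n) (simp_all add: scaleC_add_left scaleC_one)

lemma G_trace: "(\<Sum>c\<in>{1..l + 1}. G c c) = 0"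
proof -
  have "(\<Sum>c\<in>{1..l + 1}. G c c) = (\<Sum>c\<in>{1..l + 1}. cartan_sum c)
     - of_nat (l + 1) *\<^sub>C ((1 / of_nat (l + 1)) *\<^sub>C (\<Sum>c\<in>{1..l + 1}. cartan_sum c))"
    unfolding scaleC_of_nat by (simp add: G_def sum_subtractf)
  then show ?thesis by (simp add: scaleC_scaleC scaleC_one del: of_nat_Suc of_nat_add)
qed

lemma e_G:
  assumes "i \<in> {1..l}" "a \<in> {1..l+1}" "b \<in> {1..l+1}"
  shows "\<^bold>[e i, G a b\<^bold>] = (if i = a then G (Suc i) b else 0) - (if b = Suc i then G a i else 0)"
proof -
  interpret s: serre_A l f e "\<lambda>i. - h i" by (rule serre_swap)
  consider "b < a" | "a < b" | "a = b" by linarith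
  then show ?thesis
  proof cases
    case 1
    then show ?thesis using assms ad_e[of b a i] by (auto simp: G_lower)
  next
    case 2
    show ?thesis
    proof (cases "b = Suc a")
      case True
      then show ?thesis using assms 2 s.ad_f[of a b i] G_diag_step[of i]
        by (auto simp: root_vec_simple G_e G_f ef)
    next
      case False
      then obtain d where "b = Suc (Suc (a + d))" using 2 less_imp_Suc_add[of a b] by (metis add_Suc_right gr0_implies_Suc add_0_right not_gr0)
      then show ?thesis using assms 2 s.ad_f[of a b i]
        by (auto simp: G_def lie_scale_right lie_minus_right scaleC_zero_right)
    qed
  next
    case 3
    \<comment> \<open>Only differences of diagonal units are known, through \<open>h c\<close>. So
      the error \<open>y c\<close> of the claimed formula does not depend on \<open>c\<close>; it
      also sums to zero because the trace of \<open>G\<close> vanishes, hence it is zero.\<close>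
    define y where "y c = \<^bold>[e i, G c c\<^bold>] - (kd i c - kd c (Suc i)) *\<^sub>C e i" for c
    have step: "y (Suc c) = y c" if "c \<in> {1..l}" for c
    proof -
      have "\<^bold>[e i, G (Suc c) (Suc c)\<^bold>] - \<^bold>[e i, G c c\<^bold>] = - \<^bold>[h c, e i\<^bold>]"
        using G_diag_step[of c] lie_skew[of "e i" "h c"] that by (simp flip: lie_diff_right)
      also have "\<dots> = (kd i (Suc c) - kd (Suc c) (Suc i)) *\<^sub>C e i - (kd i c - kd c (Suc i)) *\<^sub>C e i"
        using he[of c i] that assms
        by (auto simp: cartan_A_def kd_def simp flip: cx.scale_left_diff_distrib)
      finally show ?thesis by (simp add: y_def algebra_simps)
    qed
    have y: "y c = y 1" if "c \<in> {1..l+1}" for c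
      using that
    proof (induction c)
      case (Suc c)
      then show ?case using step[of c] by (cases "c = 0") auto
    qed simp
    have "(\<Sum>c\<in>{1..l+1}. y c) = 0"
    proof -
      have "(\<Sum>c\<in>{1..l+1}. (kd i c - kd c (Suc i)) *\<^sub>C e i) = (\<Sum>c\<in>{1..l+1}. (kd i c - kd c (Suc i))) *\<^sub>C e i"
        by (rule cx.scale_sum_left[symmetric])
      also have "(\<Sum>c\<in>{1..l+1}. (kd i c - kd c (Suc i))) = 0"
        using assms by (simp add: sum_subtractf kd_def)
      finally show ?thesis
        by (simp add: y_def sum_subtractf G_trace[simplified] lie_zero_right flip: lie_sum_right)
    qed
    then have "of_nat (l + 1) *\<^sub>C y 1 = 0"
      unfolding scaleC_of_nat using y by (metis (no_types, lifting) sum.cong)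
    then have "y a = 0" using y[OF assms(2)] by (metis cx.scale_eq_0_iff of_nat_neq_0 Suc_eq_plus1)
    then show ?thesis using 3 by (auto simp: y_def kd_def G_e)
  qed
qed

lemma f_G:
  assumes "i \<in> {1..l}" "a \<in> {1..l+1}" "b \<in> {1..l+1}"
  shows "\<^bold>[f i, G a b\<^bold>] = (if a = Suc i then G i b else 0) - (if b = i then G a (Suc i) else 0)"
proof -
  interpret s: serre_A l f e "\<lambda>i. - h i" by (rule serre_swap)
  have sc: "s.cartan_sum c = - cartan_sum c" for c
    by (simp add: s.cartan_sum_def cartan_sum_def sum_negf)
  \<comment> \<open>The matrix units of the swapped system are the negative transposes up to the
    sign \<open>(-1) ^ (a + b)\<close>, so \<open>e_G\<close> for that system is the claim about
    \<open>f i\<close>.\<close>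
  have sG: "s.G a b = (- ((-1) ^ (a + b))) *\<^sub>C G b a" for a b
  proof -
    consider "b < a" | "a < b" | "a = b" by linarith
    then show ?thesis
    proof cases
      case 1
      then obtain d where "a = Suc (b + d)" using less_imp_Suc_add by blast
      then show ?thesis by (simp add: s.G_def G_def scaleC_scaleC scaleC_one minus_one_power_iff)
    next
      case 2
      then obtain d where "b = Suc (a + d)" using less_imp_Suc_add by blast
      then show ?thesis by (simp add: s.G_def G_def scaleC_scaleC scaleC_one minus_one_power_iff)
    next
      case 3
      have "(\<Sum>c\<in>{1..l + 1}. s.cartan_sum c) = - (\<Sum>c\<in>{1..l + 1}. cartan_sum c)"
        by (simp add: sc sum_negf)
      then show ?thesis using 3 by (simp add: s.G_def G_def sc scaleC_one del: sum.cl_ivl_Suc flip: mult_2)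
    qed
  qed
  have "\<^bold>[f i, s.G b a\<^bold>] = (if i = b then s.G (Suc i) a else 0) - (if a = Suc i then s.G b i else 0)"
    by (rule s.e_G) (use assms in auto)
  then have "(-1) ^ (a + b) *\<^sub>C \<^bold>[f i, s.G b a\<^bold>] =
      (-1) ^ (a + b) *\<^sub>C ((if i = b then s.G (Suc i) a else 0) - (if a = Suc i then s.G b i else 0))"
    by simp
  then show ?thesis
    by (auto simp: sG lie_scale_right scaleC_scaleC scaleC_one cx.scale_right_diff_distrib
        scaleC_zero_right lie_minus_right
        algebra_simps simp flip: power_add split: if_splits)
qed

definition bracket_rel :: "nat \<Rightarrow> nat \<Rightarrow> bool" where
  "bracket_rel a b \<longleftrightarrow> (\<forall>c\<in>{1..l+1}. \<forall>d\<in>{1..l+1}.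
     \<^bold>[G a b, G c d\<^bold>] = kd b c *\<^sub>C G a d - kd a d *\<^sub>C G c b)"

text \<open>\<open>G a c\<close> is the commutator of \<open>G a b\<close> and \<open>G b c\<close>,
  and by Jacobi its adjoint action is the commutator of two known ones. For \<open>a = c\<close>
  this commutator would be a difference of two diagonal units instead.\<close>

lemma bracket_rel_trans:
  assumes "bracket_rel a b" "bracket_rel b c" "a \<noteq> c" "a \<in> {1..l+1}" "b \<in> {1..l+1}" "c \<in> {1..l+1}"
  shows "bracket_rel a c"
proof -
  have r: "\<^bold>[G a b, G p q\<^bold>] = kd b p *\<^sub>C G a q - kd a q *\<^sub>C G p b"
    "\<^bold>[G b c, G p q\<^bold>] = kd c p *\<^sub>C G b q - kd b q *\<^sub>C G p c"
    if "p \<in> {1..l+1}" "q \<in> {1..l+1}" for p q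
    using assms that unfolding bracket_rel_def by auto
  have "G a c = \<^bold>[G a b, G b c\<^bold>]"
    using assms by (simp add: r kd_neq scaleC_one)
  then have "\<^bold>[G a c, G p q\<^bold>] = \<^bold>[G a b, \<^bold>[G b c, G p q\<^bold>]\<^bold>] - \<^bold>[G b c, \<^bold>[G a b, G p q\<^bold>]\<^bold>]" for p q
    by (simp only: lie_jacobi')
  then show ?thesis
    unfolding bracket_rel_def using assms(3-6)
    by (simp add: r lie_diff_right lie_scale_right)
       (auto simp: kd_def scaleC_one)
qed

lemma bracket_off_diag:
  assumes "a \<noteq> b" "a \<in> {1..l+1}" "b \<in> {1..l+1}"
  shows "bracket_rel a b"
proof -
  have lo: "bracket_rel (Suc i) i" and up: "bracket_rel i (Suc i)" if "i \<in> {1..l}" for i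
    using that by (auto simp: bracket_rel_def G_e G_f e_G f_G kd_def scaleC_one)
  have "bracket_rel (b + Suc d) b" if "b \<ge> 1" "b + Suc d \<le> l + 1" for b d
    using that
  proof (induction d)
    case 0
    then show ?case using lo[of b] by simp
  next
    case (Suc d)
    then show ?case using lo[of "b + Suc d"] by (auto intro: bracket_rel_trans[of _ "b + Suc d"])
  qed
  moreover have "bracket_rel a (a + Suc d)" if "a \<ge> 1" "a + Suc d \<le> l + 1" for a d
    using that
  proof (induction d)
    case 0
    then show ?case using up[of a] by simp
  next
    case (Suc d)
    then show ?case using up[of "a + Suc d"] by (auto intro: bracket_rel_trans[of _ "a + Suc d"])
  qed
  moreover have "(\<exists>d. a = b + Suc d) \<or> (\<exists>d. b = a + Suc d)"
    using assms(1) by presburger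
  ultimately show ?thesis using assms by auto
qed

lemma bracket_G:
  assumes "a \<in> {1..l+1}" "b \<in> {1..l+1}" "c \<in> {1..l+1}" "d \<in> {1..l+1}"
  shows "\<^bold>[G a b, G c d\<^bold>] = kd b c *\<^sub>C G a d - kd a d *\<^sub>C G c b"
proof (cases "a = b")
  case False
  then show ?thesis using bracket_off_diag[of a b] assms by (simp add: bracket_rel_def)
next
  case True
  \<comment> \<open>Only the differences \<open>G a a - G x x\<close> are commutators of root
    vectors. Summing over \<open>x\<close> and using that the trace vanishes isolates
    \<open>l + 1\<close> times the action of \<open>G a a\<close>.\<close>
  have dd: "\<^bold>[G a a - G x x, G c d\<^bold>] = (kd a c - kd a d - kd x c + kd x d) *\<^sub>C G c d"
    if "x \<in> {1..l+1}" for x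
  proof (cases "a = x")
    case False
    have r: "\<^bold>[G a x, G p q\<^bold>] = kd x p *\<^sub>C G a q - kd a q *\<^sub>C G p x"
      "\<^bold>[G x a, G p q\<^bold>] = kd a p *\<^sub>C G x q - kd x q *\<^sub>C G p a"
      if "p \<in> {1..l+1}" "q \<in> {1..l+1}" for p q
      using bracket_off_diag[of a x] bracket_off_diag[of x a] assms \<open>x \<in> _\<close> False that
      unfolding bracket_rel_def by auto
    have "\<^bold>[G a x, G x a\<^bold>] = G a a - G x x"
      using r(1)[of x a] assms that by (simp add: scaleC_one)
    then have "\<^bold>[G a a - G x x, G c d\<^bold>] = \<^bold>[\<^bold>[G a x, G x a\<^bold>], G c d\<^bold>]" by simp
    also have "\<dots> = (kd a c - kd a d - kd x c + kd x d) *\<^sub>C G c d"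
      unfolding lie_jacobi' using assms that False
      by (simp add: r lie_diff_right lie_scale_right)
         (auto simp: kd_def scaleC_one scaleC_add_left[of 1 1, simplified])
    finally show ?thesis .
  qed (simp add: lie_zero_left)
  have "(\<Sum>x\<in>{1..l+1}. \<^bold>[G a a - G x x, G c d\<^bold>]) = of_nat (l + 1) *\<^sub>C \<^bold>[G a a, G c d\<^bold>]"
    using G_trace unfolding scaleC_of_nat
    by (simp add: lie_diff_left sum_subtractf lie_zero_left flip: lie_sum_left)
  moreover have "(\<Sum>x\<in>{1..l+1}. \<^bold>[G a a - G x x, G c d\<^bold>]) = of_nat (l + 1) *\<^sub>C ((kd a c - kd a d) *\<^sub>C G c d)"
  proof -
    have "(\<Sum>x\<in>{1..l+1}. \<^bold>[G a a - G x x, G c d\<^bold>]) = (\<Sum>x\<in>{1..l+1}. kd a c - kd a d - kd x c + kd x d) *\<^sub>C G c d"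
      unfolding cx.scale_sum_left by (intro sum.cong refl dd)
    also have "(\<Sum>x\<in>{1..l+1}. kd a c - kd a d - kd x c + kd x d) = of_nat (l + 1) * (kd a c - kd a d)"
      using assms by (simp add: sum.distrib sum_subtractf kd_def)
    finally show ?thesis by (simp add: scaleC_scaleC)
  qed
  ultimately have "\<^bold>[G a a, G c d\<^bold>] = (kd a c - kd a d) *\<^sub>C G c d"
    by (metis cx.scale_left_imp_eq of_nat_neq_0 Suc_eq_plus1)
  then show ?thesis using True by (auto simp: kd_def scaleC_one)
qed

text \<open>By \<open>bracket_G\<close> the span of the \<open>G a b\<close> is a subalgebra
  containing all generators. The form as an induction rule suits properties that are closed under
  linear combinations.\<close>

lemma G_span:
  assumes gen: "\<And>S. lie_subalgebra S \<Longrightarrow> e ` {1..l} \<subseteq> S \<Longrightarrow> f ` {1..l} \<subseteq> S \<Longrightarrow> S = UNIV"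
    and "P 0" and add: "\<And>x y. P x \<Longrightarrow> P y \<Longrightarrow> P (x + y)" and scale: "\<And>a x. P x \<Longrightarrow> P (a *\<^sub>C x)"
    and G: "\<And>a b. a \<in> {1..l+1} \<Longrightarrow> b \<in> {1..l+1} \<Longrightarrow> P (G a b)"
  shows "P x"
proof -
  define B where "B = (\<lambda>(a, b). G a b) ` ({1..l+1} \<times> {1..l+1})"
  have "lie_subalgebra (cx.span B)"
    unfolding lie_subalgebra_def
  proof (intro conjI ballI)
    fix x y assume xy: "x \<in> cx.span B" "y \<in> cx.span B"
    have BB: "\<^bold>[x, y\<^bold>] \<in> cx.span B" if "x \<in> B" "y \<in> B" for x y
    proof -
      have "G a b \<in> cx.span B" if "a \<in> {1..l+1}" "b \<in> {1..l+1}" for a b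
        using that unfolding B_def by (intro cx.span_base) auto
      then show ?thesis using that unfolding B_def[symmetric]
        by (auto simp: bracket_G B_def[THEN eq_refl, THEN subsetD] intro!: cx.span_diff cx.span_scale dest!: B_def[THEN eq_refl, THEN subsetD])
    qed
    have *: "\<^bold>[x, y\<^bold>] \<in> cx.span B" if "x \<in> B" for x
      using xy(2) by (induction rule: cx.span_induct_alt)
        (auto simp: lie_zero_right cx.span_zero lie_add_right lie_scale_right intro!: cx.span_add cx.span_scale BB[OF that])
    show "\<^bold>[x, y\<^bold>] \<in> cx.span B"
      using xy(1) by (induction rule: cx.span_induct_alt)
        (auto simp: lie_zero_left cx.span_zero lie_add_left lie_scale_left intro!: cx.span_add cx.span_scale *)
  qed simp
  moreover have "G (Suc i) i \<in> B" "G i (Suc i) \<in> B" if "i \<in> {1..l}" for i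
    using that unfolding B_def by auto
  ultimately have "cx.span B = UNIV"
    by (intro gen) (auto simp: G_e G_f intro!: cx.span_base)
  then have "x \<in> cx.span B" by simp
  then show ?thesis
    by (induction rule: cx.span_induct_alt) (auto simp: B_def intro!: add scale G assms(2))
qed

end

section \<open>Chevalley generators and the invariant form\<close>

lemma chevalley_serre:
  assumes "chevalley_generators_A l e f h"
  shows "serre_A l e f h"
proof
  fix i j assume ij: "i \<in> {1..l}" "j \<in> {1..l}"
  note A = conjunct2[OF assms[unfolded chevalley_generators_A_def], rule_format, OF ij]
  show "\<^bold>[h i, h j\<^bold>] = 0" "\<^bold>[e i, f j\<^bold>] = (if i = j then h i else 0)"
    "\<^bold>[h i, e j\<^bold>] = of_int (cartan_A i j) *\<^sub>C e j" "\<^bold>[h i, f j\<^bold>] = - (of_int (cartan_A i j) *\<^sub>C f j)"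
    using A by blast+
  show "\<^bold>[e i, e j\<^bold>] = 0" "\<^bold>[f i, f j\<^bold>] = 0" if "i \<noteq> Suc j" "j \<noteq> Suc i"
    using A that by (cases "i = j"; simp add: cartan_A_def lie_self)+
  show "\<^bold>[e i, \<^bold>[e i, e j\<^bold>]\<^bold>] = 0" "\<^bold>[f i, \<^bold>[f i, f j\<^bold>]\<^bold>] = 0" if "i = Suc j \<or> j = Suc i"
    using A that by (auto simp: cartan_A_def numeral_2_eq_2)
qed

text \<open>The value is the trace form on the traceless parts of matrix units. Invariance under
  diagonal elements leaves only pairs of opposite weight; invariance under root vectors gives all of
  these one common value \<open>s\<close>, for which three distinct indices and so
  \<open>l \<ge> 2\<close> are used; the normalization then gives \<open>s = 1\<close>.\<close>

lemma serre_form: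
  fixes e f h :: "nat \<Rightarrow> 'g::complex_lie_algebra_form"
  assumes "serre_A l e f h" "l \<ge> 2" and norm: "form_normalized l e h"
    and nonab: "\<exists>x y :: 'g. \<^bold>[x, y\<^bold>] \<noteq> 0"
    and gen: "\<And>S. lie_subalgebra S \<Longrightarrow> e ` {1..l} \<subseteq> S \<Longrightarrow> f ` {1..l} \<subseteq> S \<Longrightarrow> S = UNIV"
    and I: "a \<in> {1..l+1}" "b \<in> {1..l+1}" "c \<in> {1..l+1}" "d \<in> {1..l+1}"
  shows "inv_form (serre_A.G l e f h a b) (serre_A.G l e f h c d) =
    kd b c * kd a d - kd a b * kd c d / of_nat (l + 1)"
proof -
  interpret serre_A l e f h by fact
  let ?I = "{1..l+1}" and ?F = inv_form
  have sym: "?F x y = ?F y x" for x y :: 'g by (rule form_sym)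
  have inv: "?F (\<^bold>[x, y\<^bold>]) z = ?F x (\<^bold>[y, z\<^bold>])" for x y z :: 'g by (rule form_invariant)
  have dl: "?F (x - y) z = ?F x z - ?F y z" and dr: "?F z (x - y) = ?F z x - ?F z y" for x y z :: 'g
    using form_add_left[of "x - y" y z] form_add_right[of z "x - y" y] by simp_all
  note lin = dl dr form_scale_left form_scale_right form_zero_left form_zero_right form_add_left form_add_right
  have sumr: "?F z (\<Sum>i\<in>A. g i) = (\<Sum>i\<in>A. ?F z (g i))" for z A and g :: "nat \<Rightarrow> 'g"
    by (induction A rule: infinite_finite_induct) (simp_all add: form_zero_right form_add_right)
  have wt: "(kd p a - kd p b + kd p c - kd p d) * ?F (G a b) (G c d) = 0"
    if "p \<in> ?I" "a \<in> ?I" "b \<in> ?I" "c \<in> ?I" "d \<in> ?I" for p a b c d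
  proof -
    have "?F (\<^bold>[G a b, G p p\<^bold>]) (G c d) = ?F (G a b) (\<^bold>[G p p, G c d\<^bold>])" by (rule inv)
    then have "(kd b p - kd a p) * ?F (G a b) (G c d) = (kd p c - kd p d) * ?F (G a b) (G c d)"
      using that by (simp add: bracket_G lin kd_def[of p] kd_def[of _ p] scaleC_one split: if_splits)
    then show ?thesis by (simp add: kd_def algebra_simps split: if_splits)
  qed
  define q where "q a b = ?F (G a b) (G b a)" for a b
  have q1: "q a d = q a b" if "a \<in> ?I" "b \<in> ?I" "d \<in> ?I" "a \<noteq> b" "a \<noteq> d" "b \<noteq> d" for a b d
  proof -
    have "?F (\<^bold>[G a b, G b d\<^bold>]) (G d a) = ?F (G a b) (\<^bold>[G b d, G d a\<^bold>])" by (rule inv)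
    then show ?thesis using that by (simp add: bracket_G q_def kd_neq scaleC_one)
  qed
  have qs: "q a b = q b a" for a b by (simp add: q_def sym)
  have three: "\<exists>d\<in>?I. d \<noteq> a \<and> d \<noteq> b" for a b
  proof -
    have "1 \<in> ?I" "2 \<in> ?I" "3 \<in> ?I" using \<open>l \<ge> 2\<close> by auto
    moreover have "(1 \<noteq> a \<and> 1 \<noteq> b) \<or> (2 \<noteq> a \<and> 2 \<noteq> b) \<or> (3 \<noteq> a \<and> 3 \<noteq> b)" by presburger
    ultimately show ?thesis by blast
  qed
  have q0: "q a b = q 1 2" if "a \<in> ?I" "b \<in> ?I" "a \<noteq> b" for a b
  proof -
    have m: "1 \<in> ?I" "2 \<in> ?I" using \<open>l \<ge> 2\<close> by auto
    have one: "q 1 b = q 1 2" if "b \<in> ?I" "b \<noteq> 1" for b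
      using q1[of 1 2 b] that m by (cases "b = 2") auto
    consider "a = 1" | "b = 1" | "a \<noteq> 1" "b \<noteq> 1" by blast
    then show ?thesis
    proof cases
      case 1
      then show ?thesis using one[of b] that by simp
    next
      case 2
      then show ?thesis using one[of a] qs[of a b] that by simp
    next
      case 3
      have "q a b = q a 1" using q1[of a 1 b] that m 3 by auto
      then show ?thesis using one[of a] qs[of a 1] that 3 by simp
    qed
  qed
  define s where "s = q 1 2"
  have diag: "of_nat (l + 1) * ?F (G a a) (G c c) = s * (of_nat (l + 1) * kd a c - 1)"
    if "a \<in> ?I" "c \<in> ?I" for a c
  proof -
    have d: "?F (G a a) (G c c) - ?F (G x x) (G c c) = s * (kd a c - kd x c)" if "x \<in> ?I" for x
    proof (cases "x = a")
      case False
      have "?F (\<^bold>[G a x, G x a\<^bold>]) (G c c) = ?F (G a x) (\<^bold>[G x a, G c c\<^bold>])" by (rule inv)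
      then show ?thesis
        using that \<open>a \<in> ?I\<close> \<open>c \<in> ?I\<close> q0[of a x] False
        by (auto simp add: bracket_G lin scaleC_one q_def[symmetric] s_def)
           (auto simp: kd_def lin scaleC_one q_def[symmetric] s_def)
    qed simp
    have "(\<Sum>x\<in>?I. ?F (G a a) (G c c) - ?F (G x x) (G c c)) = (\<Sum>x\<in>?I. s * (kd a c - kd x c))"
      by (intro sum.cong refl d)
    moreover have "(\<Sum>x\<in>?I. ?F (G x x) (G c c)) = 0"
    proof -
      have "(\<Sum>x\<in>?I. ?F (G x x) (G c c)) = ?F (G c c) (\<Sum>x\<in>?I. G x x)"
        unfolding sumr by (simp only: sym[of "G c c"])
      then show ?thesis using G_trace by (simp only: form_zero_right)
    qed
    moreover have "(\<Sum>x\<in>?I. kd x c) = 1" using that by (simp add: kd_def)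
    ultimately show ?thesis
      by (simp add: sum_subtractf flip: sum_distrib_left)
  qed
  have F: "?F (G a b) (G c d) = s * (kd b c * kd a d - kd a b * kd c d / of_nat (l + 1))"
    if "a \<in> ?I" "b \<in> ?I" "c \<in> ?I" "d \<in> ?I" for a b c d
  proof -
    consider "a = b" "c = d" | "a \<noteq> b" "a = d" "b = c" | "\<not> (a = b \<and> c = d)" "\<not> (a = d \<and> b = c)" by blast
    then show ?thesis
    proof cases
      case 1
      then show ?thesis using diag[of a c] that
        by (simp add: field_simps del: of_nat_add of_nat_Suc) (auto simp: kd_def)
    next
      case 2
      then show ?thesis using q0[of a b] that by (simp add: q_def s_def kd_neq)
    next
      case 3
      have "\<exists>p\<in>?I. kd p a - kd p b + kd p c - kd p d \<noteq> 0"
      proof (cases "a = b")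
        case True
        then show ?thesis using 3 that by (intro bexI[of _ c]) (auto simp: kd_def)
      next
        case False
        then show ?thesis
        proof (cases "a = d")
          case True
          then show ?thesis using 3 False that by (intro bexI[of _ b]) (auto simp: kd_def)
        next
          case ad: False
          then show ?thesis using 3 False that by (intro bexI[of _ a]) (auto simp: kd_def)
        qed
      qed
      then have "?F (G a b) (G c d) = 0" using wt that by (meson mult_eq_0_iff)
      then show ?thesis using 3 by (auto simp: kd_def)
    qed
  qed
  have hspan: "G (l+1) (l+1) - G 1 1 \<in> cx.span (h ` {1..l})"
  proof -
    have "G (Suc n) (Suc n) - G 1 1 \<in> cx.span (h ` {1..l})" if "n \<le> l" for n
      using that
    proof (induction n)
      case (Suc n)
      have "G (Suc (Suc n)) (Suc (Suc n)) - G 1 1 = h (Suc n) + (G (Suc n) (Suc n) - G 1 1)"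
        using G_diag_step[of "Suc n"] by (simp add: algebra_simps)
      moreover have "h (Suc n) \<in> cx.span (h ` {1..l})"
        using Suc.prems by (intro cx.span_base) auto
      moreover have "G (Suc n) (Suc n) - G 1 1 \<in> cx.span (h ` {1..l})"
        using Suc by simp
      ultimately show ?case by (simp only: cx.span_add)
    qed (simp add: cx.span_zero)
    then show ?thesis by simp
  qed
  have th: "e_theta l e = G (l+1) 1" using \<open>l \<ge> 2\<close> by (simp add: e_theta_def G_lower)
  \<comment> \<open>The normalization is an equation of multiples of \<open>e_theta\<close>, so it
    says something only if this vector is nonzero. If it vanished, all root vectors would vanish and
    the algebra would be abelian.\<close>
  have th0: "G (l+1) 1 \<noteq> 0"
  proof
    assume z: "G (l+1) 1 = 0"
    have z1: "G a 1 = 0" if "a \<in> ?I" "a \<noteq> 1" for a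
    proof -
      have "\<^bold>[G a (l+1), G (l+1) 1\<^bold>] = G a 1" using that by (simp add: bracket_G kd_neq scaleC_one)
      then show ?thesis using z by (simp add: lie_zero_right)
    qed
    have z2: "G a b = 0" if "a \<in> ?I" "b \<in> ?I" "a \<noteq> b" "a \<noteq> 1" for a b
    proof -
      have "\<^bold>[G a 1, G 1 b\<^bold>] = G a b" using that by (simp add: bracket_G kd_neq scaleC_one)
      then show ?thesis using z1 that by (simp add: lie_zero_left)
    qed
    have z3: "G 1 b = 0" if "b \<in> ?I" "b \<noteq> 1" for b
    proof -
      obtain d where d: "d \<in> ?I" "d \<noteq> 1" "d \<noteq> b" using three[of 1 b] by blast
      then have "\<^bold>[G 1 d, G d b\<^bold>] = G 1 b" using that by (simp add: bracket_G kd_neq scaleC_one)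
      then show ?thesis using z2[of d b] d that by (simp add: lie_zero_right)
    qed
    have zz: "\<^bold>[G a b, x\<^bold>] = 0" if "a \<in> ?I" "b \<in> ?I" for a b x
    proof (rule G_span[where P = "\<lambda>x. \<^bold>[G a b, x\<^bold>] = 0", OF gen])
      fix c d assume cd: "c \<in> ?I" "d \<in> ?I"
      show "\<^bold>[G a b, G c d\<^bold>] = 0"
      proof (cases "a \<noteq> b \<or> c \<noteq> d")
        case True
        then show ?thesis using z2[of a b] z3[of b] z2[of c d] z3[of d] cd that
          by (metis lie_zero_left lie_zero_right)
      next
        case False
        then show ?thesis using cd that by (auto simp: bracket_G kd_def)
      qed
    qed (simp_all add: lie_zero_right lie_add_right lie_scale_right scaleC_zero_right)
    have "\<^bold>[y, x\<^bold>] = 0" for x y :: 'g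
      by (rule G_span[where P = "\<lambda>y. \<^bold>[y, x\<^bold>] = 0", OF gen])
         (simp_all only: zz lie_zero_left lie_add_left lie_scale_left scaleC_zero_right add_0_left)
    then show False using nonab by blast
  qed
  from norm[unfolded form_normalized_def th] obtain t
    where t: "t \<in> cx.span (h ` {1..l})" "?F t t = 2"
    and tx: "\<forall>x \<in> cx.span (h ` {1..l}). \<^bold>[x, G (l+1) 1\<^bold>] = ?F t x *\<^sub>C G (l+1) 1"
    by (elim bexE conjE)
  \<comment> \<open>The pairing of \<open>t\<close> with \<open>?t\<close> is computed twice: it is
    theta of \<open>?t\<close>, which is 2, and, because \<open>?t\<close> represents
    \<open>s\<close> times theta, it is also \<open>s\<close> times theta of \<open>t\<close>, which
    is \<open>2 s\<close>.\<close>
  let ?t = "G (l+1) (l+1) - G 1 1"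
  have "\<^bold>[?t, G (l+1) 1\<^bold>] = 2 *\<^sub>C G (l+1) 1"
    using \<open>l \<ge> 2\<close> scaleC_add_left[of 1 1 "G (l+1) 1"]
    by (simp add: lie_diff_left bracket_G kd_neq scaleC_one)
  then have t2: "?F t ?t = 2"
    using bspec[OF tx hspan] th0 by (metis cx.scale_right_imp_eq)
  have diagonal: "?F ?t (G c c) *\<^sub>C G (l+1) 1 = s *\<^sub>C \<^bold>[G c c, G (l+1) 1\<^bold>]" if "c \<in> ?I" for c
  proof -
    have "?F ?t (G c c) = s * (kd (l+1) c - kd 1 c)"
      using that by (simp add: dl F algebra_simps) (auto simp: kd_def)
    moreover have "\<^bold>[G c c, G (l+1) 1\<^bold>] = (kd (l+1) c - kd 1 c) *\<^sub>C G (l+1) 1"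
      using that \<open>l \<ge> 2\<close> by (simp add: bracket_G) (auto simp: kd_def scaleC_one)
    ultimately show ?thesis by (simp only: scaleC_scaleC)
  qed
  have "?F ?t x *\<^sub>C G (l+1) 1 = s *\<^sub>C \<^bold>[x, G (l+1) 1\<^bold>]" if "x \<in> cx.span (h ` {1..l})" for x
    using that
  proof (induction rule: cx.span_induct_alt)
    case base
    then show ?case by (simp add: form_zero_right lie_zero_left scaleC_zero_right)
  next
    case (step c y z)
    then obtain i where "i \<in> {1..l}" "y = h i" by blast
    then have i: "i \<in> {1..l}" "y = G (Suc i) (Suc i) - G i i"
      using G_diag_step[of i] by auto
    have y: "?F ?t y *\<^sub>C G (l+1) 1 = s *\<^sub>C \<^bold>[y, G (l+1) 1\<^bold>]"
      using diagonal[of i] diagonal[of "Suc i"] i(1)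
      unfolding i(2) dr lie_diff_left cx.scale_left_diff_distrib cx.scale_right_diff_distrib by simp
    have "?F ?t (c *\<^sub>C y + z) *\<^sub>C G (l+1) 1 =
        c *\<^sub>C (?F ?t y *\<^sub>C G (l+1) 1) + ?F ?t z *\<^sub>C G (l+1) 1"
      by (simp only: form_add_right form_scale_right scaleC_add_left scaleC_scaleC)
    also have "\<dots> = s *\<^sub>C \<^bold>[c *\<^sub>C y + z, G (l+1) 1\<^bold>]"
      unfolding y step.IH
      by (simp only: lie_add_left lie_scale_left scaleC_add_right scaleC_scaleC mult.commute)
    finally show ?case .
  qed
  from this[OF t(1)] have "?F ?t t = s * 2"
    using bspec[OF tx t(1)] th0 t(2) by (metis cx.scale_right_imp_eq scaleC_scaleC)
  then have "s = 1" using t2 sym[of t ?t] by simp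
  then show ?thesis using F I by simp
qed

section \<open>Quadratic fields at level \<open>- N / 2\<close>\<close>

lemma sum_kd:
  assumes "finite A" "a \<in> A"
  shows "(\<Sum>p\<in>A. kd a p * F p) = F a" "(\<Sum>p\<in>A. kd p a * F p) = F a"
    "(\<Sum>p\<in>A. kd a p) = 1" "(\<Sum>p\<in>A. kd p a) = 1"
  using assms by (simp_all add: kd_def if_distrib[where f = "\<lambda>x. x * _"] cong: if_cong)

lemma kd_sym: "kd a b = kd b a"
  by (simp add: kd_def eq_commute)

text \<open>Terms that leave or enter the window at the lower end are zero, those at the upper end
  follow the affine law. The correction is the sum of \<open>x + y s\<close> for \<open>s\<close>
  from \<open>T\<close> to \<open>T + n - 1\<close>, continued to negative \<open>n\<close>.\<close>

lemma sum_shift_affine: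
  fixes F :: "int \<Rightarrow> complex"
  assumes lo: "\<And>s. s < - B \<Longrightarrow> F s = 0" and hi: "\<And>s. s \<ge> B \<Longrightarrow> F s = x + y * of_int s"
    and T: "T \<ge> B + \<bar>n\<bar>" "B \<ge> 0"
  shows "(\<Sum>s\<in>{-T..<T}. F (s + n)) =
    (\<Sum>s\<in>{-T..<T}. F s) + of_int n * x + y * (of_int n * of_int T + of_int n * (of_int n - 1) / 2)"
proof -
  define H where "H n = (\<Sum>s\<in>{-T+n..<T+n}. F s)" for n
  have H: "(\<Sum>s\<in>{-T..<T}. F (s + n)) = H n" for n
    unfolding H_def by (rule sum.reindex_bij_witness[where i = "\<lambda>s. s - n" and j = "\<lambda>s. s + n"]) auto
  have step: "H (n + 1) = H n - F (- T + n) + F (T + n)" if "T > 0" for n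
  proof -
    have "{-T+n..<T+n} = insert (-T+n) {-T+n+1..<T+n}" "{-T+(n+1)..<T+(n+1)} = insert (T+n) {-T+n+1..<T+n}"
      using that by auto
    then show ?thesis unfolding H_def by simp
  qed
  have Hn: "H n = H 0 + of_int n * x + y * (of_int n * of_int T + of_int n * (of_int n - 1) / 2)"
    if "T \<ge> B + \<bar>n\<bar>" for n
    using that
  proof (induction n rule: int_induct[where k = 0])
    case base
    then show ?case by simp
  next
    case (step1 i)
    have "F (- T + i) = 0" using step1 by (intro lo) auto
    moreover have "F (T + i) = x + y * of_int (T + i)" using step1 T(2) by (intro hi) auto
    ultimately show ?case using step[of i] step1 T(2)
      by (simp add: field_simps)
  next
    case (step2 i)
    have "F (- T + (i - 1)) = 0" using step2 by (intro lo) auto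
    moreover have "F (T + (i - 1)) = x + y * of_int (T + (i - 1))" using step2 T(2) by (intro hi) auto
    moreover have "H i = H (i - 1) - F (- T + (i - 1)) + F (T + (i - 1))"
    proof -
      have "T > 0" using step2(1,3) T(2) by linarith
      then show ?thesis using step[of "i - 1"] by simp
    qed
    ultimately have 1: "H (i - 1) = H i - (x + y * of_int (T + (i - 1)))" by (simp only:) simp
    have 2: "H i = H 0 + of_int i * x + y * (of_int i * of_int T + of_int i * (of_int i - 1) / 2)"
      by (rule step2.IH) (use step2.prems step2.hyps in linarith)
    show ?case unfolding 1 2 by (simp add: field_simps)
  qed
  have "(\<Sum>s\<in>{-T..<T}. F s) = H 0" using H[of 0] by (simp only: add_0_right)
  then show ?thesis unfolding H[of n] Hn[OF T(1)] by (simp only:)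
qed

lemma sum_of_int_up: "T \<ge> 0 \<Longrightarrow> (\<Sum>s\<in>{0..<T}. of_int s :: complex) = of_int T * (of_int T - 1) / 2"
proof (induction T rule: int_ge_induct)
  case (step T)
  have "{0..<T+1} = insert T {0..<T}" using step by auto
  then show ?case using step by (simp add: field_simps)
qed simp

section \<open>The abstract setting: affine currents, the vacuum ideal and linear
  functionals\<close>

definition left_ideal :: "'u::ring set \<Rightarrow> bool" where
  "left_ideal W \<longleftrightarrow> 0 \<in> W \<and> (\<forall>x\<in>W. \<forall>y\<in>W. x + y \<in> W) \<and> (\<forall>u. \<forall>x\<in>W. u * x \<in> W)"

definition idx :: "nat \<Rightarrow> nat set" where
  "idx N = {1..N}"

lemma finite_idx [simp]: "finite (idx N)"
  and card_idx [simp]: "card (idx N) = N"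
  by (simp_all add: idx_def)

text \<open>\<open>'u\<close> stands for the enveloping algebra, \<open>E a b n\<close> for the mode
  of \<open>G a b\<close>, \<open>cc\<close> for the central element, \<open>K\<close> for the
  annihilator of the vacuum and \<open>vacf\<close> for the coefficient of the vacuum. The
  subtracted term with \<open>of_nat N\<close> comes from the form on traceless matrices.\<close>

locale sl_hat =
  fixes cst :: "complex \<Rightarrow> 'u::{ring, monoid_mult}" and N :: nat and E :: "nat \<Rightarrow> nat \<Rightarrow> int \<Rightarrow> 'u"
    and cc :: 'u and k :: complex and K :: "'u set" and vacf :: "'u \<Rightarrow> complex"
  assumes cst_add: "cst (\<alpha> + \<beta>) = cst \<alpha> + cst \<beta>" and cst_mult: "cst (\<alpha> * \<beta>) = cst \<alpha> * cst \<beta>"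
    and cst_1: "cst 1 = 1" and cst_central: "u * cst \<alpha> = cst \<alpha> * u"
    and E_comm: "\<lbrakk>a \<in> idx N; b \<in> idx N; c \<in> idx N; d \<in> idx N\<rbrakk> \<Longrightarrow>
      E a b s * E c d t = E c d t * E a b s + cst (kd b c) * E a d (s + t) - cst (kd a d) * E c b (s + t)
        + cst ((if s + t = 0 then of_int s else 0) * (kd b c * kd a d - kd a b * kd c d / of_nat N)) * cc"
    and E_trace: "(\<Sum>a\<in>idx N. E a a s) = 0"
    and U_induct: "\<And>P u. \<lbrakk>P 1; \<And>x y. P x \<Longrightarrow> P y \<Longrightarrow> P (x + y); \<And>\<alpha> x. P x \<Longrightarrow> P (cst \<alpha> * x);
      \<And>a b s x. a \<in> idx N \<Longrightarrow> b \<in> idx N \<Longrightarrow> P x \<Longrightarrow> P (E a b s * x); \<And>x. P x \<Longrightarrow> P (cc * x)\<rbrakk> \<Longrightarrow> P u"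
    and cc_central: "cc * u = u * cc"
    and K_ideal: "left_ideal K"
    and E_K: "\<lbrakk>a \<in> idx N; b \<in> idx N; s \<ge> 0\<rbrakk> \<Longrightarrow> E a b s \<in> K"
    and cc_K: "cc - cst k \<in> K"
    and vac_add: "vacf (x + y) = vacf x + vacf y" and vac_cst: "vacf (cst \<alpha> * x) = \<alpha> * vacf x"
    and vac_1: "vacf 1 = 1" and vac_K: "x \<in> K \<Longrightarrow> vacf x = 0"
    and vac_neg: "\<lbrakk>a \<in> idx N; b \<in> idx N; s < 0\<rbrakk> \<Longrightarrow> vacf (E a b s * x) = 0"
    and N_odd: "odd N" and N_ge: "N \<ge> 2" and k_def: "k = - of_nat N / 2"
begin

abbreviation I where "I \<equiv> idx N"

lemma cst_0 [simp]: "cst 0 = 0"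
  using cst_add[of 0 0] by simp

lemma cst_minus: "cst (- a) = - cst a"
proof -
  have "cst (- a) + cst a = cst (- a + a)" by (rule cst_add[symmetric])
  then have "cst (- a) + cst a = 0" by simp
  then show ?thesis by (rule eq_neg_iff_add_eq_0[THEN iffD2])
qed

lemma cst_left: "u * (cst a * x) = cst a * (u * x)"
  by (simp only: cst_central[of u a] flip: mult.assoc)

lemma ideal_zero: "left_ideal W \<Longrightarrow> 0 \<in> W"
  and ideal_add: "left_ideal W \<Longrightarrow> x \<in> W \<Longrightarrow> y \<in> W \<Longrightarrow> x + y \<in> W"
  and ideal_mult: "left_ideal W \<Longrightarrow> x \<in> W \<Longrightarrow> u * x \<in> W"
  for W :: "'u set"
  by (auto simp: left_ideal_def)

lemma ideal_minus: "left_ideal W \<Longrightarrow> x \<in> W \<Longrightarrow> - x \<in> W" for W :: "'u set"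
  using ideal_mult[of W x "cst (- 1)"] by (simp add: cst_minus cst_1)

lemma ideal_diff: "left_ideal W \<Longrightarrow> x \<in> W \<Longrightarrow> y \<in> W \<Longrightarrow> x - y \<in> W" for W :: "'u set"
  using ideal_add[of W x "- y"] ideal_minus by simp

lemma ideal_sum: "left_ideal W \<Longrightarrow> (\<And>i. i \<in> A \<Longrightarrow> g i \<in> W) \<Longrightarrow> (\<Sum>i\<in>A. g i) \<in> W" for W :: "'u set"
  by (induction A rule: infinite_finite_induct) (simp_all add: ideal_zero ideal_add)

lemma ideal_cancel: "left_ideal W \<Longrightarrow> x \<in> W \<Longrightarrow> x + y \<in> W \<longleftrightarrow> y \<in> W" for W :: "'u set"
  using ideal_diff[of W "x + y" x] ideal_add by auto

lemma ideal_scale: "left_ideal W \<Longrightarrow> a \<noteq> 0 \<Longrightarrow> cst a * x \<in> W \<longleftrightarrow> x \<in> W" for W :: "'u set"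
proof
  assume W: "left_ideal W" "a \<noteq> 0" "cst a * x \<in> W"
  then have "cst (1 / a) * (cst a * x) \<in> W" by (blast intro: ideal_mult)
  moreover have "cst (1 / a) * (cst a * x) = x"
    using W(2) cst_mult[of "1 / a" a] by (simp add: cst_1 flip: mult.assoc)
  ultimately show "x \<in> W" by simp
qed (rule ideal_mult)

text \<open>Identities modulo a left ideal are checked after applying the functionals that vanish on it,
  that is, in the complex numbers.\<close>

definition dual :: "'u set \<Rightarrow> ('u \<Rightarrow> complex) set" where
  "dual W = {f. (\<forall>x y. f (x + y) = f x + f y) \<and> (\<forall>a x. f (cst a * x) = a * f x) \<and> (\<forall>x\<in>W. f x = 0)}"

lemma dual_mono: "K' \<subseteq> W \<Longrightarrow> f \<in> dual W \<Longrightarrow> f \<in> dual K'"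
  by (auto simp: dual_def)

lemma dual_zero: "f \<in> dual W \<Longrightarrow> x \<in> W \<Longrightarrow> f x = 0"
  by (simp add: dual_def)

lemma dual_lin:
  assumes "f \<in> dual W"
  shows "f (x + y) = f x + f y" "f (cst a * x) = a * f x" "f (x - y) = f x - f y"
    "f 0 = 0" "f (- x) = - f x" "f (\<Sum>i\<in>A. g i) = (\<Sum>i\<in>A. f (g i))"
proof -
  show a: "f (x + y) = f x + f y" for x y using assms by (simp add: dual_def)
  show "f (cst a * x) = a * f x" using assms by (simp add: dual_def)
  show "f (x - y) = f x - f y" using a[of "x - y" y] by simp
  show z: "f 0 = 0" using a[of 0 0] by simp
  show "f (- x) = - f x" using a[of x "- x"] z by (simp add: eq_neg_iff_add_eq_0 add.commute)
  show "f (\<Sum>i\<in>A. g i) = (\<Sum>i\<in>A. f (g i))"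
    by (induction A rule: infinite_finite_induct) (simp_all add: a z)
qed

lemma dual_mult: "left_ideal W \<Longrightarrow> f \<in> dual W \<Longrightarrow> (\<lambda>x. f (u * x)) \<in> dual W"
  by (auto simp: dual_def distrib_left cst_left ideal_mult)

lemma cst_vector_space: "vector_space (\<lambda>a x. cst a * x)"
  by standard (simp_all only: distrib_left distrib_right cst_add cst_mult cst_1 mult.assoc mult_1_left)

text \<open>Adjoin \<open>x\<close> to a basis of \<open>W\<close>, extend to a basis of the whole
  space and take the coordinate at \<open>x\<close>.\<close>

lemma dual_separates:
  assumes "left_ideal W" "x \<notin> W"
  obtains f where "f \<in> dual W" "f x = 1"
proof -
  interpret v: vector_space "\<lambda>a x. cst a * x" by (rule cst_vector_space)
  have sub: "v.subspace W"
    using assms(1) by (auto simp: v.subspace_def ideal_zero ideal_add ideal_mult)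
  obtain B where B: "B \<subseteq> W" "v.independent B" "W \<subseteq> v.span B"
    using v.maximal_independent_subset[of W] by metis
  have sB: "v.span B = W" using B sub by (metis v.span_minimal subset_antisym)
  then have ind: "v.independent (insert x B)"
    using B(2) assms(2) v.independent_insert[of x B] by (metis (full_types) v.span_base)
  let ?B = "v.extend_basis (insert x B)"
  have iB: "v.independent ?B" and sp: "v.span ?B = UNIV" and sup: "insert x B \<subseteq> ?B"
    using v.independent_extend_basis[OF ind] v.span_extend_basis[OF ind] v.extend_basis_superset[OF ind] by auto
  define f where "f y = v.representation ?B y x" for y
  have "f y = 0" if "y \<in> W" for y
  proof -
    have "v.representation ?B y = v.representation B y"
      using that sB sup iB by (intro v.representation_extend) auto
    moreover have "x \<notin> B" using B(1) assms(2) by blast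
    ultimately show ?thesis
      unfolding f_def using v.representation_ne_zero[of B y x] by metis
  qed
  then have "f \<in> dual W"
    by (simp add: dual_def f_def v.representation_add[OF iB] v.representation_scale[OF iB] sp)
  moreover have "f x = 1"
    unfolding f_def using v.representation_basis[OF iB, of x] sup by auto
  ultimately show ?thesis by (rule that)
qed

lemma dual_mem: "left_ideal W \<Longrightarrow> (\<And>f. f \<in> dual W \<Longrightarrow> f x = 0) \<Longrightarrow> x \<in> W"
  by (metis dual_separates zero_neq_one)

lemma dual_comm:
  assumes W: "left_ideal W" "K \<subseteq> W" "f \<in> dual W" and "a \<in> I" "b \<in> I" "c \<in> I" "d \<in> I"
  shows "f (E a b s * (E c d t * y)) = f (E c d t * (E a b s * y)) + kd b c * f (E a d (s + t) * y)
    - kd a d * f (E c b (s + t) * y)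
    + (if s + t = 0 then of_int s else 0) * (kd b c * kd a d - kd a b * kd c d / of_nat N) * k * f y"
proof -
  \<comment> \<open>As \<open>cc\<close> is central, this difference is
    \<open>y * (cc - cst k)\<close>, so the central element acts as \<open>k\<close> on the left
    too.\<close>
  have "cc * y - cst k * y \<in> W"
    using ideal_mult[OF K_ideal cc_K, of y] W(2) by (auto simp: right_diff_distrib cst_central[of y] cc_central[of y])
  then have "f (cc * y) = k * f y"
    using dual_zero[OF W(3), of "cc * y - cst k * y"] by (simp add: dual_lin[OF W(3)])
  moreover have "E a b s * (E c d t * y) = E c d t * (E a b s * y) + cst (kd b c) * (E a d (s + t) * y)
    - cst (kd a d) * (E c b (s + t) * y)
    + cst ((if s + t = 0 then of_int s else 0) * (kd b c * kd a d - kd a b * kd c d / of_nat N)) * (cc * y)"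
    unfolding mult.assoc[symmetric] E_comm[OF assms(4-7)]
    by (simp add: distrib_right left_diff_distrib)
  ultimately show ?thesis by (simp add: dual_lin[OF W(3)])
qed

lemmas K_comm = dual_comm[OF K_ideal order.refl]

text \<open>For properties stable under adding elements of \<open>K\<close>, the step for
  \<open>cc\<close> reduces to the one for the scalar \<open>k\<close>.\<close>

lemma mod_induct [case_names one add scale E K]:
  assumes "P 1" "\<And>x y. P x \<Longrightarrow> P y \<Longrightarrow> P (x + y)" "\<And>a x. P x \<Longrightarrow> P (cst a * x)"
    "\<And>a b s x. a \<in> I \<Longrightarrow> b \<in> I \<Longrightarrow> P x \<Longrightarrow> P (E a b s * x)"
    and K: "\<And>x z. P x \<Longrightarrow> z \<in> K \<Longrightarrow> P (x + z)"
  shows "P u"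
proof (rule U_induct)
  fix x assume "P x"
  then have "P (cst k * x)" by (rule assms(3))
  moreover have "x * (cc - cst k) \<in> K" by (intro ideal_mult K_ideal cc_K)
  ultimately have "P (cst k * x + x * (cc - cst k))" by (rule K)
  then show "P (cc * x)" by (simp add: right_diff_distrib cst_central[of x] cc_central[of x])
qed (use assms in auto)

lemma smooth: "\<exists>B. \<forall>t\<ge>B. \<forall>a\<in>I. \<forall>b\<in>I. E a b t * u \<in> K"
proof (induction u rule: mod_induct)
  case one
  then show ?case using E_K by (intro exI[of _ 0]) auto
next
  case (add x y)
  then obtain B B' where "\<forall>t\<ge>B. \<forall>a\<in>I. \<forall>b\<in>I. E a b t * x \<in> K" "\<forall>t\<ge>B'. \<forall>a\<in>I. \<forall>b\<in>I. E a b t * y \<in> K"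
    by blast
  then show ?case
    by (intro exI[of _ "max B B'"]) (simp add: distrib_left ideal_add[OF K_ideal])
next
  case (scale a x)
  then show ?case by (metis cst_left ideal_mult[OF K_ideal])
next
  case (E c d s x)
  then obtain B where B: "\<forall>t\<ge>B. \<forall>a\<in>I. \<forall>b\<in>I. E a b t * x \<in> K" by blast
  \<comment> \<open>The bound \<open>B - s\<close> puts the modes \<open>t + s\<close> of the
    commutator above \<open>B\<close>; \<open>1 - s\<close> makes \<open>t + s\<close> positive, so
    that no central term arises.\<close>
  have "E a b t * (E c d s * x) \<in> K" if "t \<ge> max B (max (B - s) (1 - s))" "a \<in> I" "b \<in> I" for a b t
  proof (rule dual_mem[OF K_ideal])
    fix f assume p: "f \<in> dual K"
    have "f (E a b t * (E c d s * x)) = f (E c d s * (E a b t * x)) + kd b c * f (E a d (t + s) * x)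
      - kd a d * f (E c b (t + s) * x)"
      using that E K_comm[OF p, of a b c d t s x] by simp
    moreover have "E a b t * x \<in> K" "E a d (t + s) * x \<in> K" "E c b (t + s) * x \<in> K"
      using that E B by auto
    moreover from this have "E c d s * (E a b t * x) \<in> K" by (blast intro: ideal_mult[OF K_ideal])
    ultimately show "f (E a b t * (E c d s * x)) = 0" using dual_zero[OF p] by simp
  qed
  then show ?case by blast
next
  case (K x z)
  then show ?case by (metis distrib_left ideal_add[OF K_ideal] ideal_mult[OF K_ideal])
qed

text \<open>The quadratic sum is not normally ordered. For \<open>s \<ge> 0\<close> reordering a term adds \<open>N E i j m\<close>, which is
  subtracted here, and for \<open>m = 0\<close> also a multiple of \<open>s kd i j\<close>, which cancels in the traceless part.
  Applied to a fixed vector, everything is eventually constant in the cutoff \<open>T\<close> up to that multiple.\<close>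

definition Q :: "int \<Rightarrow> nat \<Rightarrow> nat \<Rightarrow> int \<Rightarrow> 'u" where
  "Q T i j m = (\<Sum>s\<in>{-T..<T}. \<Sum>p\<in>I. E i p s * E p j (m - s))
     + cst (of_nat N / 2 * of_int (m + 1) - of_int T * of_nat N) * E i j m"

lemma dual_Q:
  assumes "f \<in> dual W"
  shows "f (Q T i j m * u) = (\<Sum>s\<in>{-T..<T}. \<Sum>p\<in>I. f (E i p s * (E p j (m - s) * u)))
     + (of_nat N / 2 * of_int (m + 1) - of_int T * of_nat N) * f (E i j m * u)"
  unfolding Q_def by (simp add: distrib_right sum_distrib_right dual_lin[OF assms] mult.assoc)

lemma dual_trace:
  assumes p: "f \<in> dual W"
  shows "(\<Sum>p\<in>I. f (E p p m * u)) = 0"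
  by (simp only: dual_lin(6)[OF p, symmetric] sum_distrib_right[symmetric] E_trace mult_zero_left dual_lin(4)[OF p])

text \<open>Where \<open>E i p s\<close> annihilates \<open>u\<close>, only the commutator survives,
  and its part with \<open>E p p m\<close> sums to zero by tracelessness. This is the source of both
  the term \<open>N E i j m\<close> per \<open>s\<close> and the affine growth in
  \<open>s\<close>.\<close>

lemma comm_trace_sum:
  assumes W: "left_ideal W" "K \<subseteq> W" "f \<in> dual W" and ij: "i \<in> I" "j \<in> I"
    and z: "\<And>p. p \<in> I \<Longrightarrow> E i p s * u \<in> W"
  shows "(\<Sum>p\<in>I. f (E i p s * (E p j (m - s) * u))) = of_nat N * f (E i j m * u)
     + (if m = 0 then of_int s * kd i j * (of_nat N - 1 / of_nat N) * k * f u else 0)"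
proof -
  have "f (E i p s * (E p j (m - s) * u)) = f (E i j m * u) - kd i j * f (E p p m * u)
    + (if m = 0 then of_int s * k * f u * (kd i j - kd i p * kd p j / of_nat N) else 0)" if "p \<in> I" for p
    using dual_comm[OF W, of i p p j s "m - s" u] ij that
      dual_zero[OF W(3) ideal_mult[OF W(1) z], of p] by simp
  then have "(\<Sum>p\<in>I. f (E i p s * (E p j (m - s) * u))) = (\<Sum>p\<in>I. f (E i j m * u) - kd i j * f (E p p m * u)
    + (if m = 0 then of_int s * k * f u * (kd i j - kd i p * kd p j / of_nat N) else 0))"
    by (intro sum.cong refl)
  also have "\<dots> = of_nat N * f (E i j m * u)
     + (if m = 0 then of_int s * k * f u * (of_nat N * kd i j - kd i j / of_nat N) else 0)"
    using ij dual_trace[OF W(3), of m u]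
    by (simp add: sum.distrib sum_subtractf sum_kd flip: sum_distrib_left sum_divide_distrib)
  finally show ?thesis by (simp add: algebra_simps)
qed

text \<open>The current acts as a derivation on each product in \<open>Q\<close>; the resulting sums
  are brought back to the window by \<open>sum_shift_affine\<close>. The last term is the multiple
  of the identity matrix that remains at this level. The threshold for \<open>T\<close> depends on
  \<open>u\<close> but not on \<open>f\<close>, which lets the identity be composed with left
  multiplications.\<close>

lemma Q_comm:
  assumes ab: "a \<in> I" "b \<in> I" and ij: "i \<in> I" "j \<in> I"
  shows "\<forall>\<^sub>F T in at_top. \<forall>f\<in>dual K. f (E a b n * (Q T i j m * u)) = f (Q T i j m * (E a b n * u))
    + kd b i * f (Q T a j (m + n) * u) - kd a j * f (Q T i b (m + n) * u)
    + of_int n * kd i j * f (E a b (m + n) * u)"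
proof -
  obtain B0 where B0: "\<forall>t\<ge>B0. \<forall>a\<in>I. \<forall>b\<in>I. E a b t * u \<in> K" using smooth by blast
  define M where "M = m + n"
  define B where "B = \<bar>B0\<bar> + \<bar>M\<bar>"
  have N0: "of_nat N \<noteq> (0 :: complex)" using N_ge by simp
  have "f (E a b n * (Q T i j m * u)) = f (Q T i j m * (E a b n * u))
    + kd b i * f (Q T a j M * u) - kd a j * f (Q T i b M * u)
    + of_int n * kd i j * f (E a b M * u)" if T: "T \<ge> B + \<bar>n\<bar> + 1" and p: "f \<in> dual K" for T f
  proof -
    note pl = dual_lin[OF p]
    define e where "e x y = f (E x y M * u)" for x y
    define A where "A x y s = (\<Sum>p\<in>I. f (E x p s * (E p y (M - s) * u)))" for x y s
    define D where "D s = f (E i b s * (E a j (M - s) * u))" for s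
    define z :: "int \<Rightarrow> complex" where "z s = (if s = 0 then 1 else 0)" for s
    have zz: "(if s = 0 then of_int n else 0) = z s * of_int n" for s n :: int by (simp add: z_def)
    note Kc = K_comm[unfolded zz]
    have arith: "X - Z = P1 - P2 + z1 * (kd a p * (kd b i * w) - kd i p * (kd a b / of_nat N * w)) +
          Q1 - Q2 + z2 * (kd b p * (kd a j * w') - kd p j * (kd a b / of_nat N * w'))"
      if "X = Y + P1 - P2 + z1 * (kd b i * kd a p - kd a b * kd i p / of_nat N) * w"
         "Y = Z + Q1 - Q2 + z2 * (kd b p * kd a j - kd a b * kd p j / of_nat N) * w'"
      for X Y Z P1 P2 Q1 Q2 w w' z1 z2 p
      using that by (simp add: algebra_simps)
    have one: "f (E a b n * (E i p s * (E p j (m - s) * u))) - f (E i p s * (E p j (m - s) * (E a b n * u))) =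
      kd b i * f (E a p (n + s) * (E p j (m - s) * u)) - kd a p * f (E i b (n + s) * (E p j (m - s) * u))
      + z (n + s) * of_int n * k * (kd a p * (kd b i * f (E p j (m - s) * u)) - kd i p * (kd a b / of_nat N * f (E p j (m - s) * u)))
      + kd b p * f (E i p s * (E a j (n + (m - s)) * u)) - kd a j * f (E i p s * (E p b (n + (m - s)) * u))
      + z (n + (m - s)) * of_int n * k * (kd b p * (kd a j * f (E i p s * u)) - kd p j * (kd a b / of_nat N * f (E i p s * u)))"
      if "p \<in> I" for p s
    proof (rule arith)
      show "f (E a b n * (E i p s * (E p j (m - s) * u))) = f (E i p s * (E a b n * (E p j (m - s) * u)))
          + kd b i * f (E a p (n + s) * (E p j (m - s) * u)) - kd a p * f (E i b (n + s) * (E p j (m - s) * u))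
          + (z (n + s) * of_int n * k) * (kd b i * kd a p - kd a b * kd i p / of_nat N) * f (E p j (m - s) * u)"
        using Kc[OF p, of a b i p n s "E p j (m - s) * u"] ab ij that by (simp add: mult_ac)
      show "f (E i p s * (E a b n * (E p j (m - s) * u))) = f (E i p s * (E p j (m - s) * (E a b n * u)))
          + kd b p * f (E i p s * (E a j (n + (m - s)) * u)) - kd a j * f (E i p s * (E p b (n + (m - s)) * u))
          + (z (n + (m - s)) * of_int n * k) * (kd b p * kd a j - kd a b * kd p j / of_nat N) * f (E i p s * u)"
        using Kc[OF dual_mult[OF K_ideal p, of "E i p s"], of a b p j n "m - s" u] ab ij that
        by (simp add: mult_ac)
    qed
    \<comment> \<open>In the sum over \<open>p\<close>, the two terms in which the current meets the
      contracted index collapse to \<open>D (s + n)\<close> and \<open>D s\<close>. They would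
      cancel in a sum over all integers and here leave a shift term.\<close>
    have per0: "(\<Sum>p\<in>I. f (E a b n * (E i p s * (E p j (m - s) * u)))) - (\<Sum>p\<in>I. f (E i p s * (E p j (m - s) * (E a b n * u))))
      = kd b i * A a j (s + n) - D (s + n) + D s - kd a j * A i b s
       + z (n + s) * of_int n * k * (kd b i * f (E a j (m - s) * u) - kd a b / of_nat N * f (E i j (m - s) * u))
       + z (n + (m - s)) * of_int n * k * (kd a j * f (E i b s * u) - kd a b / of_nat N * f (E i j s * u))" for s
    proof -
      have A1: "(\<Sum>p\<in>I. f (E a p (n + s) * (E p j (m - s) * u))) = A a j (s + n)"
        and A2: "(\<Sum>p\<in>I. f (E i p s * (E p b (n + (m - s)) * u))) = A i b s"
        and D1: "f (E i b (n + s) * (E a j (m - s) * u)) = D (s + n)"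
        and D2: "f (E i b s * (E a j (n + (m - s)) * u)) = D s"
        by (simp_all add: A_def D_def M_def algebra_simps)
      show ?thesis
        unfolding sum_subtractf[symmetric] using ab ij
        by (simp add: one sum.distrib sum_subtractf sum_kd A1 A2 D1 D2 flip: sum_distrib_left sum_divide_distrib)
    qed
    have regroup: "X = Y + (P + z1 * (c1 * c2 * Q) + z2 * (c1 * c2 * R))"
      if "X - Y = P + z1 * c1 * c2 * Q + z2 * c1 * c2 * R" for X Y P Q R z1 z2 c1 c2 :: complex
      using that by (simp add: algebra_simps)
    have per: "(\<Sum>p\<in>I. f (E a b n * (E i p s * (E p j (m - s) * u)))) = (\<Sum>p\<in>I. f (E i p s * (E p j (m - s) * (E a b n * u))))
       + (kd b i * A a j (s + n) - D (s + n) + D s - kd a j * A i b s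
       + z (n + s) * (of_int n * k * (kd b i * f (E a j (m - s) * u) - kd a b / of_nat N * f (E i j (m - s) * u)))
       + z (n + (m - s)) * (of_int n * k * (kd a j * f (E i b s * u) - kd a b / of_nat N * f (E i j s * u))))" for s
      by (rule regroup[OF per0])
    have zs: "(\<Sum>s\<in>{-T..<T}. z (n + s) * X s) = X (- n)" "(\<Sum>s\<in>{-T..<T}. z (n + (m - s)) * X s) = X M" for X
    proof -
      have "z (n + s) = kd s (- n)" "z (n + (m - s)) = kd s M" for s
        by (auto simp: z_def kd_def M_def)
      moreover have "- n \<in> {-T..<T}" "M \<in> {-T..<T}" using T by (auto simp: B_def)
      ultimately show "(\<Sum>s\<in>{-T..<T}. z (n + s) * X s) = X (- n)" "(\<Sum>s\<in>{-T..<T}. z (n + (m - s)) * X s) = X M"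
        by (simp_all only: sum_kd finite_atLeastLessThan_int)
    qed
    define SA SD where "SA x y = (\<Sum>s\<in>{-T..<T}. A x y s)" and "SD = (\<Sum>s\<in>{-T..<T}. D s)" for x y
    define cT where "cT m = of_nat N / 2 * of_int (m + 1) - of_int T * (of_nat N :: complex)" for m
    define q1 q2 where "q1 = (\<Sum>s\<in>{-T..<T}. (\<Sum>p\<in>I. f (E i p s * (E p j (m - s) * (E a b n * u)))))"
      and "q2 = f (E i j m * (E a b n * u))"
    define w where "w = (if M = 0 then k * f u else 0)"
    have lo: "E x y (M - s) * u \<in> K" if "s < - B" "x \<in> I" "y \<in> I" for x y s
      using that B0 by (auto simp: B_def)
    have lo2: "f (v * (E x y (M - s) * u)) = 0" if "s < - B" "x \<in> I" "y \<in> I" for v x y s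
      by (rule dual_zero[OF p ideal_mult[OF K_ideal lo[OF that]]])
    have hi: "E x y s * u \<in> K" if "s \<ge> B" "x \<in> I" "y \<in> I" for x y s
      using that B0 by (auto simp: B_def)
    \<comment> \<open>Below \<open>- B\<close> the right factor annihilates \<open>u\<close>; from
      \<open>B\<close> on the left factor does, and \<open>comm_trace_sum\<close> supplies the
      affine law.\<close>
    have shA: "(\<Sum>s\<in>{-T..<T}. A a j (s + n)) = SA a j + of_int n * (of_nat N * e a j) +
      (kd a j * (of_nat N - 1 / of_nat N) * w) * (of_int n * of_int T + of_int n * (of_int n - 1) / 2)"
      unfolding SA_def
    proof (rule sum_shift_affine)
      show "A a j s = 0" if "s < - B" for s
        unfolding A_def using that ij by (simp add: lo2)
      show "A a j s = of_nat N * e a j + kd a j * (of_nat N - 1 / of_nat N) * w * of_int s" if "s \<ge> B" for s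
        unfolding A_def e_def w_def
        using comm_trace_sum[OF K_ideal order.refl p ab(1) ij(2), of s u M] hi[OF that ab(1)] by simp
    qed (use T in \<open>auto simp: B_def\<close>)
    have shD: "(\<Sum>s\<in>{-T..<T}. D (s + n)) = SD + of_int n * (kd a b * e i j - kd i j * e a b) +
      ((kd a b * kd i j - kd b i * kd a j / of_nat N) * w) * (of_int n * of_int T + of_int n * (of_int n - 1) / 2)"
      unfolding SD_def
    proof (rule sum_shift_affine)
      show "D s = 0" if "s < - B" for s
        unfolding D_def using that ab ij by (simp add: lo2)
      show "D s = kd a b * e i j - kd i j * e a b + (kd a b * kd i j - kd b i * kd a j / of_nat N) * w * of_int s"
        if "s \<ge> B" for s
        unfolding D_def e_def w_def
        using K_comm[OF p, of i b a j s "M - s" u] ab ij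
          dual_zero[OF p ideal_mult[OF K_ideal hi[OF that]], of i b]
        by (simp add: kd_sym[of b])
    qed (use T in \<open>auto simp: B_def\<close>)
    have Ec: "f (E a b n * (E i j m * u)) = q2 + kd b i * e a j - kd a j * e i b
       + of_int n * (kd b i * kd a j - kd a b * kd i j / of_nat N) * w"
      unfolding q2_def e_def w_def M_def using K_comm[OF p, of a b i j n m u] ab ij by (simp add: add.commute)
    have "(\<Sum>s\<in>{-T..<T}. (\<Sum>p\<in>I. f (E a b n * (E i p s * (E p j (m - s) * u))))) = q1 +
       (kd b i * (\<Sum>s\<in>{-T..<T}. A a j (s + n)) - (\<Sum>s\<in>{-T..<T}. D (s + n)) + SD - kd a j * SA i b
       + of_int n * k * (kd b i * e a j - kd a b / of_nat N * e i j)
       + of_int n * k * (kd a j * e i b - kd a b / of_nat N * e i j))"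
      unfolding per sum.distrib sum_subtractf zs q1_def SD_def SA_def e_def M_def
      by (simp add: add.commute flip: sum_distrib_left)
    then have L: "f (E a b n * (Q T i j m * u)) = q1 +
       (kd b i * (SA a j + of_int n * (of_nat N * e a j) +
      (kd a j * (of_nat N - 1 / of_nat N) * w) * (of_int n * of_int T + of_int n * (of_int n - 1) / 2))
       - (SD + of_int n * (kd a b * e i j - kd i j * e a b) +
      ((kd a b * kd i j - kd b i * kd a j / of_nat N) * w) * (of_int n * of_int T + of_int n * (of_int n - 1) / 2))
       + SD - kd a j * SA i b
       + of_int n * k * (kd b i * e a j - kd a b / of_nat N * e i j)
       + of_int n * k * (kd a j * e i b - kd a b / of_nat N * e i j))
       + cT m * (q2 + kd b i * e a j - kd a j * e i b
       + of_int n * (kd b i * kd a j - kd a b * kd i j / of_nat N) * w)"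
      unfolding dual_Q[OF dual_mult[OF K_ideal p]] shA shD Ec cT_def by simp
    have R: "f (Q T i j m * (E a b n * u)) + kd b i * f (Q T a j M * u) - kd a j * f (Q T i b M * u)
        + of_int n * kd i j * f (E a b M * u)
      = q1 + cT m * q2 + kd b i * (SA a j + cT M * e a j) - kd a j * (SA i b + cT M * e i b)
        + of_int n * kd i j * e a b"
      unfolding dual_Q[OF p] q1_def q2_def SA_def A_def e_def cT_def by simp
    have cM: "cT M = cT m + of_nat N / 2 * of_int n" by (simp add: cT_def M_def field_simps)
    \<comment> \<open>\<open>w\<close> vanishes unless \<open>m = - n\<close>, so \<open>m\<close>
      may be replaced by \<open>- n\<close> beside it. The terms with \<open>T\<close> then cancel
      against those from the shifts.\<close>
    have cw: "cT m * w = (of_nat N / 2 * (1 - of_int n) - of_int T * of_nat N) * w"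
    proof (cases "M = 0")
      case True
      then have "m = - n" by (simp add: M_def)
      then show ?thesis by (simp add: cT_def)
    qed (simp add: w_def)
    have cw': "cT m * (of_int n * X * w) = (of_nat N / 2 * (1 - of_int n) - of_int T * of_nat N) * w * (of_int n * X)" for X
      unfolding cw[symmetric] by simp
    \<comment> \<open>Divided by \<open>n\<close>, the extra terms of \<open>e a j\<close>,
      \<open>e i b\<close> and \<open>e i j\<close> agree if \<open>N + k = N / 2\<close>,
      \<open>k = - N / 2\<close> and \<open>1 + 2 k / N = 0\<close>, all true at this level. The
      terms with \<open>w\<close> cancel by \<open>cw'\<close>, and \<open>n kd i j e a b\<close>
      remains.\<close>
    show ?thesis
      unfolding L R cM distrib_left[of "cT m"] right_diff_distrib[of "cT m"] cw'
      unfolding k_def using N0 by (simp add: field_simps)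
  qed
  then show ?thesis unfolding eventually_at_top_linorder M_def by blast
qed

end

text \<open>Subtracting equation \<open>i + 1\<close> from equation \<open>i\<close> leaves
  \<open>\<mu> i - \<mu> (i + 1)\<close> times an integer of the parity of \<open>N\<close>, which
  is odd and so nonzero. All weights are therefore equal, and by the trace condition they are
  zero.\<close>

lemma weights_zero:
  fixes \<mu> :: "nat \<Rightarrow> int" and d :: int
  assumes N: "odd N"
    and eq: "\<And>i. i \<in> idx N \<Longrightarrow>
      2 * (\<mu> i)\<^sup>2 + 2 * (\<Sum>p\<in>idx N. if i < p then \<mu> i - \<mu> p else 0) - int N * \<mu> i = 2 * d"
    and tr: "(\<Sum>i\<in>idx N. \<mu> i) = 0"
  shows "d = 0"
proof -
  have step: "\<mu> (Suc i) = \<mu> i" if i: "i \<in> idx N" "Suc i \<in> idx N" for i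
  proof -
    have "(\<Sum>p\<in>idx N. if i < p then \<mu> i - \<mu> p else 0) - (\<Sum>p\<in>idx N. if Suc i < p then \<mu> (Suc i) - \<mu> p else 0)
      = (\<Sum>p\<in>idx N. if i < p then \<mu> i - \<mu> (Suc i) else 0)"
      unfolding sum_subtractf[symmetric]
    proof (rule sum.cong)
      fix p assume "p \<in> idx N"
      show "(if i < p then \<mu> i - \<mu> p else 0) - (if Suc i < p then \<mu> (Suc i) - \<mu> p else 0)
        = (if i < p then \<mu> i - \<mu> (Suc i) else 0)"
        by (cases "p = Suc i") auto
    qed simp
    also have "\<dots> = (\<Sum>p\<in>{p\<in>idx N. i < p}. \<mu> i - \<mu> (Suc i))"
      by (rule sum.inter_filter[symmetric]) simp
    also have "\<dots> = int (N - i) * (\<mu> i - \<mu> (Suc i))"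
    proof -
      have "{p\<in>idx N. i < p} = {Suc i..N}" by (auto simp: idx_def)
      then show ?thesis by simp
    qed
    finally have "2 * (\<mu> i)\<^sup>2 - 2 * (\<mu> (Suc i))\<^sup>2 + 2 * (int (N - i) * (\<mu> i - \<mu> (Suc i)))
      - int N * (\<mu> i - \<mu> (Suc i)) = 0"
      using eq[OF i(1)] eq[OF i(2)] by (simp add: algebra_simps)
    then have "(\<mu> i - \<mu> (Suc i)) * (2 * (\<mu> i + \<mu> (Suc i) + int (N - i)) - int N) = 0"
      by (simp add: algebra_simps power2_eq_square)
    moreover have "2 * (\<mu> i + \<mu> (Suc i) + int (N - i)) - int N \<noteq> 0"
      using N by presburger
    ultimately show ?thesis by simp
  qed
  have N1: "1 \<in> idx N" using N by (cases N) (auto simp: idx_def)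
  have const: "\<mu> i = \<mu> 1" if "i \<in> idx N" for i
    using that
  proof (induction i)
    case (Suc i)
    then show ?case using step[of i] by (cases "i = 0") (auto simp: idx_def)
  qed (simp add: idx_def)
  have "(\<Sum>i\<in>idx N. \<mu> i) = int N * \<mu> 1" using const by (simp cong: sum.cong)
  with tr N have "\<mu> 1 = 0" by auto
  moreover have "(\<Sum>p\<in>idx N. if 1 < p then \<mu> 1 - \<mu> p else 0) = 0"
    using const by (intro sum.neutral) auto
  ultimately show ?thesis using eq[OF N1] by simp
qed

section \<open>The trace and the traceless part of the quadratic field\<close>

context sl_hat begin

lemma N_nonzero [simp]: "of_nat N \<noteq> (0 :: complex)"
  and N_pos [simp]: "N \<noteq> 0" "N > 0"
  using N_ge by auto

definition S :: "int \<Rightarrow> int \<Rightarrow> 'u" where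
  "S T m = (\<Sum>i\<in>I. Q T i i m)"

definition R :: "int \<Rightarrow> nat \<Rightarrow> nat \<Rightarrow> int \<Rightarrow> 'u" where
  "R T i j m = Q T i j m - cst (kd i j / of_nat N) * S T m"

lemma dual_S: "f \<in> dual W \<Longrightarrow> f (S T m * u) = (\<Sum>i\<in>I. f (Q T i i m * u))"
  by (simp add: S_def sum_distrib_right dual_lin)

lemma dual_R: "f \<in> dual W \<Longrightarrow> f (R T i j m * u) = f (Q T i j m * u) - kd i j / of_nat N * f (S T m * u)"
  by (simp add: R_def left_diff_distrib mult.assoc dual_lin)

lemma eventually_ball2:
  "\<lbrakk>finite A; finite B; \<And>i j. i \<in> A \<Longrightarrow> j \<in> B \<Longrightarrow> \<forall>\<^sub>F T in F. P T i j\<rbrakk> \<Longrightarrow> \<forall>\<^sub>F T in F. \<forall>i\<in>A. \<forall>j\<in>B. P T i j"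
  by (simp add: eventually_ball_finite)

lemma Q_comm_all:
  assumes ab: "a \<in> I" "b \<in> I"
  shows "\<forall>\<^sub>F T in at_top. \<forall>i\<in>I. \<forall>j\<in>I. \<forall>f\<in>dual K. f (E a b n * (Q T i j m * u)) = f (Q T i j m * (E a b n * u))
    + kd b i * f (Q T a j (m + n) * u) - kd a j * f (Q T i b (m + n) * u)
    + of_int n * kd i j * f (E a b (m + n) * u)"
  by (rule eventually_ball2[OF finite_idx finite_idx]) (rule Q_comm[OF ab])

text \<open>In the trace the two adjoint terms of \<open>Q_comm\<close> cancel. What remains says
  that \<open>S / N\<close> obeys the rule \<open>[x(n), L(m)] = n x(m + n)\<close> of the Sugawara
  operators.\<close>

lemma S_comm:
  assumes ab: "a \<in> I" "b \<in> I"
  shows "\<forall>\<^sub>F T in at_top. \<forall>f\<in>dual K. f (E a b n * (S T m * u)) = f (S T m * (E a b n * u))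
    + of_nat N * of_int n * f (E a b (m + n) * u)"
  using Q_comm_all[OF ab, of n m u]
proof (rule eventually_mono, intro ballI, goal_cases)
  case (1 T f)
  note Q = 1(1) and p = 1(3)
  have "f (E a b n * (S T m * u)) = (\<Sum>i\<in>I. f (E a b n * (Q T i i m * u)))"
    by (rule dual_S[OF dual_mult[OF K_ideal p]])
  also have "\<dots> = (\<Sum>i\<in>I. f (Q T i i m * (E a b n * u)) + kd b i * f (Q T a i (m + n) * u)
      - kd a i * f (Q T i b (m + n) * u) + of_int n * f (E a b (m + n) * u))"
  proof (rule sum.cong)
    fix i assume "i \<in> I"
    with Q p have "f (E a b n * (Q T i i m * u)) = f (Q T i i m * (E a b n * u))
      + kd b i * f (Q T a i (m + n) * u) - kd a i * f (Q T i b (m + n) * u)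
      + of_int n * kd i i * f (E a b (m + n) * u)" by blast
    then show "f (E a b n * (Q T i i m * u)) = f (Q T i i m * (E a b n * u)) + kd b i * f (Q T a i (m + n) * u)
      - kd a i * f (Q T i b (m + n) * u) + of_int n * f (E a b (m + n) * u)" by simp
  qed simp
  also have "\<dots> = f (S T m * (E a b n * u)) + of_nat N * of_int n * f (E a b (m + n) * u)"
    using ab by (simp add: sum.distrib sum_subtractf sum_kd dual_S[OF p])
  finally show "f (E a b n * (S T m * u)) = f (S T m * (E a b n * u))
    + of_nat N * of_int n * f (E a b (m + n) * u)" .
qed

text \<open>The multiple of the identity in \<open>Q_comm\<close> is removed by subtracting the
  trace, so the commutator no longer depends on \<open>n\<close> except through the mode
  number.\<close>

lemma R_comm:
  assumes ab: "a \<in> I" "b \<in> I" and ij: "i \<in> I" "j \<in> I"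
  shows "\<forall>\<^sub>F T in at_top. \<forall>f\<in>dual K. f (E a b n * (R T i j m * u)) = f (R T i j m * (E a b n * u))
    + kd b i * f (R T a j (m + n) * u) - kd a j * f (R T i b (m + n) * u)"
  using eventually_conj[OF Q_comm[OF ab ij, of n m u] S_comm[OF ab, of n m u]]
proof (rule eventually_mono, intro ballI, goal_cases)
  case (1 T f)
  note QS = 1(1) and p = 1(3)
  have "f (E a b n * (R T i j m * u)) = f (E a b n * (Q T i j m * u)) - kd i j / of_nat N * f (E a b n * (S T m * u))"
    by (rule dual_R[OF dual_mult[OF K_ideal p]])
  also have "\<dots> = f (R T i j m * (E a b n * u)) + (kd b i * f (Q T a j (m + n) * u) - kd a j * f (Q T i b (m + n) * u))"
    unfolding bspec[OF conjunct1[OF QS] p] bspec[OF conjunct2[OF QS] p] dual_R[OF p]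
    by (simp add: field_simps)
  also have "kd b i * f (Q T a j (m + n) * u) - kd a j * f (Q T i b (m + n) * u) =
      kd b i * f (R T a j (m + n) * u) - kd a j * f (R T i b (m + n) * u)"
    by (simp add: dual_R[OF p] right_diff_distrib kd_sym[of b] flip: mult.assoc)
  finally show "f (E a b n * (R T i j m * u)) = f (R T i j m * (E a b n * u))
    + kd b i * f (R T a j (m + n) * u) - kd a j * f (R T i b (m + n) * u)" by simp
qed

lemma K_dual_zero: "f \<in> dual K \<Longrightarrow> x \<in> K \<Longrightarrow> f (u * x) = 0"
  using dual_zero[OF dual_mult[OF K_ideal]] .

lemma K_right: "x \<in> K \<Longrightarrow> u * x \<in> K"
  by (rule ideal_mult[OF K_ideal])

text \<open>The sum of the central terms \<open>(N - 1 / N) k s\<close> over \<open>s\<close> in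
  \<open>{0..<T}\<close>. It grows with the cutoff, and \<open>S T 0 / N\<close> measures the degree
  only up to this shift, which is the same for all vectors.\<close>

definition gamma :: "int \<Rightarrow> complex" where
  "gamma T = (of_nat N - 1 / of_nat N) * k * (of_int T * (of_int T - 1) / 2)"

text \<open>For \<open>s < 0\<close> the right factor kills the vacuum; for \<open>s \<ge> 0\<close>
  the commutators add up to \<open>T N E i j m\<close>, which the definition of \<open>Q\<close>
  subtracts. The remaining correction vanishes through the factor \<open>m + 1\<close> at
  \<open>m = -1\<close> and through the vacuum for \<open>m \<ge> 0\<close>.\<close>

lemma Q_vacuum:
  assumes ij: "i \<in> I" "j \<in> I" and m: "m \<ge> -1" and T: "T \<ge> 0" and p: "f \<in> dual K"
  shows "f (Q T i j m) = (if m = 0 then kd i j * gamma T * f 1 else 0)"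
proof -
  define G where "G s = (\<Sum>p\<in>I. f (E i p s * (E p j (m - s) * 1)))" for s
  have neg: "G s = 0" if "s < 0" for s
    unfolding G_def using that m ij
    by (intro sum.neutral ballI) (auto intro!: K_dual_zero[OF p] E_K)
  have pos: "G s = of_nat N * f (E i j m) + (if m = 0 then kd i j * (of_nat N - 1 / of_nat N) * k * f 1 else 0) * of_int s"
    if "s \<ge> 0" for s
    unfolding G_def using comm_trace_sum[OF K_ideal order.refl p ij, of s 1 m] E_K[OF ij(1) _ that] by simp
  have "(\<Sum>s\<in>{-T..<T}. G s) = (\<Sum>s\<in>{0..<T}. G s)"
    using neg T by (intro sum.mono_neutral_right) auto
  also have "\<dots> = (\<Sum>s\<in>{0..<T}. of_nat N * f (E i j m) + (if m = 0 then kd i j * (of_nat N - 1 / of_nat N) * k * f 1 else 0) * of_int s)"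
    by (intro sum.cong) (auto simp: pos)
  also have "\<dots> = of_int T * of_nat N * f (E i j m) + (if m = 0 then kd i j * gamma T * f 1 else 0)"
    using T by (simp add: sum.distrib sum_of_int_up gamma_def flip: sum_distrib_left sum_distrib_right)
  finally have "(\<Sum>s\<in>{-T..<T}. G s) = \<dots>" .
  moreover have z: "of_int (m + 1) * f (E i j m) = 0"
    using E_K[OF ij, of m] m dual_zero[OF p] by (cases "m = -1") auto
  have "of_nat N / 2 * of_int (m + 1) * f (E i j m) = 0"
    by (simp only: mult.assoc z mult_zero_right)
  ultimately show ?thesis
    using dual_Q[OF p, of T i j m 1] unfolding G_def by (simp add: left_diff_distrib)
qed

lemma S_vacuum:
  assumes "m \<ge> -1" "T \<ge> 0" "f \<in> dual K"
  shows "f (S T m) = (if m = 0 then of_nat N * gamma T * f 1 else 0)"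
  using dual_S[OF assms(3), of T m 1] assms by (simp add: Q_vacuum)

lemma R_vacuum:
  assumes "i \<in> I" "j \<in> I" "m \<ge> -1" "T \<ge> 0" "f \<in> dual K"
  shows "f (R T i j m) = 0"
  using dual_R[OF assms(5), of T i j m 1] assms by (simp add: Q_vacuum S_vacuum)

text \<open>What is left of \<open>Q T i j m\<close> on the vacuum for \<open>m \<le> -2\<close> and
  large \<open>T\<close>: the range of \<open>s\<close> is the one where both modes are
  negative.\<close>

definition Qv :: "nat \<Rightarrow> nat \<Rightarrow> int \<Rightarrow> 'u" where
  "Qv i j m = (\<Sum>s\<in>{m+1..<0}. \<Sum>p\<in>I. E i p s * E p j (m - s)) + cst (of_nat N / 2 * of_int (m + 1)) * E i j m"

definition Rv :: "nat \<Rightarrow> nat \<Rightarrow> int \<Rightarrow> 'u" where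
  "Rv i j m = Qv i j m - cst (kd i j / of_nat N) * (\<Sum>a\<in>I. Qv a a m)"

lemma dual_Qv:
  assumes "f \<in> dual W"
  shows "f (u * Qv i j m) = (\<Sum>s\<in>{m+1..<0}. \<Sum>p\<in>I. f (u * (E i p s * E p j (m - s))))
     + (of_nat N / 2 * of_int (m + 1)) * f (u * E i j m)"
  unfolding Qv_def by (simp add: distrib_left sum_distrib_left dual_lin[OF assms] cst_left)

lemma dual_Rv:
  assumes "f \<in> dual W"
  shows "f (u * Rv i j m) = f (u * Qv i j m) - kd i j / of_nat N * (\<Sum>a\<in>I. f (u * Qv a a m))"
  unfolding Rv_def by (simp add: right_diff_distrib sum_distrib_left dual_lin[OF assms] cst_left)

lemma Q_Qv:
  assumes ij: "i \<in> I" "j \<in> I" and m: "m \<le> -2" and T: "T \<ge> - m" and p: "f \<in> dual K"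
  shows "f (Q T i j m) = f (Qv i j m)"
proof -
  define G where "G s = (\<Sum>p\<in>I. f (E i p s * (E p j (m - s) * 1)))" for s
  have neg: "G s = 0" if "s \<le> m" for s
    unfolding G_def using that ij
    by (intro sum.neutral ballI) (auto intro!: K_dual_zero[OF p] E_K)
  have pos: "G s = of_nat N * f (E i j m)" if "s \<ge> 0" for s
    unfolding G_def using comm_trace_sum[OF K_ideal order.refl p ij, of s 1 m] E_K[OF ij(1) _ that] m by simp
  have "{-T..<T} = {-T..m} \<union> {m+1..<0} \<union> {0..<T}" using m T by auto
  then have "(\<Sum>s\<in>{-T..<T}. G s) = (\<Sum>s\<in>{-T..m}. G s) + (\<Sum>s\<in>{m+1..<0}. G s) + (\<Sum>s\<in>{0..<T}. G s)"
    using m by (simp only:) (subst sum.union_disjoint; auto)+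
  moreover have "(\<Sum>s\<in>{-T..m}. G s) = 0" using neg by (intro sum.neutral) auto
  moreover have "(\<Sum>s\<in>{0..<T}. G s) = of_int T * of_nat N * f (E i j m)"
    using pos T m by simp
  ultimately show ?thesis
    using dual_Q[OF p, of T i j m 1] dual_Qv[OF p, of 1 i j m] unfolding G_def by (simp add: algebra_simps)
qed

lemma R_Rv:
  assumes "i \<in> I" "j \<in> I" "m \<le> -2" "T \<ge> - m" "f \<in> dual K"
  shows "f (R T i j m) = f (Rv i j m)"
  using dual_R[OF assms(5), of T i j m 1] dual_Rv[OF assms(5), of 1 i j m] dual_S[OF assms(5), of T m 1] assms
  by (simp add: Q_Qv)

text \<open>The mode of the Sugawara field of weight \<open>-1\<close> acts on vectors as a multiple of the translation operator.\<close>

lemma translation: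
  assumes ij: "i \<in> I" "j \<in> I" and m: "m \<le> -2"
  shows "\<forall>\<^sub>F T in at_top. \<forall>f\<in>dual K. f (S T (-1) * Qv i j m) = - (of_nat N * of_int (m + 1)) * f (Qv i j (m - 1))"
proof -
  have 1: "\<forall>\<^sub>F T in at_top. \<forall>f\<in>dual K. f (S T (-1) * E a b n) = - (of_nat N * of_int n) * f (E a b (n - 1))"
    if "a \<in> I" "b \<in> I" for a b n
    using eventually_conj[OF S_comm[OF that, of n "-1" 1] eventually_ge_at_top[of 0]]
  proof (rule eventually_mono, intro ballI, goal_cases)
    case (1 T f)
    note H = 1(1) and p = 1(3)
    have "f (E a b n * S T (-1)) = 0"
      using S_vacuum[OF _ _ dual_mult[OF K_ideal p], of "-1" T "E a b n"] H by simp
    then show "f (S T (-1) * E a b n) = - (of_nat N * of_int n) * f (E a b (n - 1))"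
      using bspec[OF conjunct1[OF H] p] by (simp add: eq_neg_iff_add_eq_0)
  qed
  have 2: "\<forall>\<^sub>F T in at_top. \<forall>f\<in>dual K. f (S T (-1) * (E a b s * E c d t)) =
      - (of_nat N * of_int s) * f (E a b (s - 1) * E c d t) - (of_nat N * of_int t) * f (E a b s * E c d (t - 1))"
    if "a \<in> I" "b \<in> I" "c \<in> I" "d \<in> I" for a b c d s t
    using eventually_conj[OF S_comm[OF that(1,2), of s "-1" "E c d t"] 1[OF that(3,4), of t]]
  proof (rule eventually_mono, intro ballI, goal_cases)
    case (1 T f)
    note H = 1(1) and p = 1(3)
    have "f (E a b s * (S T (-1) * E c d t)) = - (of_nat N * of_int t) * f (E a b s * E c d (t - 1))"
      using bspec[OF conjunct2[OF H] dual_mult[OF K_ideal p, of "E a b s"]] by simp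
    moreover have "f (E a b s * (S T (-1) * E c d t)) = f (S T (-1) * (E a b s * E c d t))
      + of_nat N * of_int s * f (E a b (s - 1) * E c d t)"
      using bspec[OF conjunct1[OF H] p] by simp
    moreover have "C = - X * D - Y * Z" if "A = - Y * Z" "A = C + X * D" for A C D X Y Z :: complex
    proof -
      have "C = A - X * D" using that(2) by (simp only: add_diff_cancel_right')
      then show ?thesis using that(1) by simp
    qed
    ultimately show "f (S T (-1) * (E a b s * E c d t)) =
      - (of_nat N * of_int s) * f (E a b (s - 1) * E c d t) - (of_nat N * of_int t) * f (E a b s * E c d (t - 1))"
      by blast
  qed
  have "\<forall>\<^sub>F T in at_top. \<forall>s\<in>{m+1..<0}. \<forall>p\<in>I. \<forall>f\<in>dual K. f (S T (-1) * (E i p s * E p j (m - s))) =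
      - (of_nat N * of_int s) * f (E i p (s - 1) * E p j (m - s)) - (of_nat N * of_int (m - s)) * f (E i p s * E p j (m - s - 1))"
    by (rule eventually_ball2[OF finite_atLeastLessThan_int finite_idx]) (rule 2; use ij in simp)
  from eventually_conj[OF this 1[OF ij, of m]] show ?thesis
  proof (rule eventually_mono, intro ballI, goal_cases)
    case (1 T f)
    note H = 1(1) and p = 1(3)
    define G where "G s = (\<Sum>p\<in>I. f (E i p s * E p j (m - 1 - s)))" for s
    have "f (S T (-1) * Qv i j m) = (\<Sum>s\<in>{m+1..<0}. \<Sum>p\<in>I. f (S T (-1) * (E i p s * E p j (m - s))))
     + (of_nat N / 2 * of_int (m + 1)) * f (S T (-1) * E i j m)"
      by (rule dual_Qv[OF p])
    also have "(\<Sum>s\<in>{m+1..<0}. \<Sum>p\<in>I. f (S T (-1) * (E i p s * E p j (m - s)))) =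
       (\<Sum>s\<in>{m+1..<0}. - (of_nat N * of_int s) * G (s - 1) - (of_nat N * of_int (m - s)) * G s)"
    proof (intro sum.cong refl)
      fix s assume s: "s \<in> {m+1..<0}"
      have "(\<Sum>p\<in>I. f (S T (-1) * (E i p s * E p j (m - s)))) =
        (\<Sum>p\<in>I. - (of_nat N * of_int s) * f (E i p (s - 1) * E p j (m - s)) - (of_nat N * of_int (m - s)) * f (E i p s * E p j (m - s - 1)))"
        using H p s by (intro sum.cong refl) blast
      also have "\<dots> = - (of_nat N * of_int s) * G (s - 1) - (of_nat N * of_int (m - s)) * G s"
        unfolding G_def sum_subtractf sum_distrib_left[symmetric] by (simp add: algebra_simps)
      finally show "(\<Sum>p\<in>I. f (S T (-1) * (E i p s * E p j (m - s)))) =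
        - (of_nat N * of_int s) * G (s - 1) - (of_nat N * of_int (m - s)) * G s" .
    qed
    also have "\<dots> = - of_nat N * ((\<Sum>s\<in>{m+1..<0}. of_int s * G (s - 1)) + (\<Sum>s\<in>{m+1..<0}. of_int (m - s) * G s))"
      unfolding sum.distrib[symmetric] sum_distrib_left by (intro sum.cong refl) (simp add: algebra_simps)
    also have "(\<Sum>s\<in>{m+1..<0}. of_int s * G (s - 1)) = (\<Sum>s\<in>{m..<-1}. of_int (s + 1) * G s)"
      by (rule sum.reindex_bij_witness[where i = "\<lambda>s. s + 1" and j = "\<lambda>s. s - 1"]) auto
    \<comment> \<open>Both sums are extended to \<open>{m..<0}\<close>, since the factor
      \<open>s + 1\<close> vanishes at \<open>s = -1\<close> and \<open>m - s\<close> vanishes at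
      \<open>s = m\<close>. Then the two coefficients add up to \<open>m + 1\<close>, independent of
      \<open>s\<close>.\<close>
    also have "\<dots> = (\<Sum>s\<in>{m..<0}. of_int (s + 1) * G s)"
    proof (rule sum.mono_neutral_left)
      show "\<forall>s\<in>{m..<0} - {m..<-1}. of_int (s + 1) * G s = 0"
      proof
        fix s assume "s \<in> {m..<0} - {m..<-1}"
        then have "s = -1" by auto
        then show "of_int (s + 1) * G s = 0" by simp
      qed
    qed auto
    also have "(\<Sum>s\<in>{m+1..<0}. of_int (m - s) * G s) = (\<Sum>s\<in>{m..<0}. of_int (m - s) * G s)"
      using m by (intro sum.mono_neutral_left) auto
    also have "(\<Sum>s\<in>{m..<0}. of_int (s + 1) * G s) + (\<Sum>s\<in>{m..<0}. of_int (m - s) * G s) =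
      of_int (m + 1) * (\<Sum>s\<in>{m..<0}. G s)"
      unfolding sum.distrib[symmetric] sum_distrib_left by (intro sum.cong refl) (simp add: algebra_simps)
    also have "f (S T (-1) * E i j m) = - (of_nat N * of_int m) * f (E i j (m - 1))"
      using H p by blast
    finally have fin: "f (S T (-1) * Qv i j m) = - of_nat N * (of_int (m + 1) * (\<Sum>s\<in>{m..<0}. G s))
      + of_nat N / 2 * of_int (m + 1) * (- (of_nat N * of_int m) * f (E i j (m - 1)))" .
    have "f (Qv i j (m - 1)) = (\<Sum>s\<in>{m..<0}. G s) + of_nat N / 2 * of_int m * f (E i j (m - 1))"
      using dual_Qv[OF p, of 1 i j "m - 1"] by (simp add: G_def)
    then show "f (S T (-1) * Qv i j m) = - (of_nat N * of_int (m + 1)) * f (Qv i j (m - 1))"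
      unfolding fin by (simp add: field_simps)
  qed
qed

text \<open>Left multiplication by \<open>S T (-1)\<close> sends \<open>Rv i j m\<close> to
  \<open>- N (m + 1)\<close> times \<open>Rv i j (m - 1)\<close>, and \<open>m + 1\<close> is
  nonzero for \<open>m \<le> -2\<close>.\<close>

lemma Rv_translate:
  assumes W: "left_ideal W" "K \<subseteq> W" and base: "\<And>i j. i \<in> I \<Longrightarrow> j \<in> I \<Longrightarrow> Rv i j (-2) \<in> W"
    and ij: "i \<in> I" "j \<in> I" and m: "m \<le> -2"
  shows "Rv i j m \<in> W"
  using m ij
proof (induction m arbitrary: i j rule: int_le_induct)
  case base
  then show ?case using assms(3) by simp
next
  case (step m)
  have "\<forall>\<^sub>F T in at_top. \<forall>a\<in>I. \<forall>b\<in>I. \<forall>f\<in>dual K. f (S T (-1) * Qv a b m) = - (of_nat N * of_int (m + 1)) * f (Qv a b (m - 1))"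
    by (rule eventually_ball2[OF finite_idx finite_idx]) (rule translation; use step.hyps in simp)
  then obtain T where T: "\<forall>a\<in>I. \<forall>b\<in>I. \<forall>f\<in>dual K. f (S T (-1) * Qv a b m) = - (of_nat N * of_int (m + 1)) * f (Qv a b (m - 1))"
    using eventually_happens'[OF trivial_limit_at_top_linorder] by blast
  show ?case
  proof (rule dual_mem[OF W(1)])
    fix f assume p: "f \<in> dual W"
    then have pK: "f \<in> dual K" using W(2) dual_mono by blast
    have "f (S T (-1) * Rv i j m) = 0"
      using step ideal_mult[OF W(1)] dual_zero[OF p] by blast
    moreover have "f (S T (-1) * Rv i j m) = - (of_nat N * of_int (m + 1)) * f (Rv i j (m - 1))"
    proof -
      have t: "f (S T (-1) * Qv a b m) = - (of_nat N * of_int (m + 1)) * f (Qv a b (m - 1))" if "a \<in> I" "b \<in> I" for a b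
        using T that pK by blast
      have tr: "(\<Sum>a\<in>I. f (S T (-1) * Qv a a m)) = - (of_nat N * of_int (m + 1)) * (\<Sum>a\<in>I. f (Qv a a (m - 1)))"
        unfolding sum_distrib_left by (intro sum.cong refl t)
      have "f (Rv i j (m - 1)) = f (Qv i j (m - 1)) - kd i j / of_nat N * (\<Sum>a\<in>I. f (Qv a a (m - 1)))"
        using dual_Rv[OF pK, of 1 i j "m - 1"] by simp
      then show ?thesis
        unfolding dual_Rv[OF pK] t[OF step.prems] tr by (simp only:) (simp add: field_simps)
    qed
    moreover have "of_nat N * of_int (m + 1) \<noteq> (0 :: complex)"
      using step.hyps by (simp add: of_int_eq_0_iff[symmetric] del: of_int_add)
    ultimately show "f (Rv i j (m - 1)) = 0" by (metis mult_eq_0_iff neg_equal_0_iff_equal)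
  qed
qed

text \<open>On the vacuum the modes of \<open>R\<close> vanish or lie in \<open>W\<close>. By
  \<open>R_comm\<close>, moving a mode of \<open>R\<close> past a current yields modes of
  \<open>R\<close> only, so this spreads to every vector; the term with the current on the left is
  harmless because \<open>W\<close> is a left ideal.\<close>

lemma R_annihilates:
  assumes W: "left_ideal W" "K \<subseteq> W" and base: "\<And>i j. i \<in> I \<Longrightarrow> j \<in> I \<Longrightarrow> Rv i j (-2) \<in> W"
    and ij: "i \<in> I" "j \<in> I"
  shows "\<forall>\<^sub>F T in at_top. \<forall>f\<in>dual W. f (R T i j m * u) = 0"
  using ij
proof (induction u arbitrary: i j m rule: mod_induct)
  case one
  show ?case
  proof (cases "m \<ge> -1")
    case True
    show ?thesis
      using eventually_ge_at_top[of 0]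
      by (rule eventually_mono) (use R_vacuum[OF one(1,2) True] dual_mono[OF W(2)] in simp)
  next
    case False
    then have m: "m \<le> -2" by simp
    show ?thesis
    proof (rule eventually_mono[OF eventually_ge_at_top[of "- m"]], intro ballI)
      fix T f assume T: "- m \<le> T" and p: "f \<in> dual W"
      have "f (Rv i j m) = 0"
        by (rule dual_zero[OF p Rv_translate[OF W base one m]])
      then show "f (R T i j m * 1) = 0"
        using R_Rv[OF one m T dual_mono[OF W(2) p]] by simp
    qed
  qed
next
  case (add x y)
  show ?case using eventually_conj[OF add.IH(1)[OF add.prems, of m] add.IH(2)[OF add.prems, of m]]
    by (rule eventually_mono) (auto simp: distrib_left dual_lin)
next
  case (scale a x)
  show ?case using scale.IH[OF scale.prems, of m]
    by (rule eventually_mono) (auto simp: cst_left dual_lin)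
next
  case (E a b s x)
  show ?case
    using eventually_conj[OF R_comm[OF E.hyps E.prems, of s m x]
      eventually_conj[OF E.IH[OF E.prems, of m]
      eventually_conj[OF E.IH[OF E.hyps(1) E.prems(2), of "m + s"] E.IH[OF E.prems(1) E.hyps(2), of "m + s"]]]]
  proof (rule eventually_mono, intro ballI, goal_cases)
    case (1 T f)
    note H = 1(1) and p = 1(3)
    have "f (E a b s * (R T i j m * x)) = 0"
      using bspec[OF conjunct1[OF conjunct2[OF H]] dual_mult[OF W(1) p, of "E a b s"]] by simp
    moreover have "f (R T a j (m + s) * x) = 0" "f (R T i b (m + s) * x) = 0" using H p by blast+
    ultimately show "f (R T i j m * (E a b s * x)) = 0"
      using bspec[OF conjunct1[OF H] dual_mono[OF W(2) p]] by simp
  qed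
next
  case (K x z)
  have "f (R T i j m * z) = 0" if "f \<in> dual W" for f T
    using K_dual_zero[OF dual_mono[OF W(2) that] K.hyps] .
  with K.IH[OF K.prems, of m] show ?case
    by (auto simp: distrib_left dual_lin elim!: eventually_mono)
qed

text \<open>\<open>R T i i 0\<close> annihilates \<open>x\<close> modulo \<open>W\<close>. Among its
  terms those with \<open>s < 0\<close> vanish, those with \<open>s > 0\<close> reduce to
  commutators, \<open>s = 0\<close> gives the quadratic expression in the weights, and
  \<open>deg\<close> evaluates the trace; the shifts \<open>gamma T\<close> cancel.\<close>

lemma singular_relation:
  assumes W: "left_ideal W" "K \<subseteq> W" and base: "\<And>i j. i \<in> I \<Longrightarrow> j \<in> I \<Longrightarrow> Rv i j (-2) \<in> W"
    and pos: "\<And>a b s. a \<in> I \<Longrightarrow> b \<in> I \<Longrightarrow> s > 0 \<Longrightarrow> E a b s * x \<in> W"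
    and raise: "\<And>a b. a \<in> I \<Longrightarrow> b \<in> I \<Longrightarrow> a < b \<Longrightarrow> E a b 0 * x \<in> W"
    and wt: "\<And>c. c \<in> I \<Longrightarrow> E c c 0 * x - cst (of_int (\<mu> c)) * x \<in> W"
    and deg: "\<forall>\<^sub>F T in at_top. \<forall>f\<in>dual W. f (S T 0 * x) = (of_nat N * of_int d + of_nat N * gamma T) * f x"
    and i: "i \<in> I" and p: "f \<in> dual W"
  shows "((of_int (\<mu> i))\<^sup>2 + (\<Sum>p\<in>I. if i < p then of_int (\<mu> i - \<mu> p) else 0)
    - of_nat N / 2 * of_int (\<mu> i) - of_int d) * f x = 0"
proof -
  note pm = dual_mult[OF W(1) p]
  have w: "f (u * (E c c 0 * x)) = of_int (\<mu> c) * f (u * x)" if "c \<in> I" for u c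
    using dual_zero[OF pm wt[OF that], of u] dual_lin(2,3)[OF pm, of u] by simp
  have w1: "f (E c c 0 * x) = of_int (\<mu> c) * f x" if "c \<in> I" for c
    using w[OF that, of 1] by simp
  obtain T where T: "f (S T 0 * x) = (of_nat N * of_int d + of_nat N * gamma T) * f x"
    "f (R T i i 0 * x) = 0" "T \<ge> 1"
    using eventually_happens'[OF trivial_limit_at_top_linorder
        eventually_conj[OF deg eventually_conj[OF R_annihilates[OF W base i i, of 0 x] eventually_ge_at_top[of 1]]]] p
    by blast
  define G where "G s = (\<Sum>p\<in>I. f (E i p s * (E p i (0 - s) * x)))" for s
  define c where "c = (of_nat N - 1 / of_nat N) * k * f x"
  have neg: "G s = 0" if "s < 0" for s
    unfolding G_def using that i by (intro sum.neutral ballI dual_zero[OF pm pos]) auto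
  have poss: "G s = of_nat N * (of_int (\<mu> i) * f x) + c * of_int s" if "s > 0" for s
    unfolding G_def c_def using comm_trace_sum[OF W p i i pos[OF i _ that], of 0] w1[OF i] by (simp add: mult_ac)
  have "f (E i p 0 * (E p i 0 * x)) = (if p = i then (of_int (\<mu> i))\<^sup>2 else 0) * f x
      + (if i < p then of_int (\<mu> i - \<mu> p) else 0) * f x" if "p \<in> I" for p
  proof -
    consider "p < i" | "p = i" | "p > i" by linarith
    then show ?thesis
    proof cases
      case 1
      then show ?thesis using dual_zero[OF pm raise[OF that i], of "E i p 0"] by simp
    next
      case 2
      then show ?thesis using w[OF i, of "E i i 0"] w1[OF i] by (simp add: power2_eq_square)
    next
      case 3
      then show ?thesis
        using dual_comm[OF W p i that that i, of 0 0 x] w1[OF i] w1[OF that]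
          dual_zero[OF pm raise[OF i that], of "E p i 0"] by (simp add: algebra_simps)
    qed
  qed
  then have G0: "G 0 = ((of_int (\<mu> i))\<^sup>2 + (\<Sum>p\<in>I. if i < p then of_int (\<mu> i - \<mu> p) else 0)) * f x"
    unfolding G_def using i by (simp add: sum.distrib distrib_right flip: sum_distrib_right)
  have "{-T..<T} = {-T..<0} \<union> insert 0 {1..<T}" using T(3) by auto
  then have "(\<Sum>s\<in>{-T..<T}. G s) = (\<Sum>s\<in>{-T..<0}. G s) + (G 0 + (\<Sum>s\<in>{1..<T}. G s))"
    by (simp only:) (subst sum.union_disjoint; simp)
  also have "(\<Sum>s\<in>{-T..<0}. G s) = 0" using neg by (intro sum.neutral) auto
  also have "(\<Sum>s\<in>{1..<T}. G s) = (\<Sum>s\<in>{1..<T}. of_nat N * (of_int (\<mu> i) * f x) + c * of_int s)"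
    using poss by (intro sum.cong) auto
  \<comment> \<open>Adding and removing the term at 0 leaves \<open>T - 1\<close> times
    \<open>N \<mu> i\<close>. Together with the correction \<open>N / 2 - T N\<close> in
    \<open>Q\<close> this gives \<open>- N / 2\<close> times \<open>\<mu> i\<close>.\<close>
  also have "\<dots> = (\<Sum>s\<in>{0..<T}. of_nat N * (of_int (\<mu> i) * f x) + c * of_int s) - of_nat N * (of_int (\<mu> i) * f x)"
  proof -
    have "{0..<T} = insert 0 {1..<T}" using T(3) by auto
    then show ?thesis by simp
  qed
  also have "(\<Sum>s\<in>{0..<T}. of_nat N * (of_int (\<mu> i) * f x) + c * of_int s) =
      of_int T * of_nat N * (of_int (\<mu> i) * f x) + gamma T * f x"
    using T(3) by (simp add: sum.distrib sum_of_int_up gamma_def c_def flip: sum_distrib_left)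
  finally have sG: "(\<Sum>s\<in>{-T..<T}. G s) = 0 + (G 0 + (of_int T * of_nat N * (of_int (\<mu> i) * f x) + gamma T * f x
      - of_nat N * (of_int (\<mu> i) * f x)))" .
  have "f (Q T i i 0 * x) = (\<Sum>s\<in>{-T..<T}. G s) + (of_nat N / 2 - of_int T * of_nat N) * (of_int (\<mu> i) * f x)"
    using dual_Q[OF p, of T i i 0 x] w1[OF i] by (simp add: G_def)
  then have "f (Q T i i 0 * x) = G 0 + gamma T * f x - of_nat N / 2 * (of_int (\<mu> i) * f x)"
    unfolding sG by (simp add: field_simps)
  moreover have "kd i i / of_nat N * ((of_nat N * of_int d + of_nat N * gamma T) * f x) = (of_int d + gamma T) * f x"
    by (simp add: field_simps)
  then have "f (Q T i i 0 * x) = (of_int d + gamma T) * f x"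
    using dual_R[OF p, of T i i 0 x] unfolding T(1,2) by simp
  ultimately show ?thesis
    unfolding G0 by (simp add: algebra_simps)
qed

end

section \<open>The radical of the vacuum functional\<close>

definition wt_add :: "(nat \<Rightarrow> int) \<Rightarrow> nat \<Rightarrow> nat \<Rightarrow> nat \<Rightarrow> int" where
  "wt_add w a b = (\<lambda>c. w c + (if c = a then 1 else 0) - (if c = b then 1 else 0))"

lemma wt_add_inverse: "wt_add (wt_add w a b) b a = w"
  by (simp add: wt_add_def fun_eq_iff)

context sl_hat begin

text \<open>Combinations of words in negative modes, of degree \<open>d\<close> and weight \<open>w\<close>; zero has every degree and weight.\<close>

inductive NS :: "int \<Rightarrow> (nat \<Rightarrow> int) \<Rightarrow> 'u \<Rightarrow> bool" where
  NS_one: "NS 0 (\<lambda>_. 0) 1"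
| NS_E: "\<lbrakk>NS d w u; a \<in> I; b \<in> I; s < 0\<rbrakk> \<Longrightarrow> NS (d - s) (wt_add w a b) (E a b s * u)"
| NS_zero: "(\<And>c. c \<notin> I \<Longrightarrow> w c = 0) \<Longrightarrow> NS d w 0"
| NS_add: "\<lbrakk>NS d w u; NS d w u'\<rbrakk> \<Longrightarrow> NS d w (u + u')"
| NS_scale: "NS d w u \<Longrightarrow> NS d w (cst \<alpha> * u)"

lemma NS_support: "NS d w u \<Longrightarrow> c \<notin> I \<Longrightarrow> w c = 0"
  by (induction rule: NS.induct) (auto simp: wt_add_def)

text \<open>Commutator terms carry Kronecker deltas; they have the right degree and weight only when
  their coefficient is nonzero.\<close>

lemma NS_coeff: "(\<alpha> \<noteq> 0 \<Longrightarrow> NS d w u) \<Longrightarrow> (\<And>c. c \<notin> I \<Longrightarrow> w c = 0) \<Longrightarrow> NS d w (cst \<alpha> * u)"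
  by (cases "\<alpha> = 0") (auto intro: NS_zero NS_scale)

text \<open>A nonnegative mode is moved to the right through a word until the vacuum absorbs it.
  Each commutator term is shorter and keeps the total degree and weight, and so does the central
  term.\<close>

lemma NS_act: "NS d w u \<Longrightarrow> a \<in> I \<Longrightarrow> b \<in> I \<Longrightarrow> \<exists>u'. NS (d - s) (wt_add w a b) u' \<and> E a b s * u - u' \<in> K"
proof (induction arbitrary: a b s rule: NS.induct)
  case NS_one
  show ?case
  proof (cases "s < 0")
    case True
    then show ?thesis using NS.NS_E[OF NS.NS_one NS_one, of s] ideal_zero[OF K_ideal]
      by (intro exI[of _ "E a b s * 1"]) simp
  next
    case False
    then show ?thesis using E_K[OF NS_one] NS_one
      by (intro exI[of _ 0]) (auto intro!: NS_zero simp: wt_add_def)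
  qed
next
  case (NS_E d w u a0 b0 s0)
  show ?case
  proof (cases "s < 0")
    case True
    show ?thesis using NS.NS_E[OF NS.NS_E[OF NS_E.hyps] NS_E.prems True] ideal_zero[OF K_ideal]
      by (intro exI[of _ "E a b s * (E a0 b0 s0 * u)"]) simp
  next
    case False
    define D Wt where "D = d - s0 - s" and "Wt = wt_add (wt_add w a0 b0) a b"
    have supp: "Wt c = 0" if "c \<notin> I" for c
      using NS_support[OF NS_E.hyps(1) that] that NS_E by (auto simp: Wt_def wt_add_def)
    obtain u1 where u1: "NS (d - s) (wt_add w a b) u1" "E a b s * u - u1 \<in> K"
      using NS_E.IH NS_E.prems by blast
    obtain u2 where u2: "NS (d - (s + s0)) (wt_add w a b0) u2" "E a b0 (s + s0) * u - u2 \<in> K"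
      using NS_E.IH NS_E.prems NS_E.hyps by blast
    obtain u3 where u3: "NS (d - (s + s0)) (wt_add w a0 b) u3" "E a0 b (s + s0) * u - u3 \<in> K"
      using NS_E.IH NS_E.prems NS_E.hyps by blast
    define z where "z = (if s + s0 = 0 then of_int s else 0) * (kd b a0 * kd a b0 - kd a b * kd a0 b0 / of_nat N) * k"
    define u' where "u' = E a0 b0 s0 * u1 + cst (kd b a0) * u2 + cst (- kd a b0) * u3 + cst z * u"
    have "NS D Wt (E a0 b0 s0 * u1)"
    proof -
      have "wt_add (wt_add w a b) a0 b0 = Wt" "d - s - s0 = D" by (auto simp: Wt_def D_def wt_add_def)
      then show ?thesis using NS.NS_E[OF u1(1) NS_E.hyps(2-4)] by simp
    qed
    moreover have "NS D Wt (cst (kd b a0) * u2)"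
    proof (rule NS_coeff[OF _ supp])
      assume "kd b a0 \<noteq> 0"
      then have "wt_add w a b0 = Wt" "d - (s + s0) = D"
        by (auto simp: Wt_def D_def wt_add_def kd_def split: if_splits)
      then show "NS D Wt u2" using u2(1) by simp
    qed
    moreover have "NS D Wt (cst (- kd a b0) * u3)"
    proof (rule NS_coeff[OF _ supp])
      assume "- kd a b0 \<noteq> 0"
      then have "wt_add w a0 b = Wt" "d - (s + s0) = D"
        by (auto simp: Wt_def D_def wt_add_def kd_def split: if_splits)
      then show "NS D Wt u3" using u3(1) by simp
    qed
    moreover have "NS D Wt (cst z * u)"
    proof (rule NS_coeff[OF _ supp])
      assume "z \<noteq> 0"
      then have "w = Wt" "d = D"
        by (auto simp: z_def Wt_def D_def wt_add_def kd_def fun_eq_iff split: if_splits)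
      then show "NS D Wt u" using NS_E.hyps(1) by simp
    qed
    ultimately have "NS D Wt u'" unfolding u'_def by (intro NS.NS_add)
    moreover have "E a b s * (E a0 b0 s0 * u) - u' \<in> K"
    proof (rule dual_mem[OF K_ideal])
      fix f assume p: "f \<in> dual K"
      note pl = dual_lin[OF p]
      have "f (E a0 b0 s0 * (E a b s * u)) = f (E a0 b0 s0 * u1)"
        using K_dual_zero[OF p u1(2), of "E a0 b0 s0"] by (simp add: right_diff_distrib pl)
      moreover have "f (E a b0 (s + s0) * u) = f u2" "f (E a0 b (s + s0) * u) = f u3"
        using dual_zero[OF p u2(2)] dual_zero[OF p u3(2)] by (simp_all add: pl)
      ultimately show "f (E a b s * (E a0 b0 s0 * u) - u') = 0"
        using K_comm[OF p NS_E.prems NS_E.hyps(2,3), of s s0 u] by (simp add: u'_def pl z_def)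
    qed
    ultimately show ?thesis unfolding D_def Wt_def by blast
  qed
next
  case (NS_zero w d)
  then show ?case using ideal_zero[OF K_ideal]
    by (intro exI[of _ 0]) (auto intro!: NS.NS_zero simp: wt_add_def)
next
  case (NS_add d w u u')
  obtain x y where "NS (d - s) (wt_add w a b) x" "E a b s * u - x \<in> K"
    "NS (d - s) (wt_add w a b) y" "E a b s * u' - y \<in> K"
    using NS_add.IH NS_add.prems by meson
  then show ?case
    using ideal_add[OF K_ideal, of "E a b s * u - x" "E a b s * u' - y"]
    by (intro exI[of _ "x + y"]) (simp add: NS.NS_add distrib_left add_diff_add)
next
  case (NS_scale d w u \<alpha>)
  obtain x where "NS (d - s) (wt_add w a b) x" "E a b s * u - x \<in> K"
    using NS_scale.IH NS_scale.prems by meson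
  then show ?case
    using K_right[of "E a b s * u - x" "cst \<alpha>"]
    by (intro exI[of _ "cst \<alpha> * x"]) (simp add: NS.NS_scale cst_left right_diff_distrib)
qed

section \<open>Degree, weight and height of homogeneous vectors\<close>

lemma vac_zero [simp]: "vacf 0 = 0"
  using vac_add[of 0 0] by simp

lemma vac_diff: "vacf (x - y) = vacf x - vacf y"
  using vac_add[of "x - y" y] by simp

lemma vac_sum: "vacf (\<Sum>i\<in>A. g i) = (\<Sum>i\<in>A. vacf (g i))"
  by (induction A rule: infinite_finite_induct) (simp_all add: vac_add)

lemma NS_negative: "NS d w u \<Longrightarrow> d < 0 \<Longrightarrow> u = 0"
  by (induction rule: NS.induct) auto

lemma NS_degree_zero: "NS d w u \<Longrightarrow> d = 0 \<Longrightarrow> \<exists>\<alpha>. u = cst \<alpha>"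
proof (induction rule: NS.induct)
  case NS_one
  show ?case by (metis cst_1)
next
  case (NS_E d w u a b s)
  then have "u = 0" using NS_negative by force
  then show ?case by (metis cst_0 mult_zero_right)
next
  case (NS_zero w d)
  show ?case by (metis cst_0)
next
  case (NS_add d w u u')
  then show ?case by (metis cst_add)
next
  case (NS_scale d w u \<alpha>)
  then show ?case by (metis cst_mult)
qed

lemma NS_vac: "NS d w u \<Longrightarrow> d \<noteq> 0 \<Longrightarrow> vacf u = 0"
  by (induction rule: NS.induct) (auto simp: vac_neg vac_add vac_cst)

text \<open>It grows by \<open>b - a\<close> under \<open>E a b\<close>. The operators with
  \<open>a < b\<close>, though they come from the \<open>f i\<close>, thus serve as raising
  operators. A letter adds less than \<open>N\<close> to the height and at least 1 to the degree, so
  the height is bounded in each degree.\<close>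

definition height :: "(nat \<Rightarrow> int) \<Rightarrow> int" where
  "height w = (\<Sum>c\<in>I. - int c * w c)"

lemma height_wt_add: "a \<in> I \<Longrightarrow> b \<in> I \<Longrightarrow> height (wt_add w a b) = height w + int b - int a"
proof -
  assume ab: "a \<in> I" "b \<in> I"
  have "height (wt_add w a b) = (\<Sum>c\<in>I. - int c * w c - (if c = a then int c else 0) + (if c = b then int c else 0))"
    unfolding height_def by (intro sum.cong) (auto simp: wt_add_def algebra_simps)
  then show ?thesis using ab by (simp add: height_def sum.distrib sum_subtractf)
qed

lemma NS_height: "NS d w u \<Longrightarrow> u \<noteq> 0 \<Longrightarrow> height w \<le> int N * d"
proof (induction rule: NS.induct)
  case NS_one
  then show ?case by (simp add: height_def)
next
  case (NS_E d w u a b s)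
  then have "u \<noteq> 0" by auto
  then have "height w \<le> int N * d" using NS_E.IH by simp
  moreover have "int N * d + int N \<le> int N * (d - s)" using NS_E.hyps(4)
    using mult_left_mono[of 1 "- s" "int N"] by (simp add: algebra_simps)
  moreover have "int b \<le> int N" "0 \<le> int a" using NS_E.hyps by (auto simp: idx_def)
  ultimately show ?case using NS_E.hyps by (simp add: height_wt_add)
next
  case (NS_add d w u u')
  then show ?case by (cases "u = 0") auto
next
  case (NS_scale d w u \<alpha>)
  then show ?case by (cases "u = 0") auto
qed auto

lemma NS_weight: "NS d w u \<Longrightarrow> c \<in> I \<Longrightarrow> f \<in> dual K \<Longrightarrow> f (E c c 0 * u) = of_int (w c) * f u"
proof (induction arbitrary: f rule: NS.induct)
  case NS_one
  then show ?case using E_K[of c c 0] dual_zero[of f K] by simp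
next
  case (NS_E d w u a b s)
  note p = \<open>f \<in> dual K\<close>
  have e: "kd c a * f (E c b s * u) = kd c a * f (E a b s * u)" "kd c b * f (E a c s * u) = kd c b * f (E a b s * u)"
    by (auto simp: kd_def)
  have wt: "of_int (wt_add w a b c) = of_int (w c) + kd c a - kd c b"
    by (simp add: wt_add_def kd_def)
  have comm: "f (E c c 0 * (E a b s * u)) = f (E a b s * (E c c 0 * u))
      + kd c a * f (E c b s * u) - kd c b * f (E a c s * u)"
    using K_comm[OF p NS_E.prems(1) NS_E.prems(1) NS_E.hyps(2,3), of 0 s u]
    by (simp add: kd_sym[of a c])
  show ?case
    unfolding comm e wt NS_E.IH[OF NS_E.prems(1) dual_mult[OF K_ideal p, of "E a b s"]]
    by (simp add: algebra_simps)
qed (simp_all add: dual_lin distrib_left cst_left algebra_simps)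

lemma NS_degree: "NS d w u \<Longrightarrow>
  \<forall>\<^sub>F T in at_top. \<forall>f\<in>dual K. f (S T 0 * u) = (of_nat N * of_int d + of_nat N * gamma T) * f u"
proof (induction rule: NS.induct)
  case NS_one
  show ?case
    by (rule eventually_mono[OF eventually_ge_at_top[of 0]]) (simp add: S_vacuum)
next
  case (NS_E d w u a b s)
  from eventually_conj[OF S_comm[OF NS_E.hyps(2,3), of s 0 u] NS_E.IH] show ?case
  proof (rule eventually_mono, intro ballI, goal_cases)
    case (1 T f)
    note H = 1(1) and p = 1(3)
    have "f (E a b s * (S T 0 * u)) = (of_nat N * of_int d + of_nat N * gamma T) * f (E a b s * u)"
      by (rule bspec[OF conjunct2[OF H] dual_mult[OF K_ideal p, of "E a b s"]])
    moreover have "f (E a b s * (S T 0 * u)) = f (S T 0 * (E a b s * u)) + of_nat N * of_int s * f (E a b s * u)"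
      using bspec[OF conjunct1[OF H] p] by simp
    ultimately have "f (S T 0 * (E a b s * u)) + of_nat N * of_int s * f (E a b s * u) =
      (of_nat N * of_int d + of_nat N * gamma T) * f (E a b s * u)" by (simp only:)
    then show "f (S T 0 * (E a b s * u)) = (of_nat N * of_int (d - s) + of_nat N * gamma T) * f (E a b s * u)"
      by (simp add: algebra_simps eq_diff_eq)
  qed
next
  case (NS_zero w d)
  show ?case by (simp add: dual_lin)
next
  case (NS_add d w u u')
  from eventually_conj[OF NS_add.IH] show ?case
    by (rule eventually_mono) (auto simp: dual_lin distrib_left)
next
  case (NS_scale d w u \<alpha>)
  from NS_scale.IH show ?case
    by (rule eventually_mono) (auto simp: dual_lin cst_left)
qed

lemma NS_decompose:
  "\<exists>F g. finite F \<and> (\<forall>l\<in>F. NS (fst l) (snd l) (g l)) \<and> u - (\<Sum>l\<in>F. g l) \<in> K"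
proof (induction u rule: mod_induct)
  case one
  show ?case
    using NS_one ideal_zero[OF K_ideal] by (intro exI[of _ "{(0, \<lambda>_. 0)}"] exI[of _ "\<lambda>_. 1"]) simp
next
  case (add x y)
  then obtain F g F' g' where Fg: "finite F" "\<forall>l\<in>F. NS (fst l) (snd l) (g l)" "x - (\<Sum>l\<in>F. g l) \<in> K"
    "finite F'" "\<forall>l\<in>F'. NS (fst l) (snd l) (g' l)" "y - (\<Sum>l\<in>F'. g' l) \<in> K" by blast
  let ?h = "\<lambda>l. (if l \<in> F then g l else 0) + (if l \<in> F' then g' l else 0)"
  have "NS (fst l) (snd l) (?h l)" if "l \<in> F \<union> F'" for l
  proof (rule NS_add)
    have supp: "snd l c = 0" if "c \<notin> I" for c
      using \<open>l \<in> F \<union> F'\<close> Fg(2,5) NS_support[OF _ that] by blast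
    show "NS (fst l) (snd l) (if l \<in> F then g l else 0)" "NS (fst l) (snd l) (if l \<in> F' then g' l else 0)"
      using Fg(2,5) by (auto intro: NS_zero supp)
  qed
  moreover have "(\<Sum>l\<in>F \<union> F'. ?h l) = (\<Sum>l\<in>F. g l) + (\<Sum>l\<in>F'. g' l)"
  proof -
    have "(\<Sum>l\<in>F \<union> F'. if l \<in> F then g l else 0) = (\<Sum>l\<in>F. g l)"
      "(\<Sum>l\<in>F \<union> F'. if l \<in> F' then g' l else 0) = (\<Sum>l\<in>F'. g' l)"
      using Fg(1,4) by (auto intro: sum.mono_neutral_cong_right)
    then show ?thesis by (simp add: sum.distrib)
  qed
  ultimately show ?case
    using Fg(1,4) ideal_add[OF K_ideal Fg(3,6)]
    by (intro exI[of _ "F \<union> F'"] exI[of _ ?h]) (simp add: add_diff_add)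
next
  case (scale a x)
  then obtain F g where Fg: "finite F" "\<forall>l\<in>F. NS (fst l) (snd l) (g l)" "x - (\<Sum>l\<in>F. g l) \<in> K" by blast
  then show ?case using K_right[OF Fg(3), of "cst a"]
    by (intro exI[of _ F] exI[of _ "\<lambda>l. cst a * g l"]) (simp add: NS_scale right_diff_distrib sum_distrib_left)
next
  case (E a b s x)
  then obtain F g where Fg: "finite F" "\<forall>l\<in>F. NS (fst l) (snd l) (g l)" "x - (\<Sum>l\<in>F. g l) \<in> K" by blast
  have "\<forall>l\<in>F. \<exists>u'. NS (fst l - s) (wt_add (snd l) a b) u' \<and> E a b s * g l - u' \<in> K"
    using NS_act Fg(2) E.hyps by blast
  then obtain h where h: "\<forall>l\<in>F. NS (fst l - s) (wt_add (snd l) a b) (h l) \<and> E a b s * g l - h l \<in> K"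
    by metis
  \<comment> \<open>Labels are pairs of degree and weight. The current shifts them injectively, with
    inverse \<open>us\<close>, so the images stay indexed by distinct labels.\<close>
  define sh where "sh l = (fst l - s, wt_add (snd l) a b)" for l :: "int \<times> (nat \<Rightarrow> int)"
  define us where "us l = (fst l + s, wt_add (snd l) b a)" for l :: "int \<times> (nat \<Rightarrow> int)"
  have us: "us (sh l) = l" for l by (simp add: us_def sh_def wt_add_inverse)
  then have inj: "inj_on sh F" by (metis inj_onI)
  have "E a b s * x - (\<Sum>l\<in>sh ` F. h (us l)) = E a b s * (x - (\<Sum>l\<in>F. g l)) + (\<Sum>l\<in>F. E a b s * g l - h l)"
    by (simp add: sum.reindex[OF inj] us right_diff_distrib sum_distrib_left sum_subtractf)
  also have "\<dots> \<in> K"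
    using h by (intro ideal_add[OF K_ideal] K_right Fg(3) ideal_sum[OF K_ideal]) auto
  finally have "E a b s * x - (\<Sum>l\<in>sh ` F. h (us l)) \<in> K" .
  moreover have "\<forall>l\<in>sh ` F. NS (fst l) (snd l) (h (us l))"
  proof
    fix l assume "l \<in> sh ` F"
    then obtain l0 where l0: "l0 \<in> F" "l = sh l0" by blast
    show "NS (fst l) (snd l) (h (us l))"
      unfolding l0(2) us using h l0(1) by (simp add: sh_def)
  qed
  ultimately show ?case
    using Fg(1) by (intro exI[of _ "sh ` F"] exI[of _ "\<lambda>l. h (us l)"]) simp
next
  case (K x z)
  then obtain F g where Fg: "finite F" "\<forall>l\<in>F. NS (fst l) (snd l) (g l)" "x - (\<Sum>l\<in>F. g l) \<in> K" by blast
  then show ?case using ideal_add[OF K_ideal Fg(3) K.hyps]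
    by (intro exI[of _ F] exI[of _ g]) (simp add: algebra_simps)
qed

text \<open>Applying \<open>A - \<mu> j\<close> to the sum removes component \<open>j\<close> and
  multiplies the others by scalars, so induction on the number of components gives
  \<open>g i\<close>, and a second induction gives the rest. Different pairs may use different
  operators.\<close>

lemma eigen_components:
  assumes W: "left_ideal W" and "finite F" "(\<Sum>i\<in>F. g i) \<in> W"
    and sep: "\<And>i j. i \<in> F \<Longrightarrow> j \<in> F \<Longrightarrow> i \<noteq> j \<Longrightarrow> \<exists>A \<mu>. (\<forall>x\<in>F. A * g x - cst (\<mu> x) * g x \<in> W) \<and> \<mu> i \<noteq> \<mu> j"
  shows "\<forall>i\<in>F. g i \<in> W"
  using assms(2-)
proof (induction "card F" arbitrary: F g rule: less_induct)
  case less
  show ?case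
  proof (cases "\<exists>i\<in>F. \<exists>j\<in>F. i \<noteq> j")
    case False
    show ?thesis
    proof
      fix i assume i: "i \<in> F"
      with False have "F = {i}" by auto
      then show "g i \<in> W" using less.prems(2) by simp
    qed
  next
    case True
    then obtain i j where ij: "i \<in> F" "j \<in> F" "i \<noteq> j" by blast
    obtain A \<mu> where A: "\<forall>x\<in>F. A * g x - cst (\<mu> x) * g x \<in> W" "\<mu> i \<noteq> \<mu> j"
      using less.prems(3)[OF ij] by blast
    have "A * (\<Sum>x\<in>F. g x) - cst (\<mu> j) * (\<Sum>x\<in>F. g x) - (\<Sum>x\<in>F. A * g x - cst (\<mu> x) * g x) =
        (\<Sum>x\<in>F. cst (\<mu> x - \<mu> j) * g x)"
      unfolding sum_distrib_left sum_subtractf[symmetric]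
    proof (intro sum.cong refl)
      fix x
      have "cst (\<mu> x - \<mu> j) = cst (\<mu> x) - cst (\<mu> j)"
        using cst_add[of "\<mu> x - \<mu> j" "\<mu> j"] by simp
      then show "A * g x - cst (\<mu> j) * g x - (A * g x - cst (\<mu> x) * g x) = cst (\<mu> x - \<mu> j) * g x"
        by (simp add: left_diff_distrib)
    qed
    moreover have "A * (\<Sum>x\<in>F. g x) - cst (\<mu> j) * (\<Sum>x\<in>F. g x) - (\<Sum>x\<in>F. A * g x - cst (\<mu> x) * g x) \<in> W"
    proof (rule ideal_diff[OF W ideal_diff[OF W ideal_mult[OF W less.prems(2)] ideal_mult[OF W less.prems(2)]]])
      show "(\<Sum>x\<in>F. A * g x - cst (\<mu> x) * g x) \<in> W" by (rule ideal_sum[OF W]) (use A(1) in blast)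
    qed
    ultimately have "(\<Sum>x\<in>F. cst (\<mu> x - \<mu> j) * g x) \<in> W" by simp
    also have "(\<Sum>x\<in>F. cst (\<mu> x - \<mu> j) * g x) = (\<Sum>x\<in>F - {j}. cst (\<mu> x - \<mu> j) * g x)"
      using less.prems(1) ij by (simp add: sum.remove[of F j])
    finally have "\<forall>x\<in>F - {j}. cst (\<mu> x - \<mu> j) * g x \<in> W"
    proof (intro less.hyps)
      show "card (F - {j}) < card F" using less.prems(1) ij by (intro psubset_card_mono) auto
      fix p q assume pq: "p \<in> F - {j}" "q \<in> F - {j}" "p \<noteq> q"
      then obtain B \<nu> where B: "\<forall>x\<in>F. B * g x - cst (\<nu> x) * g x \<in> W" "\<nu> p \<noteq> \<nu> q"
        using less.prems(3)[of p q] by blast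
      have "B * (cst c * g x) - cst (\<nu> x) * (cst c * g x) \<in> W" if "x \<in> F" for x c
      proof -
        have "cst c * (B * g x - cst (\<nu> x) * g x) \<in> W" using B(1) that by (intro ideal_mult[OF W]) auto
        then show ?thesis
          by (simp only: right_diff_distrib cst_left[of B] cst_left[of "cst (\<nu> x)" c "g x"])
      qed
      then show "\<exists>B \<nu>. (\<forall>x\<in>F - {j}. B * (cst (\<mu> x - \<mu> j) * g x) - cst (\<nu> x) * (cst (\<mu> x - \<mu> j) * g x) \<in> W) \<and> \<nu> p \<noteq> \<nu> q"
        using B(2) by blast
    qed (use less.prems(1) in auto)
    then have "cst (\<mu> i - \<mu> j) * g i \<in> W" using ij by auto
    then have gi: "g i \<in> W" using A(2) ideal_scale[OF W, of "\<mu> i - \<mu> j"] by simp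
    have "\<forall>x\<in>F - {i}. g x \<in> W"
    proof (intro less.hyps)
      show "card (F - {i}) < card F" using less.prems(1) ij by (intro psubset_card_mono) auto
      show "(\<Sum>x\<in>F - {i}. g x) \<in> W"
        using less.prems(1,2) ij(1) gi ideal_cancel[OF W gi] by (simp add: sum.remove[of F i])
      fix p q assume "p \<in> F - {i}" "q \<in> F - {i}" "p \<noteq> q"
      then show "\<exists>A \<mu>. (\<forall>x\<in>F - {i}. A * g x - cst (\<mu> x) * g x \<in> W) \<and> \<mu> p \<noteq> \<mu> q"
        using less.prems(3)[of p q] by blast
    qed (use less.prems(1) in auto)
    then show ?thesis using gi by blast
  qed
qed

lemma NS_components:
  assumes W: "left_ideal W" "K \<subseteq> W" and F: "finite F" "\<forall>l\<in>F. NS (fst l) (snd l) (g l)" "(\<Sum>l\<in>F. g l) \<in> W"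
  shows "\<forall>l\<in>F. g l \<in> W"
proof (rule eigen_components[OF W(1) F(1,3)])
  fix i j assume ij: "i \<in> F" "j \<in> F" "i \<noteq> j"
  show "\<exists>A \<mu>. (\<forall>x\<in>F. A * g x - cst (\<mu> x) * g x \<in> W) \<and> \<mu> i \<noteq> \<mu> j"
  proof (cases "fst i = fst j")
    \<comment> \<open>Degrees are separated by \<open>S T 0\<close>. One cutoff \<open>T\<close>
      must serve for all of \<open>F\<close>, which is possible because \<open>F\<close> is
      finite.\<close>
    case False
    have "\<forall>\<^sub>F T in at_top. \<forall>l\<in>F. \<forall>f\<in>dual K. f (S T 0 * g l) = (of_nat N * of_int (fst l) + of_nat N * gamma T) * f (g l)"
      by (rule eventually_ball_finite[OF F(1)]) (use NS_degree F(2) in blast)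
    then obtain T where T: "\<forall>l\<in>F. \<forall>f\<in>dual K. f (S T 0 * g l) = (of_nat N * of_int (fst l) + of_nat N * gamma T) * f (g l)"
      using eventually_happens'[OF trivial_limit_at_top_linorder] by blast
    have "S T 0 * g x - cst (of_nat N * of_int (fst x) + of_nat N * gamma T) * g x \<in> K" if "x \<in> F" for x
      using T that by (intro dual_mem[OF K_ideal]) (simp add: dual_lin)
    then show ?thesis using False W(2)
      by (intro exI[of _ "S T 0"] exI[of _ "\<lambda>l. of_nat N * of_int (fst l) + of_nat N * gamma T"]) auto
  next
    case True
    then have "snd i \<noteq> snd j" using ij(3) by (simp add: prod_eq_iff)
    then obtain c where c: "snd i c \<noteq> snd j c" by blast
    have z: "snd i c = 0" "snd j c = 0" if "c \<notin> I" using NS_support[OF _ that] F(2) ij by blast+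
    have cI: "c \<in> I" by (rule ccontr) (use c z in simp)
    have "E c c 0 * g x - cst (of_int (snd x c)) * g x \<in> K" if "x \<in> F" for x
      using NS_weight[OF bspec[OF F(2) that] cI] by (intro dual_mem[OF K_ideal]) (simp add: dual_lin)
    then show ?thesis using c W(2)
      by (intro exI[of _ "E c c 0"] exI[of _ "\<lambda>l. of_int (snd l c)"]) auto
  qed
qed

section \<open>The radical as greatest proper left ideal, and its generators\<close>

definition radical :: "'u set" where
  "radical = {u. \<forall>a. vacf (a * u) = 0}"

lemma radical_ideal: "left_ideal radical"
  by (auto simp: left_ideal_def radical_def distrib_left vac_add simp flip: mult.assoc)

lemma K_radical: "K \<subseteq> radical"
  using K_right vac_K by (auto simp: radical_def)

lemma radical_proper: "radical \<noteq> UNIV"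
proof
  assume "radical = UNIV"
  then have "vacf (1 * 1) = 0" unfolding radical_def by blast
  then show False by (simp add: vac_1)
qed

text \<open>If some \<open>a * w\<close> has a nonzero vacuum coefficient, its degree zero component
  is a nonzero scalar modulo \<open>K\<close>. The homogeneous components lie in \<open>W\<close>,
  so \<open>W\<close> contains 1.\<close>

lemma radical_greatest:
  assumes W: "left_ideal W" "K \<subseteq> W" "W \<noteq> UNIV"
  shows "W \<subseteq> radical"
proof (rule ccontr)
  assume "\<not> W \<subseteq> radical"
  then obtain w a where w: "w \<in> W" "vacf (a * w) \<noteq> 0" by (auto simp: radical_def)
  obtain F g where Fg: "finite F" "\<forall>l\<in>F. NS (fst l) (snd l) (g l)" "a * w - (\<Sum>l\<in>F. g l) \<in> K"
    using NS_decompose by blast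
  have "(\<Sum>l\<in>F. g l) = a * w - (a * w - (\<Sum>l\<in>F. g l))" by simp
  also have "\<dots> \<in> W"
    using ideal_diff[OF W(1) ideal_mult[OF W(1) w(1)], of "a * w - (\<Sum>l\<in>F. g l)" a] Fg(3) W(2) by blast
  finally have comp: "\<forall>l\<in>F. g l \<in> W" by (rule NS_components[OF W(1,2) Fg(1,2)])
  have "vacf (a * w) = (\<Sum>l\<in>F. vacf (g l))"
    using vac_K[OF Fg(3)] by (simp add: vac_diff vac_sum)
  then obtain l where l: "l \<in> F" "vacf (g l) \<noteq> 0" using w(2) by (metis sum.neutral)
  then have "fst l = 0" using NS_vac Fg(2) by blast
  then obtain \<alpha> where \<alpha>: "g l = cst \<alpha>" using NS_degree_zero Fg(2) l(1) by blast
  then have "\<alpha> \<noteq> 0" "cst \<alpha> * 1 \<in> W" using l comp by auto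
  then have "1 \<in> W" using ideal_scale[OF W(1)] by blast
  then have "u * 1 \<in> W" for u by (rule ideal_mult[OF W(1)])
  then show False using W(3) by auto
qed

lemma radical_subset:
  assumes W: "left_ideal W" "K \<subseteq> W" and base: "\<And>i j. i \<in> I \<Longrightarrow> j \<in> I \<Longrightarrow> Rv i j (-2) \<in> W"
  shows "radical \<subseteq> W"
proof (rule ccontr)
  define Bad where "Bad d w \<longleftrightarrow> (\<exists>x. NS d w x \<and> x \<in> radical \<and> x \<notin> W)" for d w
  note JI = radical_ideal
  have bad: "\<exists>d w. Bad d w" if sub: "\<not> radical \<subseteq> W"
  proof -
    obtain u where u: "u \<in> radical" "u \<notin> W" using sub by blast
    obtain F g where Fg: "finite F" "\<forall>l\<in>F. NS (fst l) (snd l) (g l)" "u - (\<Sum>l\<in>F. g l) \<in> K"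
      using NS_decompose by blast
    have "(\<Sum>l\<in>F. g l) = u - (u - (\<Sum>l\<in>F. g l))" by simp
    also have "\<dots> \<in> radical"
      using ideal_diff[OF JI u(1), of "u - (\<Sum>l\<in>F. g l)"] Fg(3) K_radical by blast
    finally have comp: "\<forall>l\<in>F. g l \<in> radical" by (rule NS_components[OF JI K_radical Fg(1,2)])
    have "\<not> (\<forall>l\<in>F. g l \<in> W)"
    proof
      assume "\<forall>l\<in>F. g l \<in> W"
      then have "(u - (\<Sum>l\<in>F. g l)) + (\<Sum>l\<in>F. g l) \<in> W"
        using Fg(3) W(2) by (intro ideal_add[OF W(1)] ideal_sum[OF W(1)]) auto
      then show False using u(2) by simp
    qed
    then show ?thesis using comp Fg(2) unfolding Bad_def by blast
  qed
  have nz: "x \<noteq> 0" if "x \<notin> W" for x using that ideal_zero[OF W(1)] by blast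
  have dpos: "d > 0" if B: "Bad d w" for d w
  proof -
    obtain x where x: "NS d w x" "x \<in> radical" "x \<notin> W" using B unfolding Bad_def by blast
    have "\<not> d < 0" using NS_negative[OF x(1)] nz[OF x(3)] by blast
    moreover have "d \<noteq> 0"
    proof
      assume "d = 0"
      then obtain \<alpha> where \<alpha>: "x = cst \<alpha>" using NS_degree_zero[OF x(1)] by blast
      have "vacf (1 * x) = 0" using x(2) unfolding radical_def by blast
      then have "\<alpha> = 0" using vac_cst[of \<alpha> 1] vac_1 \<alpha> by simp
      then show False using \<alpha> nz[OF x(3)] by simp
    qed
    ultimately show ?thesis by simp
  qed
  assume "\<not> radical \<subseteq> W"
  then obtain d1 w1 where "Bad d1 w1" using bad by blast
  then have "\<exists>w. Bad (int (nat d1)) w" using dpos[of d1 w1] by auto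
  then obtain n where n: "\<exists>w. Bad (int n) w" "\<forall>m<n. \<not> (\<exists>w. Bad (int m) w)"
    using exists_least_iff[of "\<lambda>n. \<exists>w. Bad (int n) w"] by blast
  define d where "d = int n"
  have d: "\<exists>w. Bad d w" "\<And>d' w. d' < d \<Longrightarrow> \<not> Bad d' w"
  proof -
    show "\<exists>w. Bad d w" using n(1) by (simp add: d_def)
    fix d' w assume d': "d' < d"
    show "\<not> Bad d' w"
    proof
      assume B: "Bad d' w"
      then have "int (nat d') = d'" using dpos by force
      moreover have "nat d' < n" using d' dpos[OF B] by (simp add: d_def nat_less_iff)
      ultimately show False using n(2) B by metis
    qed
  qed
  \<comment> \<open>By \<open>NS_height\<close> the height of a nonzero vector is at most
    \<open>N d\<close>, so the least value of \<open>m\<close> in degree \<open>d\<close> selects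
    maximal height.\<close>
  define m where "m w = nat (int N * d - height w)" for w
  obtain w where w: "Bad d w" "\<And>w'. Bad d w' \<Longrightarrow> m w \<le> m w'"
    using d(1) ex_has_least_nat[of "Bad d" _ m] by blast
  obtain x where x: "NS d w x" "x \<in> radical" "x \<notin> W" using w(1) unfolding Bad_def by blast
  \<comment> \<open>The image stays in the radical. A positive mode lowers the degree and a raising
    mode increases the height, so by the two minimal choices the image cannot lie outside
    \<open>W\<close>.\<close>
  have move: "E a b s * x \<in> W" if ab: "a \<in> I" "b \<in> I" and s: "s > 0 \<or> s = 0 \<and> a < b" for a b s
  proof (rule ccontr)
    assume not: "E a b s * x \<notin> W"
    obtain x' where x': "NS (d - s) (wt_add w a b) x'" "E a b s * x - x' \<in> K"
      using NS_act[OF x(1) ab] by blast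
    have "x' \<in> radical"
      using ideal_diff[OF JI ideal_mult[OF JI x(2)], of "E a b s * x - x'" "E a b s"] x'(2) K_radical by auto
    moreover have x'W: "x' \<notin> W"
      using ideal_add[OF W(1), of "E a b s * x - x'" x'] x'(2) W(2) not by auto
    ultimately have B: "Bad (d - s) (wt_add w a b)" using x'(1) unfolding Bad_def by blast
    show False
    proof (cases "s > 0")
      case True
      then show False using d(2)[of "d - s"] B by simp
    next
      case False
      then have s0: "s = 0" "a < b" using s by auto
      have "height (wt_add w a b) \<le> int N * d" using NS_height[OF x'(1) nz[OF x'W]] s0 by simp
      then have "m (wt_add w a b) < m w" using height_wt_add[OF ab, of w] s0(2) by (simp add: m_def)
      then show False using w(2)[of "wt_add w a b"] B s0(1) by simp
    qed
  qed
  obtain f where p: "f \<in> dual W" "f x = 1" using dual_separates[OF W(1) x(3)] by blast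
  have wt: "E c c 0 * x - cst (of_int (w c)) * x \<in> W" if "c \<in> I" for c
    using NS_weight[OF x(1) that dual_mono[OF W(2)]] by (intro dual_mem[OF W(1)]) (simp add: dual_lin)
  have "\<forall>\<^sub>F T in at_top. \<forall>f\<in>dual W. f (S T 0 * x) = (of_nat N * of_int d + of_nat N * gamma T) * f x"
    using NS_degree[OF x(1)] by (rule eventually_mono) (use dual_mono[OF W(2)] in blast)
  from singular_relation[OF W base move move wt this _ p(1)]
  have rel: "(of_int (w i))\<^sup>2 + (\<Sum>p\<in>I. if i < p then of_int (w i - w p) else 0)
    - of_nat N / 2 * of_int (w i) - of_int d = (0 :: complex)" if "i \<in> I" for i
    using that p(2) by simp
  have "d = 0"
  proof (rule weights_zero[OF N_odd])
    fix i assume i: "i \<in> I"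
    have "(of_int (2 * (w i)\<^sup>2 + 2 * (\<Sum>p\<in>I. if i < p then w i - w p else 0) - int N * w i) :: complex) = of_int (2 * d)"
      using rel[OF i] by (simp add: if_distrib[where f = of_int] field_simps cong: if_cong)
    then show "2 * (w i)\<^sup>2 + 2 * (\<Sum>p\<in>I. if i < p then w i - w p else 0) - int N * w i = 2 * d"
      by (simp only: of_int_eq_iff)
  next
    have "(\<Sum>c\<in>I. f (E c c 0 * x)) = (\<Sum>c\<in>I. of_int (w c))"
      using NS_weight[OF x(1) _ dual_mono[OF W(2) p(1)]] p(2) by (intro sum.cong) auto
    then show "(\<Sum>c\<in>I. w c) = 0"
      using dual_trace[OF p(1), of 0 x] by (simp flip: of_int_sum)
  qed
  then show False using dpos[OF w(1)] by simp
qed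

text \<open>The modes of \<open>R\<close> from \<open>-1\<close> on kill the vacuum, so
  \<open>R_comm\<close> shows that positive modes annihilate these vectors and zero modes permute
  them by the adjoint action.\<close>

lemma Rv_act:
  assumes ab: "a \<in> I" "b \<in> I" and ij: "i \<in> I" "j \<in> I" and s: "s \<ge> 0"
  shows "E a b s * Rv i j (-2) - (if s = 0 then cst (kd b i) * Rv a j (-2) - cst (kd a j) * Rv i b (-2) else 0) \<in> K"
proof (rule dual_mem[OF K_ideal])
  fix f assume p: "f \<in> dual K"
  note pl = dual_lin[OF p]
  obtain T where T: "\<forall>f\<in>dual K. f (E a b s * (R T i j (-2) * 1)) = f (R T i j (-2) * (E a b s * 1))
    + kd b i * f (R T a j (-2 + s) * 1) - kd a j * f (R T i b (-2 + s) * 1)" "T \<ge> 2"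
    using eventually_happens'[OF trivial_limit_at_top_linorder
        eventually_conj[OF R_comm[OF ab ij, of s "-2" 1] eventually_ge_at_top[of 2]]] by blast
  have "f (E a b s * Rv i j (-2)) = f (E a b s * R T i j (-2))"
    using R_Rv[OF ij _ _ dual_mult[OF K_ideal p, of "E a b s"], of "-2" T] T(2) by simp
  also have "\<dots> = kd b i * f (R T a j (-2 + s)) - kd a j * f (R T i b (-2 + s))"
    using bspec[OF T(1) p] K_dual_zero[OF p E_K[OF ab s]] by simp
  finally have e: "f (E a b s * Rv i j (-2)) = \<dots>" .
  show "f (E a b s * Rv i j (-2) - (if s = 0 then cst (kd b i) * Rv a j (-2) - cst (kd a j) * Rv i b (-2) else 0)) = 0"
  proof (cases "s = 0")
    case True
    then show ?thesis using e R_Rv[OF ab(1) ij(2) _ _ p, of "-2" T] R_Rv[OF ij(1) ab(2) _ _ p, of "-2" T] T(2)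
      by (simp add: pl)
  next
    case False
    then show ?thesis using e s R_vacuum[OF ab(1) ij(2) _ _ p, of "-2 + s" T] R_vacuum[OF ij(1) ab(2) _ _ p, of "-2 + s" T] T(2)
      by (simp add: pl)
  qed
qed

lemma Rv_trace: "(\<Sum>a\<in>I. Rv a a m) = 0"
proof -
  have "(\<Sum>a\<in>I. cst (kd a a / of_nat N) * X) = X" for X
  proof -
    have "(\<Sum>a\<in>A. cst (1 / of_nat N) * X) = cst (of_nat (card A) * (1 / of_nat N)) * X" if "finite A" for A :: "nat set"
      using that by (induction A rule: finite_induct) (simp_all add: cst_add distrib_right add_divide_distrib)
    from this[where A = "idx N"] show ?thesis by (simp add: cst_1)
  qed
  then show ?thesis by (simp add: Rv_def sum_subtractf)
qed

text \<open>The adjoint module is irreducible, made explicit: from the corner entry one reaches the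
  first column, the other columns, the differences on the diagonal and the first row. Tracelessness
  then gives the diagonal entries themselves.\<close>

lemma Rv_generate:
  assumes W: "left_ideal W" "K \<subseteq> W" and v: "Rv N 1 (-2) \<in> W" and ij: "i \<in> I" "j \<in> I"
  shows "Rv i j (-2) \<in> W"
proof -
  let ?r = "\<lambda>i j. Rv i j (-2)"
  have N3: "N \<ge> 3" using N_odd N_ge by (cases "N = 2") auto
  have m: "1 \<in> I" "N \<in> I" using N3 by (auto simp: idx_def)
  have act: "cst (kd b i) * ?r a j - cst (kd a j) * ?r i b \<in> W"
    if "?r i j \<in> W" "a \<in> I" "b \<in> I" "i \<in> I" "j \<in> I" for a b i j
  proof -
    let ?x = "cst (kd b i) * ?r a j - cst (kd a j) * ?r i b"
    have "E a b 0 * ?r i j - ?x \<in> W" using Rv_act[OF that(2-5), of 0] W(2) by auto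
    from ideal_diff[OF W(1) ideal_mult[OF W(1) that(1)] this]
    have "E a b 0 * ?r i j - (E a b 0 * ?r i j - ?x) \<in> W" .
    then show ?thesis by simp
  qed
  have c1: "?r a 1 \<in> W" if "a \<in> I" "a \<noteq> 1" for a
    using act[OF v that(1) m(2) m(2) m(1)] that by (simp add: kd_neq cst_1)
  have c2: "?r a b \<in> W" if "a \<in> I" "b \<in> I" "a \<noteq> 1" "b \<noteq> a" for a b
    using act[OF c1[OF that(1,3)] m(1) that(2,1) m(1)] that ideal_minus[OF W(1), of "- ?r a b"]
    by (simp add: kd_neq cst_1)
  have c3: "?r 1 1 - ?r a a \<in> W" if "a \<in> I" for a
    using act[OF c1[OF that] m(1) that that m(1)] ideal_zero[OF W(1)] by (cases "a = 1") (simp_all add: cst_1)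
  have c4: "?r 1 b \<in> W" if "b \<in> I" "b \<noteq> 1" for b
  proof -
    have "\<exists>a\<in>I. a \<noteq> 1 \<and> a \<noteq> b"
      using N3 by (cases "b = 2") (auto simp: idx_def intro: bexI[of _ 3] bexI[of _ 2])
    then obtain a where a: "a \<in> I" "a \<noteq> 1" "a \<noteq> b" by blast
    show ?thesis using act[OF c2[OF a(1) that(1) a(2)] m(1) a(1) a(1) that(1)] a that
      by (simp add: kd_neq cst_1)
  qed
  have "(\<Sum>a\<in>I. ?r 1 1 - ?r a a) \<in> W" using c3 by (intro ideal_sum[OF W(1)])
  moreover have "(\<Sum>a\<in>I. ?r 1 1 - ?r a a) = cst (of_nat N) * ?r 1 1"
  proof -
    have "(\<Sum>a\<in>A. X) = cst (of_nat (card A)) * X" if "finite A" for A :: "nat set" and X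
      using that by (induction A rule: finite_induct) (simp_all add: cst_add cst_1 distrib_right)
    from this[where A = "idx N"] show ?thesis by (simp add: sum_subtractf Rv_trace)
  qed
  ultimately have c5: "?r 1 1 \<in> W" using ideal_scale[OF W(1), of "of_nat N"] by simp
  show ?thesis
  proof (cases "i = j")
    case True
    then show ?thesis using ideal_diff[OF W(1) c5 c3[OF ij(1)]] by simp
  next
    case False
    then show ?thesis using c2[OF ij] c4[OF ij(2)] by (cases "i = 1") auto
  qed
qed

text \<open>Closure is imposed only for negative modes, so the vacuum coefficient visibly vanishes.
  That the set is nevertheless a left ideal is proved afterwards, and together these facts put the
  vectors \<open>Rv i j (-2)\<close> into the radical.\<close>

inductive_set singular_span :: "'u set" where
  span_K: "x \<in> K \<Longrightarrow> x \<in> singular_span"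
| span_Rv: "i \<in> I \<Longrightarrow> j \<in> I \<Longrightarrow> Rv i j (-2) \<in> singular_span"
| span_add: "x \<in> singular_span \<Longrightarrow> y \<in> singular_span \<Longrightarrow> x + y \<in> singular_span"
| span_scale: "x \<in> singular_span \<Longrightarrow> cst \<alpha> * x \<in> singular_span"
| span_E: "x \<in> singular_span \<Longrightarrow> a \<in> I \<Longrightarrow> b \<in> I \<Longrightarrow> s < 0 \<Longrightarrow> E a b s * x \<in> singular_span"

lemma singular_span_cong: "x \<in> singular_span \<Longrightarrow> y - x \<in> K \<Longrightarrow> y \<in> singular_span"
  using span_add[OF _ span_K, of x "y - x"] by simp

lemma singular_span_E: "x \<in> singular_span \<Longrightarrow> a \<in> I \<Longrightarrow> b \<in> I \<Longrightarrow> E a b s * x \<in> singular_span"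
proof (induction arbitrary: a b s rule: singular_span.induct)
  case (span_K x)
  then show ?case by (blast intro: singular_span.span_K K_right)
next
  case (span_Rv i j)
  show ?case
  proof (cases "s < 0")
    case True
    then show ?thesis using span_Rv by (intro singular_span.span_E singular_span.span_Rv)
  next
    case False
    have "(if s = 0 then cst (kd b i) * Rv a j (-2) + cst (- kd a j) * Rv i b (-2) else 0) \<in> singular_span"
      using span_Rv by (auto intro!: singular_span.span_add singular_span.span_scale singular_span.span_Rv
          intro: singular_span.span_K ideal_zero[OF K_ideal])
    then show ?thesis
      by (rule singular_span_cong) (use Rv_act[OF span_Rv.prems span_Rv.hyps, of s] False in \<open>auto simp: cst_minus\<close>)
  qed
next
  case (span_add x y)
  then show ?case by (simp add: distrib_left singular_span.span_add)
next
  case (span_scale x \<alpha>)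
  then show ?case by (simp add: cst_left singular_span.span_scale)
next
  case (span_E x c d t)
  define z where "z = (if s + t = 0 then of_int s else 0) * (kd b c * kd a d - kd a b * kd c d / of_nat N) * k"
  have "E c d t * (E a b s * x) + cst (kd b c) * (E a d (s + t) * x) + cst (- kd a d) * (E c b (s + t) * x) + cst z * x \<in> singular_span"
    by (intro singular_span.span_add singular_span.span_scale span_E.hyps(1)
        singular_span.span_E[OF span_E.IH[OF span_E.prems] span_E.hyps(2-4)]
        span_E.IH[OF span_E.prems(1) span_E.hyps(3)] span_E.IH[OF span_E.hyps(2) span_E.prems(2)])
  then show ?case
  proof (rule singular_span_cong, intro dual_mem[OF K_ideal])
    fix f assume p: "f \<in> dual K"
    show "f (E a b s * (E c d t * x) - (E c d t * (E a b s * x) + cst (kd b c) * (E a d (s + t) * x)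
      + cst (- kd a d) * (E c b (s + t) * x) + cst z * x)) = 0"
      using K_comm[OF p span_E.prems span_E.hyps(2,3), of s t x] by (simp add: dual_lin[OF p] z_def)
  qed
qed

lemma singular_span_ideal: "x \<in> singular_span \<Longrightarrow> u * x \<in> singular_span"
proof (induction u rule: U_induct)
  case (5 y)
  then have "cst k * (y * x) \<in> singular_span" by (intro span_scale)
  then show ?case
  proof (rule singular_span_cong)
    have "(y * x) * (cc - cst k) \<in> K" by (intro K_right cc_K)
    moreover have "(y * x) * (cc - cst k) = cc * (y * x) - cst k * (y * x)"
      by (simp only: right_diff_distrib cst_central[of "y * x"] cc_central[of "y * x"])
    ultimately show "cc * y * x - cst k * (y * x) \<in> K" by (simp only: mult.assoc)
  qed
qed (simp_all add: distrib_right mult.assoc span_add span_scale singular_span_E)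

lemma singular_span_vac: "x \<in> singular_span \<Longrightarrow> vacf x = 0"
proof (induction rule: singular_span.induct)
  case (span_Rv i j)
  have Q0: "vacf (Qv i j (-2)) = 0" if "i \<in> I" "j \<in> I" for i j
    using that vac_neg[of i j "-2" 1] by (simp add: Qv_def vac_add vac_sum vac_neg vac_cst)
  then show ?case using span_Rv by (simp add: Rv_def vac_diff vac_cst vac_sum)
qed (simp_all add: vac_K vac_add vac_cst vac_neg)

lemma Rv_radical: "i \<in> I \<Longrightarrow> j \<in> I \<Longrightarrow> Rv i j (-2) \<in> radical"
  unfolding radical_def using singular_span_vac singular_span_ideal span_Rv by blast

text \<open>The right-hand side is the preimage of the submodule generated by \<open>v\<close>. It
  contains the radical because it contains all \<open>Rv i j (-2)\<close>, and it lies in the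
  radical because \<open>v\<close> does.\<close>

theorem radical_generated:
  assumes v: "v + Rv N 1 (-2) \<in> K"
  shows "radical = {x + u * v | x u. x \<in> K}"
proof -
  let ?W = "{x + u * v | x u. x \<in> K}"
  have I1: "1 \<in> I" "N \<in> I" using N_ge by (auto simp: idx_def)
  have W: "left_ideal ?W"
    unfolding left_ideal_def
  proof (intro conjI ballI allI)
    show "0 \<in> ?W" using ideal_zero[OF K_ideal] by (force intro: exI[of _ 0])
    fix y assume "y \<in> ?W"
    then obtain x u where y: "y = x + u * v" "x \<in> K" by blast
    show "a * y \<in> ?W" for a
      using K_right[OF y(2), of a] by (auto simp: y(1) distrib_left simp flip: mult.assoc)
    fix y' assume "y' \<in> ?W"
    then obtain x' u' where y': "y' = x' + u' * v" "x' \<in> K" by blast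
    have "y + y' = (x + x') + (u + u') * v" by (simp add: y y' distrib_right algebra_simps)
    then show "y + y' \<in> ?W" using ideal_add[OF K_ideal y(2) y'(2)] by blast
  qed
  have KW: "K \<subseteq> ?W" by (force intro: exI[of _ 0])
  have "Rv N 1 (-2) = (v + Rv N 1 (-2)) + cst (- 1) * v" by (simp add: cst_minus cst_1)
  then have rW: "Rv N 1 (-2) \<in> ?W" using v by blast
  have "radical \<subseteq> ?W"
    using radical_subset[OF W KW Rv_generate[OF W KW rW]] .
  moreover have "v \<in> radical"
  proof -
    have "(v + Rv N 1 (-2)) - Rv N 1 (-2) \<in> radical"
      using v K_radical Rv_radical[OF I1(2,1)] by (intro ideal_diff[OF radical_ideal]) auto
    then show ?thesis by simp
  qed
  then have "?W \<subseteq> radical"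
    using K_radical ideal_add[OF radical_ideal] ideal_mult[OF radical_ideal] by blast
  ultimately show ?thesis by blast
qed

end

section \<open>Construction of the vacuum functional\<close>

text \<open>The derivation of the tensor algebra that extends \<open>d\<close>, composed with the
  functional \<open>F\<close>. Returning the value of \<open>F\<close> avoids formal sums of
  words.\<close>

primrec word_der :: "('a \<Rightarrow> 'a) \<Rightarrow> ('a list \<Rightarrow> complex) \<Rightarrow> 'a list \<Rightarrow> complex" where
  "word_der d F [] = 0"
| "word_der d F (y # ys) = F (d y # ys) + word_der d (\<lambda>zs. F (y # zs)) ys"

text \<open>\<open>F\<close> is evaluated only at words of the same length; this is what makes the
  recursion of \<open>vac_word\<close> well-founded.\<close>

lemma word_der_cong [fundef_cong]:
  "d = d' \<Longrightarrow> ys = ys' \<Longrightarrow> (\<And>zs. length zs = length ys' \<Longrightarrow> F zs = G zs) \<Longrightarrow>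
    word_der d F ys = word_der d' G ys'"
proof (induction ys' arbitrary: F G ys)
  case (Cons y ys')
  have "word_der d (\<lambda>zs. F (y # zs)) ys' = word_der d' (\<lambda>zs. G (y # zs)) ys'"
    by (rule Cons.IH) (use Cons.prems in simp_all)
  with Cons.prems show ?case by auto
qed simp

lemma word_der_append:
  "word_der d F (a @ b) = word_der d (\<lambda>zs. F (zs @ b)) a + word_der d (\<lambda>zs. F (a @ zs)) b"
  by (induction a arbitrary: F) simp_all

lemma word_der_linear:
  "word_der d (\<lambda>zs. F zs + G zs) ys = word_der d F ys + word_der d G ys"
  "word_der d (\<lambda>zs. F zs - G zs) ys = word_der d F ys - word_der d G ys"
  "word_der d (\<lambda>zs. c * F zs) ys = c * word_der d F ys"
  by (induction ys arbitrary: F G) (simp_all add: algebra_simps)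

text \<open>The commutator of two derivations is again a derivation. The order is reversed because
  derivations act on functionals contravariantly.\<close>

lemma word_der_swap:
  "word_der d (word_der d' F) ys - word_der d' (word_der d F) ys =
     word_der (\<lambda>y. d' (d y)) F ys - word_der (\<lambda>y. d (d' y)) F ys"
proof (induction ys arbitrary: F)
  case (Cons y ys)
  show ?case using Cons[of "\<lambda>zs. F (y # zs)"]
    by (simp add: word_der_linear)
qed simp

text \<open>The central part is kept, so this is the projection onto \<open>affine_nonneg\<close>
  along the negative loop modes, and \<open>nonneg_part X = 0\<close> describes the latter.\<close>

definition nonneg_part :: "'g::complex_lie_algebra_form affine \<Rightarrow> 'g affine" where
  "nonneg_part X = Affine (Poly_Mapping.mapp (\<lambda>n x. if n < 0 then 0 else x) (loop_part X)) (central_part X)"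

lemma lookup_nonneg_part:
  "Poly_Mapping.lookup (loop_part (nonneg_part X)) n =
     (if n < 0 then 0 else Poly_Mapping.lookup (loop_part X) n)"
  by (simp add: nonneg_part_def lookup_mapp when_def in_keys_iff)

lemma central_nonneg_part [simp]: "central_part (nonneg_part X) = central_part X"
  by (simp add: nonneg_part_def)

lemma affine_eqI:
  "(\<And>n. Poly_Mapping.lookup (loop_part X) n = Poly_Mapping.lookup (loop_part Y) n) \<Longrightarrow>
    central_part X = central_part Y \<Longrightarrow> X = Y"
  by (cases X; cases Y) (auto intro: poly_mapping_eqI)

lemma affine_parts:
  "loop_part (X + Y) = loop_part X + loop_part Y" "central_part (X + Y) = central_part X + central_part Y"
  "loop_part (X - Y) = loop_part X - loop_part Y" "central_part (X - Y) = central_part X - central_part Y"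
  "loop_part (a *\<^sub>C X) = loop_scale a (loop_part X)" "central_part (a *\<^sub>C X) = a * central_part X"
  "loop_part (0 :: 'g affine) = 0" "central_part (0 :: 'g affine) = 0"
  "loop_part (\<^bold>[X, Y\<^bold>]) = loop_bracket (loop_part X) (loop_part Y)"
  "central_part (\<^bold>[X, Y\<^bold>]) = loop_cocycle (loop_part X) (loop_part Y)"
  for X Y :: "'g::complex_lie_algebra_form affine"
  by (simp_all add: plus_affine_def minus_affine_def scaleC_affine_def zero_affine_def lie_affine_def)

lemma nonneg_part_linear:
  "nonneg_part (X + Y) = nonneg_part X + nonneg_part Y"
  "nonneg_part (a *\<^sub>C X) = a *\<^sub>C nonneg_part X"
  by (rule affine_eqI; simp add: lookup_nonneg_part affine_parts lookup_add lookup_loop_scale scaleC_zero_right)+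

lemma nonneg_part_in: "nonneg_part X \<in> affine_nonneg"
  by (simp add: affine_nonneg_def lookup_nonneg_part)

lemma nonneg_part_id: "X \<in> affine_nonneg \<Longrightarrow> nonneg_part X = X"
  by (intro affine_eqI) (auto simp: affine_nonneg_def lookup_nonneg_part)

text \<open>For nonnegative modes the cocycle could only come from \<open>m = n = 0\<close>, where
  its factor \<open>m\<close> vanishes. Hence \<open>vacuum_char k\<close> is a character of this
  subalgebra.\<close>

lemma affine_nonneg_lie:
  assumes "X \<in> affine_nonneg" "Y \<in> affine_nonneg"
  shows "\<^bold>[X, Y\<^bold>] \<in> affine_nonneg" "central_part (\<^bold>[X, Y\<^bold>]) = 0"
proof -
  let ?l = Poly_Mapping.lookup and ?k = Poly_Mapping.keys
  have nn: "m \<ge> 0" if "m \<in> ?k (loop_part X) \<or> m \<in> ?k (loop_part Y)" for m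
    using assms that unfolding affine_nonneg_def in_keys_iff by (metis (mono_tags) mem_Collect_eq not_less)
  show "\<^bold>[X, Y\<^bold>] \<in> affine_nonneg"
    unfolding affine_nonneg_def affine_parts loop_bracket_def
    by (auto simp: affine_parts loop_bracket_def lookup_sum lookup_single when_def intro!: sum.neutral dest!: nn[OF disjI1] nn[OF disjI2])
  show "central_part (\<^bold>[X, Y\<^bold>]) = 0"
    unfolding affine_parts loop_cocycle_def
    by (auto intro!: sum.neutral dest!: nn[OF disjI1] nn[OF disjI2])
qed

lemma affine_neg_lie:
  assumes "nonneg_part X = 0" "nonneg_part Y = 0"
  shows "nonneg_part (\<^bold>[X, Y\<^bold>]) = 0"
proof -
  let ?l = Poly_Mapping.lookup and ?k = Poly_Mapping.keys
  have nn: "m < 0" if "m \<in> ?k (loop_part X) \<or> m \<in> ?k (loop_part Y)" for m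
  proof (rule ccontr)
    assume "\<not> m < 0"
    then show False
      using lookup_nonneg_part[of X m] lookup_nonneg_part[of Y m] assms that
      by (simp add: in_keys_iff affine_parts)
  qed
  have "?l (loop_part (\<^bold>[X, Y\<^bold>])) n = 0" if "\<not> n < 0" for n
    unfolding affine_parts loop_bracket_def
    using that by (auto simp: lookup_sum lookup_single when_def intro!: sum.neutral dest!: nn[OF disjI1] nn[OF disjI2])
  moreover have "central_part (\<^bold>[X, Y\<^bold>]) = 0"
    unfolding affine_parts loop_cocycle_def
    by (auto intro!: sum.neutral dest!: nn[OF disjI1] nn[OF disjI2])
  ultimately show ?thesis
    by (intro affine_eqI) (simp_all add: lookup_nonneg_part affine_parts)
qed

text \<open>The coefficient of the vacuum in \<open>w \<one>\<close> for a word \<open>w\<close>: a first letter that lies in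
  \<open>\<gg> \<otimes> t\<inverse>\<complex>[t\<inverse>]\<close> makes it zero, any other one is moved to the right. This needs no PBW theorem.\<close>

function vac_word :: "complex \<Rightarrow> 'g::complex_lie_algebra_form affine list \<Rightarrow> complex" where
  "vac_word k [] = 1"
| "vac_word k (X # ys) = word_der (lie (nonneg_part X)) (vac_word k) ys + vacuum_char k X * vac_word k ys"
  by pat_completeness auto
termination by (relation "measure (\<lambda>(k, ys). length ys)") auto

lemma vacuum_char_nonneg [simp]: "vacuum_char k (nonneg_part X) = vacuum_char k X"
  by (simp add: vacuum_char_def)

lemma word_der_linear_map:
  fixes F :: "'a::complex_lie_algebra list \<Rightarrow> complex"
  assumes "\<And>a b x y. length a + length b + 1 = length ys \<Longrightarrow> F (a @ (c *\<^sub>C x + y) # b) = c * F (a @ x # b) + F (a @ y # b)"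
  shows "word_der (\<lambda>z. c *\<^sub>C f z + g z) F ys = c * word_der f F ys + word_der g F ys"
  using assms
proof (induction ys arbitrary: F)
  case (Cons u us)
  have "word_der (\<lambda>z. c *\<^sub>C f z + g z) (\<lambda>zs. F (u # zs)) us =
      c * word_der f (\<lambda>zs. F (u # zs)) us + word_der g (\<lambda>zs. F (u # zs)) us"
    by (rule Cons.IH) (use Cons.prems[of "u # _"] in simp)
  then show ?case using Cons.prems[of "[]"] by (simp add: distrib_left)
qed simp

lemma vac_word_combination:
  fixes x y :: "'g::complex_lie_algebra_form affine"
  shows "vac_word k (a @ (c *\<^sub>C x + y) # b) = c * vac_word k (a @ x # b) + vac_word k (a @ y # b)"
proof (induction "length a + length b" arbitrary: a b x y rule: less_induct)
  case less
  show ?case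
  proof (cases a)
    case Nil
    have "lie (c *\<^sub>C nonneg_part x + nonneg_part y) = (\<lambda>z. c *\<^sub>C \<^bold>[nonneg_part x, z\<^bold>] + \<^bold>[nonneg_part y, z\<^bold>])"
      by (simp add: fun_eq_iff lie_add_left lie_scale_left)
    then have "word_der (lie (c *\<^sub>C nonneg_part x + nonneg_part y)) (vac_word k) b =
        c * word_der (lie (nonneg_part x)) (vac_word k) b + word_der (lie (nonneg_part y)) (vac_word k) b"
      by (simp only:) (rule word_der_linear_map, rule less, simp add: Nil)
    then show ?thesis
      by (simp add: Nil nonneg_part_linear vacuum_char_def affine_parts algebra_simps)
  next
    case (Cons z a')
    let ?d = "lie (nonneg_part z)"
    have l: "vac_word k (a @ (c *\<^sub>C x + y) # d) = c * vac_word k (a @ x # d) + vac_word k (a @ y # d)"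
      if "length a + length d = length a' + length b" for a d :: "'g affine list" and x y
      using that less[of a d x y] by (simp add: Cons)
    have "word_der ?d (\<lambda>zs. vac_word k (zs @ (c *\<^sub>C x + y) # b)) a' =
        word_der ?d (\<lambda>zs. c * vac_word k (zs @ x # b) + vac_word k (zs @ y # b)) a'"
      "word_der ?d (\<lambda>zs. vac_word k (a' @ (c *\<^sub>C x + y) # zs)) b =
        word_der ?d (\<lambda>zs. c * vac_word k (a' @ x # zs) + vac_word k (a' @ y # zs)) b"
      by (rule word_der_cong; simp add: l)+
    then show ?thesis
      by (simp add: Cons word_der_append word_der_linear l lie_add_right lie_scale_right) (simp add: algebra_simps)
  qed
qed

lemma vac_word_linear:
  fixes x y :: "'g::complex_lie_algebra_form affine"
  shows "vac_word k (a @ (x + y) # b) = vac_word k (a @ x # b) + vac_word k (a @ y # b)"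
    and "vac_word k (a @ (c *\<^sub>C x) # b) = c * vac_word k (a @ x # b)"
  using vac_word_combination[of k a 1 x y b] vac_word_combination[of k a 1 0 0 b]
    vac_word_combination[of k a c x 0 b] by (simp_all add: scaleC_one)

lemma word_der_vac_word:
  "word_der (\<lambda>z. f z + g z) (vac_word k) ys = word_der f (vac_word k) ys + word_der g (vac_word k) ys"
  using word_der_linear_map[of ys "vac_word k" 1 f g, OF vac_word_combination] by (simp add: scaleC_one)

lemma vac_word_minus: "vac_word k (a @ (x - y) # b) = vac_word k (a @ x # b) - vac_word k (a @ y # b)"
  using vac_word_linear(1)[of k a "x - y" y b] by simp

lemma vac_word_zero [simp]: "vac_word k (a @ 0 # b) = 0"
  using vac_word_linear(1)[of k a 0 0 b] by simp

text \<open>A nonempty prefix is handled by induction, since its first letter acts as a derivation.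
  For the empty prefix the letters are split into nonnegative and negative parts, both of which span
  subalgebras.\<close>

lemma vac_word_lie:
  fixes x y :: "'g::complex_lie_algebra_form affine"
  shows "vac_word k (a @ x # y # b) - vac_word k (a @ y # x # b) = vac_word k (a @ \<^bold>[x, y\<^bold>] # b)"
proof (induction "length a + length b" arbitrary: a b x y rule: less_induct)
  case less
  let ?V = "vac_word k :: 'g affine list \<Rightarrow> complex" and ?n = nonneg_part
  show ?case
  proof (cases a)
    case (Cons z a')
    let ?d = "lie (?n z)"
    have l: "?V (c @ x # y # d) = ?V (c @ y # x # d) + ?V (c @ \<^bold>[x, y\<^bold>] # d)"
      if "length c + length d = length a' + length b" for c d x y
      using that less[of c d x y] by (simp add: Cons algebra_simps)
    have 1: "word_der ?d (\<lambda>zs. ?V (zs @ x # y # b)) a' =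
        word_der ?d (\<lambda>zs. ?V (zs @ y # x # b) + ?V (zs @ \<^bold>[x, y\<^bold>] # b)) a'"
      "word_der ?d (\<lambda>zs. ?V (a' @ x # y # zs)) b =
        word_der ?d (\<lambda>zs. ?V (a' @ y # x # zs) + ?V (a' @ \<^bold>[x, y\<^bold>] # zs)) b"
      by (rule word_der_cong; simp add: l[of _ b x y] l[of a' _ x y])+
    have 2: "\<^bold>[?n z, \<^bold>[x, y\<^bold>]\<^bold>] = \<^bold>[\<^bold>[?n z, x\<^bold>], y\<^bold>] + \<^bold>[x, \<^bold>[?n z, y\<^bold>]\<^bold>]"
      by (simp add: lie_jacobi')
    show ?thesis
      using 1[unfolded word_der_linear] l[of a' b x y]
        l[of a' b "\<^bold>[?n z, x\<^bold>]" y] l[of a' b x "\<^bold>[?n z, y\<^bold>]"]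
      by (simp add: Cons word_der_append 2 vac_word_linear algebra_simps)
  next
    case Nil
    have wl: "word_der (lie (x + y)) ?V b = word_der (lie x) ?V b + word_der (lie y) ?V b" for x y
    proof -
      have "lie (x + y) = (\<lambda>z. \<^bold>[x, z\<^bold>] + \<^bold>[y, z\<^bold>])" by (simp add: fun_eq_iff lie_add_left)
      then show ?thesis by (simp only: word_der_vac_word)
    qed
    have wz: "word_der (lie 0) ?V b = 0"
      using wl[of 0 0] by simp
    have red: "?V (x # c) = ?V (?n x # c)" for x  and c
      by (simp add: nonneg_part_id[OF nonneg_part_in])
    have neg: "?V (x # c) = 0" if "?n x = 0" for x  and c
      using red[of x c] vac_word_zero[of k "[]" c] that by simp
    \<comment> \<open>By bilinearity only pure pairs remain: \<open>B\<close> treats two negative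
      letters, \<open>C\<close> a mixed pair, \<open>D\<close> two nonnegative letters.\<close>
    define x1 x2 y1 y2 where d: "x1 = ?n x" "x2 = x - ?n x" "y1 = ?n y" "y2 = y - ?n y"
    have nx: "?n x2 = 0" "?n y2 = 0"
      using nonneg_part_linear(1)[of x2 x1] nonneg_part_linear(1)[of y2 y1]
      by (simp_all add: d nonneg_part_id[OF nonneg_part_in])
    have nn: "x1 \<in> affine_nonneg" "y1 \<in> affine_nonneg" by (simp_all add: d nonneg_part_in)
    have B: "?V (x # y # b) - ?V (y # x # b) = ?V (\<^bold>[x, y\<^bold>] # b)"
      if "?n x = 0" "?n y = 0" for x y
      by (simp only: neg[OF that(1)] neg[OF that(2)] neg[OF affine_neg_lie[OF that]] diff_self)
    have C: "?V (x # y # b) = ?V (\<^bold>[x, y\<^bold>] # b)" "?V (y # x # b) = 0"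
      if "x \<in> affine_nonneg" "?n y = 0" for x y
    proof -
      have "word_der (lie x) (\<lambda>zs. ?V (y # zs)) b = word_der (lie x) (\<lambda>zs. 0 * ?V zs) b"
        by (rule word_der_cong) (simp_all only: neg[OF that(2)] mult_zero_left)
      then show "?V (x # y # b) = ?V (\<^bold>[x, y\<^bold>] # b)"
        unfolding vac_word.simps(2)[of k x] nonneg_part_id[OF that(1)]
        by (simp only: word_der.simps word_der_linear neg[OF that(2)]) simp
      show "?V (y # x # b) = 0" by (rule neg[OF that(2)])
    qed
    have D: "?V (x # y # b) - ?V (y # x # b) = ?V (\<^bold>[x, y\<^bold>] # b)"
      if "x \<in> affine_nonneg" "y \<in> affine_nonneg" for x y
    proof -
      have n: "?n x = x" "?n y = y" "?n (\<^bold>[x, y\<^bold>]) = \<^bold>[x, y\<^bold>]" "vacuum_char k (\<^bold>[x, y\<^bold>]) = 0"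
        using that affine_nonneg_lie[of x y] by (simp_all add: nonneg_part_id vacuum_char_def)
      have e: "word_der (lie x) (\<lambda>zs. ?V (y # zs)) b =
        word_der (lie x) (word_der (lie y) ?V) b + vacuum_char k y * word_der (lie x) ?V b" if "?n y = y" for x y
        using that by (simp add: word_der_linear)
      \<comment> \<open>In the difference for \<open>D\<close> the value at
        \<open>[x, y] # b\<close> arises twice, once from each order. The reversed bracket
        \<open>[y, x]\<close> obtained here subtracts one copy.\<close>
      have sw: "word_der (lie x) (word_der (lie y) ?V) b - word_der (lie y) (word_der (lie x) ?V) b =
         word_der (lie (\<^bold>[y, x\<^bold>])) ?V b"
      proof -
        have *: "word_der (\<lambda>z. \<^bold>[y, \<^bold>[x, z\<^bold>]\<^bold>]) ?V b = word_der (\<lambda>z. \<^bold>[\<^bold>[y, x\<^bold>], z\<^bold>] + \<^bold>[x, \<^bold>[y, z\<^bold>]\<^bold>]) ?V b"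
          by (simp add: lie_jacobi')
        show ?thesis using word_der_swap[of "lie x" "lie y" ?V b] * by (simp add: word_der_vac_word)
      qed
      have s: "\<^bold>[y, x\<^bold>] = - \<^bold>[x, y\<^bold>]" by (rule lie_skew)
      have "?V (\<^bold>[y, x\<^bold>] # b) = - ?V (\<^bold>[x, y\<^bold>] # b)"
        using vac_word_minus[of k "[]" 0 "\<^bold>[x, y\<^bold>]" b] vac_word_zero[of k "[]" b] s by simp
      moreover have "word_der (lie (\<^bold>[y, x\<^bold>])) ?V b = - word_der (lie (\<^bold>[x, y\<^bold>])) ?V b"
        using wl[of "\<^bold>[y, x\<^bold>]" "\<^bold>[x, y\<^bold>]"] wz
        unfolding s by (simp add: eq_neg_iff_add_eq_0)
      moreover have "?V (\<^bold>[x, y\<^bold>] # b) = word_der (lie (\<^bold>[x, y\<^bold>])) ?V b"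
        by (simp add: n)
      moreover have "?V (x # y # b) = ?V (\<^bold>[x, y\<^bold>] # b) + word_der (lie x) (word_der (lie y) ?V) b
         + vacuum_char k y * word_der (lie x) ?V b + vacuum_char k x * ?V (y # b)"
        unfolding vac_word.simps(2)[of k x] n word_der.simps e[OF n(2)] by simp
      moreover have "?V (y # x # b) = ?V (\<^bold>[y, x\<^bold>] # b) + word_der (lie y) (word_der (lie x) ?V) b
         + vacuum_char k x * word_der (lie y) ?V b + vacuum_char k y * ?V (x # b)"
        unfolding vac_word.simps(2)[of k y] n word_der.simps e[OF n(1)] by simp
      moreover have "?V (y # b) = word_der (lie y) ?V b + vacuum_char k y * ?V b"
        "?V (x # b) = word_der (lie x) ?V b + vacuum_char k x * ?V b" by (simp_all add: n)
      ultimately show ?thesis using sw by (simp add: algebra_simps del: vac_word.simps)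
    qed
    have x: "x = x1 + x2" "y = y1 + y2" by (simp_all add: d)
    have lin: "?V ((x + y) # c) = ?V (x # c) + ?V (y # c)"
      "?V (z # (x + y) # c) = ?V (z # x # c) + ?V (z # y # c)" for x y z c
      using vac_word_linear(1)[of k "[]"] vac_word_linear(1)[of k "[z]"] by simp_all
    have "?V (\<^bold>[x2, y1\<^bold>] # b) = - ?V (\<^bold>[y1, x2\<^bold>] # b)"
      using vac_word_minus[of k "[]" 0 "\<^bold>[y1, x2\<^bold>]" b] vac_word_zero[of k "[]" b] lie_skew[of x2 y1] by simp
    then have "?V (x # y # b) - ?V (y # x # b) = ?V (\<^bold>[x, y\<^bold>] # b)"
      using B[OF nx] C[OF nn(1) nx(2)] C[OF nn(2) nx(1)] D[OF nn]
      unfolding x by (simp only: lin lie_add_left lie_add_right) (simp add: algebra_simps del: vac_word.simps)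
    then show ?thesis by (simp add: Nil)
  qed
qed

text \<open>The letters to the left act on \<open>X\<close> through brackets with nonnegative
  elements; these brackets stay in the subalgebra and have character zero, so only the value at
  \<open>X\<close> survives.\<close>

lemma vac_word_nonneg_right:
  assumes "X \<in> affine_nonneg"
  shows "vac_word k (ys @ [X]) = vacuum_char k X * vac_word k ys"
  using assms
proof (induction "length ys" arbitrary: ys X rule: less_induct)
  case less
  show ?case
  proof (cases ys)
    case Nil
    then show ?thesis by simp
  next
    case (Cons z zs)
    let ?d = "lie (nonneg_part z)"
    have "word_der ?d (\<lambda>a. vac_word k (a @ [X])) zs = word_der ?d (\<lambda>a. vacuum_char k X * vac_word k a) zs"
      by (rule word_der_cong) (use less Cons in auto)
    then have 1: "word_der ?d (\<lambda>a. vac_word k (a @ [X])) zs = vacuum_char k X * word_der ?d (vac_word k) zs"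
      by (simp only: word_der_linear)
    have "\<^bold>[nonneg_part z, X\<^bold>] \<in> affine_nonneg" "vacuum_char k (\<^bold>[nonneg_part z, X\<^bold>]) = 0"
      using less.prems affine_nonneg_lie[of "nonneg_part z" X] nonneg_part_in[of z]
      by (simp_all add: vacuum_char_def)
    then have 2: "vac_word k (zs @ [\<^bold>[nonneg_part z, X\<^bold>]]) = 0"
      using less.hyps[of zs "\<^bold>[nonneg_part z, X\<^bold>]"] Cons by simp
    have 3: "vac_word k (zs @ [X]) = vacuum_char k X * vac_word k zs"
      using less Cons by simp
    show ?thesis
      using 1 2 3 by (simp add: Cons word_der_append word_der_linear algebra_simps)
  qed
qed

lemma poly_mapping_induct_add [case_names zero single add]:
  fixes p :: "'a \<Rightarrow>\<^sub>0 'b::comm_monoid_add"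
  assumes "P 0" and s: "\<And>k c. P (Poly_Mapping.single k c)"
    and a: "\<And>p q. P p \<Longrightarrow> P q \<Longrightarrow> P (p + q)"
  shows "P p"
proof (induction p rule: update_induct)
  case const
  then show ?case by (rule assms)
next
  case (update f a b)
  have "Poly_Mapping.update a b f = f + Poly_Mapping.single a b"
    using update(1) by (intro poly_mapping_eqI)
      (auto simp: lookup_update lookup_add lookup_single when_def in_keys_iff)
  then show ?case using update(3) by (simp add: s a)
qed

section \<open>Descent of the functional to the enveloping algebra and to the Verma module\<close>

fun word_list :: "'a word \<Rightarrow> 'a list" where
  "word_list (Word xs) = xs"

definition vac_free :: "complex \<Rightarrow> 'g::complex_lie_algebra_form affine free_algebra \<Rightarrow> complex" where
  "vac_free k p = (\<Sum>w\<in>Poly_Mapping.keys p. Poly_Mapping.lookup p w * vac_word k (word_list w))"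

lemma vac_free_add: "vac_free k (p + q) = vac_free k p + vac_free k q"
  unfolding vac_free_def
  by (rule setsum_keys_plus_distrib) (simp_all add: distrib_right)

lemma vac_free_single: "vac_free k (Poly_Mapping.single w c) = c * vac_word k (word_list w)"
  by (cases "c = 0") (simp_all add: vac_free_def)

lemma vac_free_diff: "vac_free k (p - q) = vac_free k p - vac_free k q"
  using vac_free_add[of k "p - q" q] by simp

lemma vac_free_zero: "vac_free k 0 = 0"
  by (simp add: vac_free_def)

lemma vac_free_sandwich:
  assumes "\<And>a b. vac_free k (Poly_Mapping.single (Word a) 1 * p * Poly_Mapping.single (Word b) 1) = 0"
  shows "vac_free k (r * p * s) = 0"
proof -
  have sc: "vac_free k (Poly_Mapping.single 0 c * q) = c * vac_free k q" for c q
    by (induction q rule: poly_mapping_induct_add)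
      (simp_all add: vac_free_zero distrib_left vac_free_add mult_single vac_free_single)
  have sc': "vac_free k (q * Poly_Mapping.single 0 c) = c * vac_free k q" for c q
    by (induction q rule: poly_mapping_induct_add)
      (simp_all add: vac_free_zero distrib_left distrib_right vac_free_add mult_single vac_free_single)
  have mono: "vac_free k (Poly_Mapping.single a c * p * Poly_Mapping.single b d) = 0" for a b c d
  proof -
    have "Poly_Mapping.single a c * p * Poly_Mapping.single b d =
      Poly_Mapping.single 0 c * ((Poly_Mapping.single a 1 * p * Poly_Mapping.single b 1) * Poly_Mapping.single 0 d)"
    proof -
      have "Poly_Mapping.single a c = Poly_Mapping.single 0 c * Poly_Mapping.single a 1"
        "Poly_Mapping.single b d = Poly_Mapping.single b 1 * Poly_Mapping.single 0 d"
        by (simp_all add: mult_single)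
      then show ?thesis by (metis mult.assoc)
    qed
    then show ?thesis
      using assms[of "word_list a" "word_list b"] by (cases a; cases b) (simp add: sc sc')
  qed
  have "vac_free k (Poly_Mapping.single a c * p * s) = 0" for a c
    by (induction s rule: poly_mapping_induct_add) (simp_all add: vac_free_zero mono distrib_left vac_free_add)
  then show ?thesis
    by (induction r rule: poly_mapping_induct_add) (simp_all add: vac_free_zero distrib_right vac_free_add)
qed

lemma vac_free_uea_ideal: "p \<in> uea_ideal \<Longrightarrow> vac_free k (r * p * s) = 0"
proof (induction arbitrary: r s rule: uea_ideal.induct)
  case (gen_add x y)
  show ?case
    by (rule vac_free_sandwich)
      (simp add: fa_gen_def algebra_simps mult_single vac_free_diff vac_free_add vac_free_single vac_word_linear)
next
  case (gen_scale a x)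
  show ?case
    by (rule vac_free_sandwich)
      (simp add: fa_gen_def fa_const_def algebra_simps mult_single vac_free_diff vac_free_add vac_free_single vac_word_linear)
next
  case (gen_lie x y)
  show ?case
    by (rule vac_free_sandwich)
      (simp add: fa_gen_def algebra_simps mult_single vac_free_diff vac_free_single vac_free_add vac_word_lie[symmetric])
next
  case (add p q)
  then show ?case by (simp add: distrib_left distrib_right vac_free_add)
next
  case (mult p r' s')
  then show ?case using mult.IH[of "r * r'" "s' * s"] by (simp add: mult.assoc)
qed (simp add: vac_free_zero)

lift_definition vac :: "complex \<Rightarrow> 'g::complex_lie_algebra_form affine uea \<Rightarrow> complex" is vac_free
  unfolding uea_eq_def
  using vac_free_uea_ideal[where r = 1 and s = 1] vac_free_diff by (metis mult_1 mult_1_right eq_iff_diff_eq_0)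

lemma vac_add: "vac k (u + u') = vac k u + vac k u'"
  by transfer (rule vac_free_add)

lemma vac_one: "vac k 1 = 1"
  by transfer (simp add: vac_free_single zero_word_def flip: single_one)

lemma vac_const: "vac k (uea_const a * u) = a * vac k u"
proof (transfer, goal_cases)
  case (1 k a u)
  show ?case
    by (induction u rule: poly_mapping_induct_add)
      (simp_all add: vac_free_zero fa_const_def distrib_left vac_free_add mult_single vac_free_single)
qed

lemma uea_const_central: "u * uea_const a = uea_const a * u"
proof (transfer, goal_cases)
  case (1 u a)
  have "u * fa_const a = fa_const a * u"
    by (induction u rule: poly_mapping_induct_add)
      (simp_all add: fa_const_def distrib_left distrib_right mult_single mult.commute)
  then show ?case by (simp add: uea_eq_def uea_ideal.zero)
qed

lemma vac_neg: "nonneg_part X = 0 \<Longrightarrow> vac k (uea_gen X * u) = 0"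
proof (transfer, goal_cases)
  case (1 X k u)
  have "vac_word k (X # ys) = vac_word k ((0 :: 'a affine) # ys)" for ys
    using 1 vacuum_char_nonneg[of k X] nonneg_part_id[OF nonneg_part_in, of X]
    unfolding vac_word.simps by (simp only:)
  then have "vac_word k (X # ys) = 0" for ys
    using vac_word_zero[of k "[]" ys] by simp
  then show ?case
  proof (induction u rule: poly_mapping_induct_add)
    case (single w c)
    then show ?case by (cases w) (simp add: fa_gen_def mult_single vac_free_single)
  qed (simp_all add: vac_free_zero distrib_left vac_free_add)
qed

lemma vac_nonneg_right: "X \<in> affine_nonneg \<Longrightarrow> vac k (u * uea_gen X) = vacuum_char k X * vac k u"
proof (transfer, goal_cases)
  case (1 X k u)
  then show ?case
  proof (induction u rule: poly_mapping_induct_add)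
    case (single w c)
    then show ?case by (cases w) (simp add: fa_gen_def mult_single vac_free_single vac_word_nonneg_right)
  qed (simp_all add: vac_free_zero distrib_left distrib_right vac_free_add)
qed

definition vac_pre :: "complex \<Rightarrow> 'g::complex_lie_algebra_form pre_verma \<Rightarrow> complex" where
  "vac_pre k p = (\<Sum>x\<in>Poly_Mapping.keys p. of_int (Poly_Mapping.lookup p x) * (vac k (fst x) * snd x))"

lemma vac_pre_add: "vac_pre k (p + q) = vac_pre k p + vac_pre k q"
  unfolding vac_pre_def
  by (rule setsum_keys_plus_distrib[where f = "\<lambda>x c. of_int c * (vac k (fst x) * snd x)"])
    (simp_all add: distrib_right)

lemma vac_pre_frag_of: "vac_pre k (frag_of (u, z)) = vac k u * z"
  by (simp add: vac_pre_def)

lemma vac_pre_zero: "vac_pre k 0 = 0"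
  by (simp add: vac_pre_def)

lemma vac_pre_diff: "vac_pre k (p - q) = vac_pre k p - vac_pre k q"
  using vac_pre_add[of k "p - q" q] by simp

text \<open>The functional descends to N(k, 0). As it is 1 on the vacuum, \<open>verma_ker k\<close>
  is a proper left ideal.\<close>

lemma vac_pre_verma_rel: "p \<in> verma_rel k \<Longrightarrow> vac_pre k p = 0"
proof (induction rule: verma_rel.induct)
  case (uminus p)
  then show ?case using vac_pre_diff[of k 0 p] by (simp add: vac_pre_zero)
qed (simp_all add: vac_pre_diff vac_pre_frag_of vac_pre_zero vac_pre_add vac_add vac_const
    uea_const_central vac_nonneg_right algebra_simps)

section \<open>Transfer to the generalized Verma module\<close>

lemma tpow_linear:
  "(x + y) \<otimes>t n = x \<otimes>t n + y \<otimes>t n" "(a *\<^sub>C x) \<otimes>t n = a *\<^sub>C (x \<otimes>t n)" "0 \<otimes>t n = 0"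
  by (simp_all add: tpow_def affine_parts plus_affine_def scaleC_affine_def zero_affine_def
      single_add loop_scale_single)

lemma uea_gen_zero [simp]: "uea_gen 0 = 0"
  using uea_gen_add[of 0 0] by simp

lemma mode_zero [simp]: "0\<langle>n\<rangle> = 0"
  by (simp add: tpow_linear)

lemma mode_add: "(x + y)\<langle>n\<rangle> = x\<langle>n\<rangle> + y\<langle>n\<rangle>"
  by (simp add: tpow_linear uea_gen_add)

lemma mode_scale: "(a *\<^sub>C x)\<langle>n\<rangle> = uea_const a * x\<langle>n\<rangle>"
  by (simp add: tpow_linear uea_gen_scale)

lemma mode_diff: "(x - y)\<langle>n\<rangle> = x\<langle>n\<rangle> - y\<langle>n\<rangle>"
  using mode_add[of "x - y" y n] by simp

lemma mode_sum: "(\<Sum>i\<in>A. g i)\<langle>n\<rangle> = (\<Sum>i\<in>A. (g i)\<langle>n\<rangle>)"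
  by (induction A rule: infinite_finite_induct) (simp_all add: mode_add)

lemma uea_const_add: "uea_const (a + b) = uea_const a + uea_const b"
  by transfer (simp add: fa_const_def single_add uea_eq_def uea_ideal.zero)

lemma uea_const_zero [simp]: "uea_const 0 = 0"
  using uea_const_add[of 0 0] by simp

lemma uea_const_mult: "uea_const (a * b) = uea_const a * uea_const b"
  by transfer (simp add: fa_const_def mult_single uea_eq_def uea_ideal.zero)

lemma uea_const_one: "uea_const 1 = 1"
  by transfer (simp add: fa_const_def uea_eq_def uea_ideal.zero)

lemma uea_induct [case_names one add const gen]:
  fixes u :: "'a::complex_lie_algebra uea"
  assumes "P 1" and add: "\<And>x y. P x \<Longrightarrow> P y \<Longrightarrow> P (x + y)"
    and const: "\<And>\<alpha> x. P x \<Longrightarrow> P (uea_const \<alpha> * x)" and gen: "\<And>X x. P x \<Longrightarrow> P (uea_gen X * x)"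
  shows "P u"
proof -
  have "P (abs_uea p)" for p
  proof (induction p rule: poly_mapping_induct_add)
    case zero
    have "abs_uea 0 = uea_const 0 * (1 :: 'a uea)"
      by (simp add: zero_uea.abs_eq[symmetric] uea_const.abs_eq fa_const_def)
    then show ?case using const[OF assms(1)] by metis
  next
    case (single w c)
    have "P (abs_uea (Poly_Mapping.single (Word xs) 1))" for xs
    proof (induction xs)
      case Nil
      have "abs_uea (Poly_Mapping.single (Word []) 1) = (1 :: 'a uea)"
        by (simp add: one_uea.abs_eq zero_word_def flip: single_one)
      then show ?case using assms(1) by simp
    next
      case (Cons x xs)
      have "abs_uea (Poly_Mapping.single (Word (x # xs)) 1) = uea_gen x * abs_uea (Poly_Mapping.single (Word xs) 1)"
        by (simp add: uea_gen.abs_eq times_uea.abs_eq fa_gen_def mult_single)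
      then show ?case using gen[OF Cons] by simp
    qed
    moreover have "abs_uea (Poly_Mapping.single w c) = uea_const c * abs_uea (Poly_Mapping.single (Word (word_list w)) 1)"
      by (cases w) (simp add: uea_const.abs_eq times_uea.abs_eq fa_const_def mult_single)
    ultimately show ?case using const by simp
  next
    case (add p q)
    then show ?case using assms(2)[OF add] by (simp add: plus_uea.abs_eq)
  qed
  then show ?thesis by (induct u rule: uea.abs_induct)
qed

lemma uea_gen_affine_c_central: "uea_gen affine_c * u = u * uea_gen affine_c"
proof (induction u rule: uea_induct)
  case (add x y)
  then show ?case by (simp add: distrib_left distrib_right)
next
  case (const \<alpha> x)
  then show ?case by (metis mult.assoc uea_const_central)
next
  case (gen X x)
  have "uea_gen affine_c * uea_gen X = uea_gen X * uea_gen affine_c"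
    using uea_gen_lie[of affine_c X] by (simp add: affine_bracket_c)
  then show ?case using gen by (metis mult.assoc)
qed simp

section \<open>Submodules of N(k, 0) as left ideals above the annihilator of the vacuum\<close>

definition verma_pi :: "complex \<Rightarrow> 'g::complex_lie_algebra_form affine uea \<Rightarrow> 'g pre_verma set" where
  "verma_pi k u = verma_class k (frag_of (u, 1))"

definition verma_ker :: "complex \<Rightarrow> 'g::complex_lie_algebra_form affine uea set" where
  "verma_ker k = {u. frag_of (u, 1) \<in> verma_rel k}"

lemma verma_rel_diff: "p \<in> verma_rel k \<Longrightarrow> q \<in> verma_rel k \<Longrightarrow> p - q \<in> verma_rel k"
  using verma_rel.add[of p k "- q"] verma_rel.uminus[of q k] by simp

lemma verma_rel_frag_diff:
  "frag_of (u, 1) - frag_of (u', 1) \<in> verma_rel k \<longleftrightarrow> frag_of (u - u', 1) \<in> verma_rel k"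
proof -
  have "frag_of (u, 1) - frag_of (u - u', 1) - frag_of (u', 1) \<in> verma_rel k"
    using verma_rel.add_left[of "u - u'" u' 1 k] by simp
  then have d: "(frag_of (u, 1) - frag_of (u', 1)) - frag_of (u - u', 1) \<in> verma_rel k"
    by (simp add: algebra_simps)
  show ?thesis
    using verma_rel.add[OF d, of "frag_of (u - u', 1)"] verma_rel_diff[OF _ d, of "frag_of (u, 1) - frag_of (u', 1)"]
    by auto
qed

lemma verma_pi_eq: "verma_pi k u = verma_pi k u' \<longleftrightarrow> u - u' \<in> verma_ker k"
  unfolding verma_pi_def verma_class_eq_iff verma_rel_frag_diff verma_ker_def by simp

lemma verma_rel_frag_zero: "frag_of (0, 1) \<in> verma_rel k"
  using verma_rel_frag_diff[of 0 0 k] by (simp add: verma_rel.zero)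

lemma verma_ker_ideal: "left_ideal (verma_ker k :: 'g::complex_lie_algebra_form affine uea set)"
  unfolding left_ideal_def verma_ker_def
proof (intro conjI ballI allI CollectI)
  show "frag_of (0, 1) \<in> verma_rel k" by (rule verma_rel_frag_zero)
  fix x :: "'g affine uea" assume x: "x \<in> {u. frag_of (u, 1) \<in> verma_rel k}"
  show "frag_of (u * x, 1) \<in> verma_rel k" for u
    using pre_act_rel[of "frag_of (x, 1)" k u] x by (simp add: pre_act_def)
  fix y :: "'g affine uea" assume y: "y \<in> {u. frag_of (u, 1) \<in> verma_rel k}"
  have "frag_of (x + y, 1) - frag_of (y, 1) \<in> verma_rel k"
    using x by (simp add: verma_rel_frag_diff)
  from verma_rel.add[OF this, of "frag_of (y, 1)"] y show "frag_of (x + y, 1) \<in> verma_rel k" by simp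
qed

lemma verma_ker_nonneg:
  assumes "X \<in> affine_nonneg"
  shows "uea_gen X - uea_const (vacuum_char k X) \<in> verma_ker k"
proof -
  have "frag_of (uea_gen X, 1) - frag_of (1, vacuum_char k X) \<in> verma_rel k"
    "frag_of (uea_const (vacuum_char k X), 1) - frag_of (1, vacuum_char k X) \<in> verma_rel k"
    using verma_rel.balanced[OF assms, of 1 1 k] verma_rel.balanced_const[of 1 "vacuum_char k X" 1 k] by simp_all
  from verma_rel_diff[OF this] show ?thesis
    by (simp add: verma_ker_def flip: verma_rel_frag_diff)
qed

lemma vac_verma_ker: "u \<in> verma_ker k \<Longrightarrow> vac k u = 0"
  using vac_pre_verma_rel[of "frag_of (u, 1)" k] by (simp add: verma_ker_def vac_pre_frag_of)

text \<open>The balancing relation for constants absorbs the second tensor factor into the first, so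
  the vacuum generates N(k, 0).\<close>

lemma verma_N_pi: "verma_N k = range (verma_pi k :: 'g::complex_lie_algebra_form affine uea \<Rightarrow> _)"
proof -
  have "\<exists>u. p - frag_of (u, 1) \<in> verma_rel k" for p :: "'g pre_verma"
    using subset_UNIV[of "Poly_Mapping.keys p"]
  proof (induction p rule: frag_induction)
    case zero
    show ?case using verma_rel.uminus[OF verma_rel_frag_zero] by (intro exI[of _ 0]) simp
  next
    case (one x)
    obtain u z where x: "x = (u, z)" by (cases x)
    have "- (frag_of (u * uea_const z, 1) - frag_of (u, z * 1)) \<in> verma_rel k"
      by (intro verma_rel.uminus verma_rel.balanced_const)
    then show ?case unfolding x by (intro exI[of _ "u * uea_const z"]) simp
  next
    case (diff p q)
    then obtain u u' where u: "p - frag_of (u, 1) \<in> verma_rel k" "q - frag_of (u', 1) \<in> verma_rel k" by blast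
    have "frag_of (u, 1) - frag_of (u', 1) - frag_of (u - u', 1) \<in> verma_rel k"
      using verma_rel.add_left[of "u - u'" u' 1 k] by (simp add: algebra_simps)
    from verma_rel.add[OF verma_rel_diff[OF u] this] show ?case
      by (intro exI[of _ "u - u'"]) (simp add: algebra_simps)
  qed
  then have "\<exists>u. verma_class k p = verma_pi k u" for p :: "'g pre_verma"
    unfolding verma_pi_def verma_class_eq_iff by blast
  then show ?thesis unfolding verma_N_def by (auto simp: verma_pi_def image_iff)
qed

lemma verma_add_pi: "verma_add k (verma_pi k u) (verma_pi k u') = verma_pi k (u + u')"
proof -
  have "- (frag_of (u + u', 1) - frag_of (u, 1) - frag_of (u', 1)) \<in> verma_rel k"
    by (intro verma_rel.uminus verma_rel.add_left)
  then show ?thesis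
    unfolding verma_pi_def verma_add_class verma_class_eq_iff by (simp add: algebra_simps)
qed

lemma verma_act_pi: "verma_act k a (verma_pi k u) = verma_pi k (a * u)"
  unfolding verma_pi_def verma_act_class by (simp add: pre_act_def)

lemma verma_zero_pi: "verma_zero k = verma_pi k 0"
  unfolding verma_zero_def verma_pi_def verma_class_eq_iff
  using verma_rel.uminus[OF verma_rel_frag_zero] by simp

lemma vacuum_pi: "vacuum k = verma_pi k 1"
  by (simp add: vacuum_def verma_pi_def)

lemma verma_submodule_pi: "left_ideal V \<Longrightarrow> verma_submodule k (verma_pi k ` V)"
  unfolding verma_submodule_def left_ideal_def
  by (auto simp: verma_N_pi verma_zero_pi verma_add_pi verma_act_pi)

lemma verma_submodule_preimage:
  fixes W :: "'g::complex_lie_algebra_form pre_verma set set"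
  assumes "verma_submodule k W"
  defines "V \<equiv> {u. verma_pi k u \<in> W}"
  shows "left_ideal V" "verma_ker k \<subseteq> V" "W = verma_pi k ` V"
proof -
  note W = assms(1)[unfolded verma_submodule_def]
  show "left_ideal V"
    unfolding left_ideal_def V_def using W
    by (auto simp: verma_zero_pi simp flip: verma_add_pi verma_act_pi)
  show "verma_ker k \<subseteq> V"
  proof
    fix x :: "'g affine uea" assume "x \<in> verma_ker k"
    then have "verma_pi k x = verma_zero k" by (simp add: verma_zero_pi verma_pi_eq)
    then show "x \<in> V" using W by (simp add: V_def)
  qed
  show "W = verma_pi k ` V"
    using W by (auto simp: V_def verma_N_pi)
qed

text \<open>Proper submodules pull back to proper left ideals containing \<open>verma_ker k\<close>,
  so a greatest such ideal yields a submodule that contains every proper one.\<close>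

lemma verma_maximal:
  assumes R: "left_ideal R" "verma_ker k \<subseteq> R" "R \<noteq> UNIV"
    and greatest: "\<And>V. left_ideal V \<Longrightarrow> verma_ker k \<subseteq> V \<Longrightarrow> V \<noteq> UNIV \<Longrightarrow> V \<subseteq> R"
  shows "maximal_proper_submodule k J \<longleftrightarrow> J = verma_pi k ` R"
proof -
  have proper: "verma_pi k ` R \<noteq> verma_N k"
  proof
    assume "verma_pi k ` R = verma_N k"
    then have "\<forall>u. verma_pi k u \<in> verma_pi k ` R" by (simp add: verma_N_pi)
    then have "\<forall>u. \<exists>r\<in>R. verma_pi k u = verma_pi k r" by (metis imageE)
    then have "\<forall>u. \<exists>r\<in>R. u - r \<in> R" using R(2) verma_pi_eq by blast
    then have "\<forall>u. u \<in> R" using R(1) unfolding left_ideal_def by (metis diff_add_cancel)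
    then show False using R(3) by blast
  qed
  have sub: "W \<subseteq> verma_pi k ` R" if "verma_submodule k W" "W \<noteq> verma_N k" for W
  proof -
    let ?V = "{u. verma_pi k u \<in> W}"
    note V = verma_submodule_preimage[OF that(1)]
    have "?V \<noteq> UNIV" using that(2) V(3) by (metis verma_N_pi)
    then have "?V \<subseteq> R" using greatest V by blast
    then show ?thesis using V(3) by blast
  qed
  have max: "maximal_proper_submodule k (verma_pi k ` R)"
    unfolding maximal_proper_submodule_def
  proof (intro conjI allI impI verma_submodule_pi[OF R(1)] proper)
    fix W assume "verma_submodule k W \<and> verma_pi k ` R \<subseteq> W"
    then show "W = verma_pi k ` R \<or> W = verma_N k" using sub[of W] by fast
  qed
  moreover have "J = verma_pi k ` R" if "maximal_proper_submodule k J" for J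
  proof -
    have J: "verma_submodule k J" "J \<noteq> verma_N k"
      "verma_pi k ` R = J \<or> verma_pi k ` R = verma_N k"
      using that verma_submodule_pi[OF R(1)] sub[of J] unfolding maximal_proper_submodule_def by auto
    then show ?thesis using proper by simp
  qed
  ultimately show ?thesis by blast
qed

section \<open>The given vector and the instantiation of the abstract setting\<close>

context sl_hat begin

text \<open>\<open>Rv N 1 (-2)\<close> is the sum of \<open>E N p (-1) * E p 1 (-1)\<close> minus
  \<open>N / 2\<close> times \<open>E N 1 (-2)\<close>. For each of the \<open>N - 1\<close> indices
  \<open>p \<noteq> N\<close> the factors are exchanged, at the cost of one
  \<open>E N 1 (-2)\<close>; this leaves the coefficient
  \<open>N - 1 - N / 2 = (N - 2) / 2\<close>.\<close>

lemma singular_vector: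
  "- (E 1 1 (-1) + E N N (-1)) * E N 1 (-1) - (\<Sum>p\<in>{2..<N}. E p 1 (-1) * E N p (-1))
     - cst ((of_nat N - 2) / 2) * E N 1 (-2) + Rv N 1 (-2) \<in> K"
proof (rule dual_mem[OF K_ideal])
  fix f assume p: "f \<in> dual K"
  note pl = dual_lin[OF p]
  have I: "1 \<in> I" "N \<in> I" "1 \<noteq> N" "{2..<N} \<subseteq> I" using N_ge by (auto simp: idx_def)
  define X where "X = f (E N 1 (-2))"
  define Y where "Y p = f (E N p (-1) * E p 1 (-1))" for p
  have Idec: "I = insert 1 (insert N {2..<N})" using N_ge by (auto simp: idx_def)
  have swap: "f (E p 1 (-1) * E N p (-1)) = Y p - X" if "p \<in> I" for p
    using K_comm[OF p that I(1,2) that, of "-1" "-1" 1] I(3) by (simp add: kd_neq X_def Y_def)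
  have "{-2 + 1..<0} = {-1::int}" by auto
  then have "f (Rv N 1 (-2)) = (\<Sum>p\<in>I. Y p) - of_nat N / 2 * X"
    using dual_Rv[OF p, of 1 N 1 "-2"] dual_Qv[OF p, of 1 N 1 "-2"] I(3) by (simp add: kd_neq Y_def X_def)
  also have "(\<Sum>p\<in>I. Y p) = Y 1 + (Y N + (\<Sum>p\<in>{2..<N}. Y p))"
    unfolding Idec using I(3) N_ge by simp
  finally have R: "f (Rv N 1 (-2)) = Y 1 + (Y N + (\<Sum>p\<in>{2..<N}. Y p)) - of_nat N / 2 * X" .
  have "f (\<Sum>p\<in>{2..<N}. E p 1 (-1) * E N p (-1)) = (\<Sum>p\<in>{2..<N}. Y p - X)"
    unfolding pl using I(4) swap by (intro sum.cong) auto
  also have "\<dots> = (\<Sum>p\<in>{2..<N}. Y p) - (of_nat N - 2) * X"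
    using N_ge by (simp add: sum_subtractf of_nat_diff)
  finally have S2: "f (\<Sum>p\<in>{2..<N}. E p 1 (-1) * E N p (-1)) = (\<Sum>p\<in>{2..<N}. Y p) - (of_nat N - 2) * X" .
  have e: "- (A + B) * C = - (A * C) - B * C" for A B C :: 'u
    by (simp add: distrib_right left_diff_distrib)
  show "f (- (E 1 1 (-1) + E N N (-1)) * E N 1 (-1) - (\<Sum>p\<in>{2..<N}. E p 1 (-1) * E N p (-1))
     - cst ((of_nat N - 2) / 2) * E N 1 (-2) + Rv N 1 (-2)) = 0"
    unfolding e pl(1,2,3,5) S2 R swap[OF I(1)] X_def[symmetric] Y_def[of N, symmetric]
    by (simp add: field_simps)
qed

end

lemma uea_modes_induct:
  fixes u :: "'g::complex_lie_algebra_form affine uea"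
  assumes "P 1" and add: "\<And>x y. P x \<Longrightarrow> P y \<Longrightarrow> P (x + y)"
    and const: "\<And>\<alpha> x. P x \<Longrightarrow> P (uea_const \<alpha> * x)"
    and mode: "\<And>x n u. P u \<Longrightarrow> P (x\<langle>n\<rangle> * u)" and c: "\<And>u. P u \<Longrightarrow> P (uea_gen affine_c * u)"
  shows "P u"
proof (induction u rule: uea_induct)
  case (gen X u)
  have P0: "P 0" using const[OF assms(1), of 0] by simp
  have "P (uea_gen (Affine p 0) * u)" for p :: "int \<Rightarrow>\<^sub>0 'g"
  proof (induction p rule: loop_induct)
    case zero
    then show ?case using P0 by (simp add: zero_affine_def[symmetric])
  next
    case (single m x)
    then show ?case using mode[OF gen, of x m] by (simp add: tpow_def)
  next
    case (add p q)
    have "Affine (p + q) 0 = Affine p 0 + Affine q (0 :: complex)" by (simp add: plus_affine_def)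
    then show ?case using assms(2)[OF add] by (simp add: uea_gen_add distrib_right)
  qed
  moreover have "X = Affine (loop_part X) 0 + central_part X *\<^sub>C affine_c"
    by (cases X) (simp add: affine_c_def plus_affine_def scaleC_affine_def)
  then have "uea_gen X * u = uea_gen (Affine (loop_part X) 0) * u + uea_const (central_part X) * (uea_gen affine_c * u)"
    by (metis distrib_right mult.assoc uea_gen_add uea_gen_scale)
  ultimately show ?case using add const c[OF gen] by simp
qed (use assms in auto)

context serre_A begin

text \<open>Summation by parts: consecutive coefficients differ by \<open>2 / (l + 1)\<close>, so
  the inner diagonal units all get this factor. In \<open>h_sum\<close> the vanishing trace then
  leaves only the first and the last one.\<close>

lemma G_diag_sum:
  "(\<Sum>i=1..m. ((of_nat l - 2 * of_nat i + 1) / (of_nat l + 1)) *\<^sub>C (G (Suc i) (Suc i) - G i i)) =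
    ((of_nat l - 2 * of_nat m + 1) / (of_nat l + 1)) *\<^sub>C G (Suc m) (Suc m)
      + (2 / (of_nat l + 1)) *\<^sub>C (\<Sum>j=1..m. G j j) - G 1 1"
proof (induction m)
  case 0
  have n: "(of_nat l + 1 :: complex) \<noteq> 0" using of_nat_neq_0[of l] by (simp add: add.commute)
  have c: "(of_nat l - 2 * of_nat 0 + 1) / (of_nat l + 1) = (1 :: complex)"
    by (simp only: of_nat_0 mult_zero_right diff_zero divide_self[OF n])
  show ?case unfolding c by (simp add: scaleC_one)
next
  case (Suc m)
  let ?n = "of_nat l + 1 :: complex"
  have "(?n - 2 * of_nat m) / ?n = (?n - 2 * of_nat (Suc m)) / ?n + 2 / ?n"
    unfolding add_divide_distrib[symmetric] by (rule arg_cong[where f = "\<lambda>x. x / ?n"]) simp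
  then have "((of_nat l - 2 * of_nat m + 1) / ?n) *\<^sub>C x =
     ((of_nat l - 2 * of_nat (Suc m) + 1) / ?n) *\<^sub>C x + (2 / ?n) *\<^sub>C x" for x :: 'g
    by (simp only: scaleC_add_left[symmetric]) (simp add: algebra_simps)
  then show ?case
    using Suc by (simp add: scaleC_add_right cx.scale_right_diff_distrib algebra_simps del: of_nat_Suc)
qed

lemma h_sum:
  assumes "l \<ge> 1"
  shows "(\<Sum>i=1..l. ((of_nat l - 2 * of_nat i + 1) / (of_nat l + 1)) *\<^sub>C h i) = - (G 1 1 + G (l + 1) (l + 1))"
proof -
  have n: "(of_nat l + 1 :: complex) \<noteq> 0" using of_nat_neq_0[of l] by (simp add: add.commute)
  have tr: "(\<Sum>j=1..l. G j j) = - G (Suc l) (Suc l)"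
    using G_trace by (simp add: eq_neg_iff_add_eq_0)
  have c: "((of_nat l - 2 * of_nat l + 1) / (of_nat l + 1)) *\<^sub>C x - (2 / (of_nat l + 1)) *\<^sub>C x = - x" for x :: 'g
  proof -
    have "(of_nat l - 2 * of_nat l + 1) / (of_nat l + 1) - 2 / (of_nat l + 1) = (- 1 :: complex)"
    proof -
      have "(of_nat l - 2 * of_nat l + 1) - 2 = - (of_nat l + 1 :: complex)" by simp
      then show ?thesis
        by (simp only: diff_divide_distrib[symmetric] minus_divide_left[symmetric] divide_self[OF n])
    qed
    then show ?thesis by (simp only: cx.scale_left_diff_distrib[symmetric]) (simp add: scaleC_one)
  qed
  have "(\<Sum>i=1..l. ((of_nat l - 2 * of_nat i + 1) / (of_nat l + 1)) *\<^sub>C h i) =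
      (\<Sum>i=1..l. ((of_nat l - 2 * of_nat i + 1) / (of_nat l + 1)) *\<^sub>C (G (Suc i) (Suc i) - G i i))"
    by (intro sum.cong refl) (simp add: G_diag_step)
  also have "\<dots> = (((of_nat l - 2 * of_nat l + 1) / (of_nat l + 1)) *\<^sub>C G (Suc l) (Suc l)
      - (2 / (of_nat l + 1)) *\<^sub>C G (Suc l) (Suc l)) - G 1 1"
    unfolding G_diag_sum tr cx.scale_minus_right by (simp only: diff_conv_add_uminus)
  also have "\<dots> = - (G 1 1 + G (l + 1) (l + 1))"
    unfolding c by simp
  finally show ?thesis .
qed

end

lemma serre_sl_hat:
  fixes e f h :: "nat \<Rightarrow> 'g::complex_lie_algebra_form"
  assumes l: "l \<ge> 2" "even l" and A: "simple_type_A l e f h" and norm: "form_normalized l e h"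
    and k: "k = - (1 / 2) * (of_nat l + 1)"
  shows "sl_hat uea_const (l + 1) (\<lambda>a b n. (serre_A.G l e f h a b)\<langle>n\<rangle>) (uea_gen affine_c) k (verma_ker k) (vac k)"
proof -
  have chev: "chevalley_generators_A l e f h" and simple: "simple_lie_algebra TYPE('g)"
    using A by (auto simp: simple_type_A_def)
  have serre: "serre_A l e f h" by (rule chevalley_serre[OF chev])
  interpret serre_A l e f h by (rule serre)
  have gen: "S = UNIV" if "lie_subalgebra S" "e ` {1..l} \<subseteq> S" "f ` {1..l} \<subseteq> S" for S :: "'g set"
    using chev that unfolding chevalley_generators_A_def by blast
  have nonab: "\<exists>x y :: 'g. \<^bold>[x, y\<^bold>] \<noteq> 0"
    using simple by (simp add: simple_lie_algebra_def)
  have nonneg: "x \<otimes>t n \<in> affine_nonneg" if "n \<ge> 0" for x :: 'g and n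
    using that by (auto simp: affine_nonneg_def tpow_def lookup_single when_def)
  have c_nonneg: "affine_c \<in> affine_nonneg"
    by (simp add: affine_nonneg_def affine_c_def)
  show ?thesis
  proof
    fix a b c d :: nat and s t :: int
    assume I: "a \<in> idx (l + 1)" "b \<in> idx (l + 1)" "c \<in> idx (l + 1)" "d \<in> idx (l + 1)"
    let ?F = "kd b c * kd a d - kd a b * kd c d / of_nat (l + 1)"
    have br: "\<^bold>[G a b, G c d\<^bold>] = kd b c *\<^sub>C G a d - kd a d *\<^sub>C G c b"
      using I by (intro bracket_G) (auto simp: idx_def)
    have fm: "inv_form (G a b) (G c d) = ?F"
      using I by (intro serre_form[OF serre l(1) norm nonab gen]) (auto simp: idx_def)
    have "uea_gen (\<^bold>[G a b \<otimes>t s, G c d \<otimes>t t\<^bold>]) = (\<^bold>[G a b, G c d\<^bold>])\<langle>s + t\<rangle>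
        + uea_const (if s + t = 0 then of_int s * ?F else 0) * uea_gen affine_c"
      by (simp add: affine_bracket_tpow uea_gen_add uea_gen_scale fm)
    also have "(\<^bold>[G a b, G c d\<^bold>])\<langle>s + t\<rangle> = uea_const (kd b c) * (G a d)\<langle>s + t\<rangle> - uea_const (kd a d) * (G c b)\<langle>s + t\<rangle>"
      by (simp add: br mode_diff mode_scale)
    also have "(if s + t = 0 then of_int s * ?F else 0) = (if s + t = 0 then of_int s else 0) * ?F" by simp
    finally show "(G a b)\<langle>s\<rangle> * (G c d)\<langle>t\<rangle> = (G c d)\<langle>t\<rangle> * (G a b)\<langle>s\<rangle> + uea_const (kd b c) * (G a d)\<langle>s + t\<rangle>
      - uea_const (kd a d) * (G c b)\<langle>s + t\<rangle>
      + uea_const ((if s + t = 0 then of_int s else 0) * (kd b c * kd a d - kd a b * kd c d / of_nat (l + 1))) * uea_gen affine_c"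
      unfolding uea_gen_lie by (simp add: algebra_simps)
  next
    fix s
    show "(\<Sum>a\<in>idx (l + 1). (G a a)\<langle>s\<rangle>) = 0"
      using G_trace by (simp only: idx_def mode_sum[symmetric] mode_zero)
  next
    fix P :: "'g affine uea \<Rightarrow> bool" and u
    assume P: "P 1" and add: "\<And>x y. P x \<Longrightarrow> P y \<Longrightarrow> P (x + y)"
      and const: "\<And>\<alpha> x. P x \<Longrightarrow> P (uea_const \<alpha> * x)"
      and E: "\<And>a b s x. a \<in> idx (l + 1) \<Longrightarrow> b \<in> idx (l + 1) \<Longrightarrow> P x \<Longrightarrow> P ((G a b)\<langle>s\<rangle> * x)"
      and c: "\<And>x. P x \<Longrightarrow> P (uea_gen affine_c * x)"
    have P0: "P 0"
      using const[OF P, of 0] by simp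
    show "P u"
    proof (induction u rule: uea_modes_induct)
      case (4 x n u)
      show ?case
      proof (rule G_span[where P = "\<lambda>x. P (x\<langle>n\<rangle> * u)", OF gen])
        show "P ((G a b)\<langle>n\<rangle> * u)" if "a \<in> {1..l + 1}" "b \<in> {1..l + 1}" for a b
          using E[of a b u n] that 4 by (simp add: idx_def)
      qed (simp_all add: P0 mode_add mode_scale distrib_right mult.assoc add const)
    qed (use P add const c in auto)
  next
    fix a b :: nat and s :: int
    assume "0 \<le> s"
    then show "(G a b)\<langle>s\<rangle> \<in> verma_ker k"
      using verma_ker_nonneg[OF nonneg, of s "G a b" k] uea_const_add[of 0 0] by (simp add: vacuum_char_def tpow_def)
  next
    show "uea_gen affine_c - uea_const k \<in> verma_ker k"
      using verma_ker_nonneg[OF c_nonneg, of k] by (simp add: vacuum_char_def affine_c_def)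
  next
    fix a b :: nat and s :: int and x :: "'g affine uea"
    assume "s < 0"
    then have "nonneg_part (G a b \<otimes>t s) = 0"
      by (intro affine_eqI) (auto simp: lookup_nonneg_part affine_parts tpow_def lookup_single when_def)
    then show "vac k ((G a b)\<langle>s\<rangle> * x) = 0" by (rule vac_neg)
  next
    show "k = - of_nat (l + 1) / 2" unfolding k by (simp add: field_simps)
  next
    show "odd (l + 1)" "2 \<le> l + 1" using l by auto
  qed (fact uea_const_add uea_const_mult uea_const_one uea_const_central uea_gen_affine_c_central
      verma_ker_ideal vac_add vac_const vac_one vac_verma_ker)+
qed

theorem theorem4p3:
  fixes l :: nat and k :: complex
    and e f h :: "nat \<Rightarrow> 'g::complex_lie_algebra_form"
    and v :: "'g pre_verma set"
  assumes "l \<ge> 2" and "even l"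
    and "simple_type_A l e f h"
    and "form_normalized l e h"
    and "k = - (1 / 2) * (of_nat l + 1)"
    and "v = verma_act k
      ((\<Sum>i=1..l. uea_const ((of_nat l - 2 * of_nat i + 1) / (of_nat l + 1))
                   * (h i)\<langle>-1\<rangle> * (e_theta l e)\<langle>-1\<rangle>)
       - (\<Sum>i=1..l-1. (root_vec e 1 (i + 1))\<langle>-1\<rangle> * (root_vec e (i + 1) (l + 1))\<langle>-1\<rangle>)
       - uea_const ((1 / 2) * (of_nat l - 1)) * (e_theta l e)\<langle>-2\<rangle>)
      (vacuum k)"
  shows "(\<exists>!J :: 'g pre_verma set set. maximal_proper_submodule k J) \<and>
    verma_J k = {verma_act k u v | u. True}"
proof -
  have "serre_A l e f h"
    using assms(3) by (intro chevalley_serre) (simp add: simple_type_A_def)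
  then interpret serre_A l e f h .
  interpret sl_hat uea_const "l + 1" "\<lambda>a b n. (G a b)\<langle>n\<rangle>" "uea_gen affine_c" k "verma_ker k" "vac k"
    by (rule serre_sl_hat[OF assms(1-5)])
  define v0 where "v0 = (\<Sum>i=1..l. uea_const ((of_nat l - 2 * of_nat i + 1) / (of_nat l + 1))
                   * (h i)\<langle>-1\<rangle> * (e_theta l e)\<langle>-1\<rangle>)
       - (\<Sum>i=1..l-1. (root_vec e 1 (i + 1))\<langle>-1\<rangle> * (root_vec e (i + 1) (l + 1))\<langle>-1\<rangle>)
       - uea_const ((1 / 2) * (of_nat l - 1)) * (e_theta l e)\<langle>-2\<rangle>"
  have th: "e_theta l e = G (l + 1) 1" using assms(1) by (simp add: e_theta_def G_lower)
  have "(\<Sum>i=1..l. uea_const ((of_nat l - 2 * of_nat i + 1) / (of_nat l + 1)) * (h i)\<langle>-1\<rangle> * (e_theta l e)\<langle>-1\<rangle>) =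
      - ((G 1 1)\<langle>-1\<rangle> + (G (l + 1) (l + 1))\<langle>-1\<rangle>) * (G (l + 1) 1)\<langle>-1\<rangle>"
  proof -
    have "(\<Sum>i=1..l. uea_const ((of_nat l - 2 * of_nat i + 1) / (of_nat l + 1)) * (h i)\<langle>-1\<rangle>) =
        (- (G 1 1 + G (l + 1) (l + 1)))\<langle>-1\<rangle>"
      using assms(1) by (simp only: mode_scale[symmetric] mode_sum[symmetric] h_sum)
    also have "\<dots> = - ((G 1 1)\<langle>-1\<rangle> + (G (l + 1) (l + 1))\<langle>-1\<rangle>)"
      using mode_diff[of 0 "G 1 1 + G (l + 1) (l + 1)" "-1"] by (simp add: mode_add)
    finally show ?thesis by (simp only: sum_distrib_right[symmetric] th)
  qed
  moreover have "(\<Sum>i=1..l-1. (root_vec e 1 (i + 1))\<langle>-1\<rangle> * (root_vec e (i + 1) (l + 1))\<langle>-1\<rangle>) =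
      (\<Sum>p\<in>{2..<l + 1}. (G p 1)\<langle>-1\<rangle> * (G (l + 1) p)\<langle>-1\<rangle>)"
    by (rule sum.reindex_bij_witness[where i = "\<lambda>p. p - 1" and j = "\<lambda>i. i + 1"]) (auto simp: G_lower)
  moreover have "(1 / 2) * (of_nat l - 1) = (of_nat (l + 1) - 2) / (2 :: complex)" by simp
  ultimately have "v0 + Rv (l + 1) 1 (-2) \<in> verma_ker k"
    using singular_vector unfolding v0_def th by (simp only:)
  then have rad: "radical = {x + u * v0 | x u. x \<in> verma_ker k}" by (rule radical_generated)
  have v: "v = verma_pi k v0"
    using assms(6) by (simp only: v0_def[symmetric] vacuum_pi verma_act_pi mult_1_right)
  have max: "maximal_proper_submodule k J \<longleftrightarrow> J = verma_pi k ` radical" for J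
    by (rule verma_maximal[OF radical_ideal K_radical radical_proper radical_greatest])
  then have "verma_J k = verma_pi k ` radical"
    unfolding verma_J_def by (intro the_equality) auto
  also have "\<dots> = {verma_act k u v | u. True}"
  proof -
    have "verma_pi k (x + u * v0) = verma_pi k (u * v0)" if "x \<in> verma_ker k" for x u
      using that by (simp add: verma_pi_eq)
    then have "verma_pi k ` radical \<subseteq> {verma_pi k (u * v0) | u. True}"
      unfolding rad by blast
    moreover have "{verma_pi k (u * v0) | u. True} \<subseteq> verma_pi k ` radical"
    proof
      fix y assume "y \<in> {verma_pi k (u * v0) | u. True}"
      then obtain u where "y = verma_pi k (0 + u * v0)" by auto
      moreover have "0 + u * v0 \<in> radical" unfolding rad using ideal_zero[OF K_ideal] by blast
      ultimately show "y \<in> verma_pi k ` radical" by blast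
    qed
    ultimately show ?thesis unfolding v verma_act_pi by (rule equalityI)
  qed
  finally have "verma_J k = {verma_act k u v | u. True}" .
  moreover have "\<exists>!J :: 'g pre_verma set set. maximal_proper_submodule k J"
    unfolding max by (rule ex1I) (rule refl)
  ultimately show ?thesis by (intro conjI)
qed

end
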